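(* Let $\check R(z)=\check R^{\tilde L_1,\tilde L_1}(z)$ be the normalized intertwiner for the $7$-dimensional first fundamental module of the quantum affine algebra of type $G_2^{(1)}$. In terms of projectors for the $U_q(G_2)$-decomposition $L_{\omega_1}\otimes L_{\omega_1}\cong L_{2\omega_1}\oplus L_{\omega_2}\oplus L_{\omega_1}\oplus L_{\omega_0}$, $$\check R(z)=P_{2\omega_1}^q-q^{-2}\frac{1-q^2z}{1-q^{-2}z}P_{\omega_2}^q-q^{-8}\frac{1-q^8z}{1-q^{-8}z}P_{\omega_1}^q+q^{-14}\frac{(1-q^2z)(1-q^{12}z)}{(1-q^{-2}z)(1-q^{-12}z)}P_{\omega_0}^q.$$ In terms of matrix units, $$\check R(z)=\big(\check R(z)\big)_{\mathfrak{sl}_7}+\frac{(q-q^{-1})(1-z)}{(q-q^{-1}z)(q^4-q^{-4}z)}S(z)-\frac{(q-q^{-1})(q^2+q^{-2})(1-z)}{(q-q^{-1}z)(q^6-q^{-6}z)}Q(z),$$ where $$\big(\check R(z)\big)_{\mathfrak{sl}_{7}}=\sum_{i}E_{ii}\otimes E_{ii}+\frac{z(q-q^{-1})}{q-q^{-1}z}\sum_{i<j}E_{ii}\otimes E_{jj}+\frac{q-q^{-1}}{q-q^{-1}z}\sum_{i>j}E_{ii}\otimes E_{jj}+\frac{1-z}{q-q^{-1}z}\sum_{i\neq j}E_{ij}\otimes E_{ji}$$ (indices from $1$ to $7$), and $$S(z)=G_{\omega_1}\Big(zq^{-4},\,q^4,\,\tfrac{q^{7/2}+q^{-7/2}z}{q^{1/2}+q^{-1/2}},\,\tfrac{q^3+q^{-3}z}{q+q^{-1}};\,\mu\Big),$$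 $$Q(z)=G_{\omega_0}\Big(zq^{-6},\,q^6,\,\tfrac{q^7-q^5+q^4+(q^{-4}-q^{-5}+q^{-7})z}{q^2+q^{-2}},\,\tfrac{q^4+q^{-4}z}{q^2+q^{-2}};\,p\Big),$$ with the operators $G_\lambda$ and the coordinates $\mu,p$ defined in the context.
   Context: Conventions. $q\in\mathbb C^\times$ is not a root of unity; $q^{1/2}$ is fixed. $[2]=q+q^{-1}$, $[2]^{\mathrm i}=q-q^{-1}$. The affine Dynkin diagram $G_2^{(1)}$ is $0-2\Rrightarrow1$: $\alpha_0,\alpha_2$ long, $\alpha_1$ short; $d_0=d_2=3$, $d_1=1$, $q_i=q^{d_i}$, $\tilde B_{ij}=d_i\tilde C_{ij}$ with $\tilde C$ the affine Cartan matrix. $U_q\tilde{\mathfrak g}$ (level zero) has generators $E_i,F_i,K_i^{\pm1}$, $0\le i\le2$, with commuting $K_i$, $K_iE_jK_i^{-1}=q^{\tilde B_{ij}}E_j$, $K_iF_jK_i^{-1}=q^{-\tilde B_{ij}}F_j$, $[E_i,F_j]=\delta_{ij}\frac{K_i-K_i^{-1}}{q_i-q_i^{-1}}$, $q$-Serre relations, $\prod K_i^{a_i}=1$ ($a_i$ relatively prime positive integers with $\tilde Ca^t=0$). Coproduct: $\Delta K_i=K_i\otimes K_i$, $\Delta E_i=E_i\otimes K_i^{1/2}+K_i^{-1/2}\otimes E_i$, $\Delta F_i=F_i\otimes K_i^{1/2}+K_i^{-1/2}\otimes F_i$. $U_q(G_2)$ is generated by the generators with $i\ne0$; $L_\lambda$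 is its irreducible module of highest weight $\lambda$; $\omega_0=0$. The module $V(a)=\tilde L_1(a)$ has basis $v_1,\dots,v_7$ and is $L_{\omega_1}$ over $U_q(G_2)$, with $v_1$ of highest weight and $v_4$ of weight zero: $F_1v_1=v_2$, $F_2v_2=v_3$, $F_1v_3=\sqrt{[2]}v_4$, $F_1v_4=\sqrt{[2]}v_5$, $F_2v_5=v_6$, $F_1v_6=v_7$, other $F_kv_i=0$ ($k=1,2$); $E_k$ is the transpose of $F_k$. $E_0(a)=a(E_{61}+E_{72})$, i.e. $v_1\mapsto av_6$, $v_2\mapsto av_7$, others $\mapsto0$; $F_0(a)$ is the transpose of $a^{-2}E_0(a)$; $K_0$ is $q^{-3}$ on $v_1,v_2$, $q^3$ on $v_6,v_7$, $1$ on $v_3,v_4,v_5$. Matrix units: $E_{ij}v_k=\delta_{jk}v_i$. $\check R(z)\in\mathrm{End}(V\otimes V)$ is the unique operator, rational in $z$, which for generic $z$ intertwines $V(z)\otimes V(1)\to V(1)\otimes V(z)$ and fixes $v_1\otimes v_1$. $P^q_\lambda$ is the projector onto $L_\lambda$ along the other summands. Operators $G_\lambda$. Given ordered lists $I_s^\lambda$, $1\le s\le\dim L_\lambda$, of pairs, with $|(i,j)|$ the position of $(i,j)$ in $I_s^\lambda$ and $|I_s^\lambda|$ its cardinality, and coordinates $\sigma=(\sigma^{q,s}_{ij})$, set $G_\lambda(a_-,a_+,a_0^{(1)},a_0^{(2)};\sigma)=\sum_s\Big(a_-\sum_<+a_+\sum_>+a_0^{(1)}\sum_{=,1}+a_0^{(2)}\sum_{=,2}\Big)\sigma^{q,s}_{ik}\sigma^{q,s}_{jl}E_{ij}\otimes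 E_{kl}$, sums over $(i,k),(j,l)\in I_s^\lambda$ with $|(i,k)|+|(j,l)|$ smaller than (in $\sum_<$), greater than ($\sum_>$), equal to ($\sum_{=,1},\sum_{=,2}$) $|I_s^\lambda|+1$. For $\lambda=\omega_0$: $\sum_{=,1}$ is over those for which both $v_i,v_k$ have weight $0$, and $\sum_{=,2}$ over those for which neither has weight $0$. For $\lambda=\omega_1$: $\sum_{=,1}$ is over those for which one of $v_i,v_k$ has weight $0$ or $v_i\otimes v_k$ has weight $0$, and $\sum_{=,2}$ over those for which none of $v_i,v_k,v_i\otimes v_k$ has weight $0$. $\lambda=\omega_0$: one list $I^{\omega_0}=((1,7),(2,6),\dots,(7,1))$; the coordinates $p_{i,8-i}$, $i=1,\dots,7$, are $q^5,-q^4,q,-1,q^{-1},-q^{-4},q^{-5}$. $\lambda=\omega_1$: $\mu^{q,s}_{ij}=-\mu^{q^{-1},s}_{ji}$ (with $q^{1/2}\to q^{-1/2}$, $\sqrt{[2]}$ unchanged). For $s\neq4$, $I_s^{\omega_1}$ has $4$ elements: the two listed pairs at positions $1,2$, and $(j,i)$ at position $5-|(i,j)|$; values of $\mu^{q,s}_{ij}$ at the listed pairs: $s=1$: (1,4),(2,3), values $q^3,-q^{3/2}\sqrt{[2]}$; $s=2$: (1,5),(2,4), values $q^{5/2}\sqrt{[2]},-q$; $s=3$: (1,6),(3,4), values $q^{5/2}\sqrt{[2]},-q$; $s=5$: (2,7),(4,5), values $q^{5/2}\sqrt{[2]},-q$; $s=6$: (3,7),(4,6), values $q^{5/2}\sqrt{[2]},-q$;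 $s=7$: (4,7),(5,6), values $q^3,-q^{3/2}\sqrt{[2]}$. For $s=4$: $I_4^{\omega_1}=((1,7),(2,6),\dots,(7,1))$ with $\mu_{17}^{q,4}=q^2$, $\mu_{26}^{q,4}=q^3$, $\mu_{35}^{q,4}=-1$, $\mu_{44}^{q,4}=-[2]^{\mathrm i}$. *)

theory Defs
  imports "HOL-Analysis.Analysis" "HOL-Computational_Algebra.Polynomial"
begin

section \<open>Matrices\<close>

text \<open>
  Throughout, \<open>h\<close> stands for \<open>q\<^sup>1\<^sup>/\<^sup>2\<close> (so \<open>q = h\<^sup>2\<close>) and \<open>t\<close> for the fixed square root of
  \<open>[2] = q + q\<^sup>-\<^sup>1\<close>. The basis vector \<open>v\<^sub>i\<close> of the module, \<open>1 \<le> i \<le> 7\<close>, is the coordinate vector of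
  index \<open>of_nat i\<close> in the type \<open>7\<close>. The indices themselves are kept as natural numbers because
  \<open>of_nat 7 = (0 :: 7)\<close>, so that the order of the type \<open>7\<close> is not that of the indices.
\<close>

type_synonym 'n cmat = "complex ^ 'n ^ 'n"

definition smult_mat :: "complex \<Rightarrow> 'n::finite cmat \<Rightarrow> 'n cmat" (infixr \<open>*\<^sub>c\<close> 75) where
  "c *\<^sub>c A = (\<chi> i j. c * A $ i $ j)"

definition kron :: "'m::finite cmat \<Rightarrow> 'n::finite cmat \<Rightarrow> ('m \<times> 'n) cmat" (infixr \<open>\<otimes>\<close> 78) where
  "A \<otimes> B = (\<chi> r c. A $ fst r $ fst c * B $ snd r $ snd c)"

text \<open>The powers \<open>A ^ n\<close> of the library are entrywise on this type.\<close>

definition mat_pow :: "'n::finite cmat \<Rightarrow> nat \<Rightarrow> 'n cmat" where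
  "mat_pow A n = (((**) A) ^^ n) (mat 1)"

definition mat_unit :: "nat \<Rightarrow> nat \<Rightarrow> 7 cmat" where
  "mat_unit i j = (\<chi> r c. if r = of_nat i \<and> c = of_nat j then 1 else 0)"

definition bas2 :: "nat \<Rightarrow> nat \<Rightarrow> complex ^ (7 \<times> 7)" where
  "bas2 i j = axis (of_nat i, of_nat j) 1"


section \<open>Modules over the quantum affine algebra\<close>

text \<open>
  A module is given by the action of the generators, with \<open>Kh i m\<close> the action of \<open>K\<^sub>i\<^sup>m\<^sup>/\<^sup>2\<close>.
  Since \<open>K\<^sub>i\<close> acts diagonalizably with eigenvalues in \<open>q\<^sup>\<int>\<close>, the square root is the one with
  eigenvalue \<open>h\<^sup>n\<close> where \<open>K\<^sub>i\<close> has eigenvalue \<open>q\<^sup>n\<close>.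
\<close>

record 'n Uq_rep =
  Eop :: "nat \<Rightarrow> 'n cmat"
  Fop :: "nat \<Rightarrow> 'n cmat"
  Kh :: "nat \<Rightarrow> int \<Rightarrow> 'n cmat"

definition dsym :: "nat \<Rightarrow> nat" where
  "dsym i = [3, 1, 3] ! i"

definition cartan :: "nat \<Rightarrow> nat \<Rightarrow> int" where
  "cartan i j = [[2, 0, -1], [0, 2, -3], [-1, -1, 2]] ! i ! j"

definition qint :: "complex \<Rightarrow> nat \<Rightarrow> complex" where
  "qint x n = (x ^ n - inverse x ^ n) / (x - inverse x)"

definition qfact :: "complex \<Rightarrow> nat \<Rightarrow> complex" where
  "qfact x n = (\<Prod>k=1..n. qint x k)"

definition qbinom :: "complex \<Rightarrow> nat \<Rightarrow> nat \<Rightarrow> complex" where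
  "qbinom x n k = qfact x n / (qfact x k * qfact x (n - k))"

definition serre :: "complex \<Rightarrow> (nat \<Rightarrow> 'n::finite cmat) \<Rightarrow> nat \<Rightarrow> nat \<Rightarrow> bool" where
  "serre q X i j \<longleftrightarrow> (let n = nat (1 - cartan i j) in
     (\<Sum>r=0..n. ((-1) ^ r * qbinom (q ^ dsym i) n r) *\<^sub>c
        (mat_pow (X i) (n - r) ** X j ** mat_pow (X i) r)) = 0)"

text \<open>
  The defining relations at level zero; the exponents in the last one are
  \<open>(a\<^sub>0, a\<^sub>1, a\<^sub>2) = (1, 3, 2)\<close>.
\<close>

definition Uq_relations :: "complex \<Rightarrow> 'n::finite Uq_rep \<Rightarrow> bool" where
  "Uq_relations h \<rho> \<longleftrightarrow>
     (\<forall>i\<le>2. Kh \<rho> i 0 = mat 1 \<and> (\<forall>m n. Kh \<rho> i (m + n) = Kh \<rho> i m ** Kh \<rho> i n)) \<and>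
     (\<forall>i\<le>2. \<forall>j\<le>2.
        Kh \<rho> i 1 ** Kh \<rho> j 1 = Kh \<rho> j 1 ** Kh \<rho> i 1 \<and>
        Kh \<rho> i 2 ** Eop \<rho> j ** Kh \<rho> i (-2) = (h\<^sup>2 powi (int (dsym i) * cartan i j)) *\<^sub>c Eop \<rho> j \<and>
        Kh \<rho> i 2 ** Fop \<rho> j ** Kh \<rho> i (-2) = (h\<^sup>2 powi (- int (dsym i) * cartan i j)) *\<^sub>c Fop \<rho> j \<and>
        Eop \<rho> i ** Fop \<rho> j - Fop \<rho> j ** Eop \<rho> i =
          (if i = j
           then inverse ((h\<^sup>2) ^ dsym i - inverse ((h\<^sup>2) ^ dsym i)) *\<^sub>c (Kh \<rho> i 2 - Kh \<rho> i (-2))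
           else 0) \<and>
        (i \<noteq> j \<longrightarrow> serre (h\<^sup>2) (Eop \<rho>) i j \<and> serre (h\<^sup>2) (Fop \<rho>) i j)) \<and>
     Kh \<rho> 0 2 ** mat_pow (Kh \<rho> 1 2) 3 ** mat_pow (Kh \<rho> 2 2) 2 = mat 1"

text \<open>Coproduct:\<close>

definition tensor_rep ::
  "'m::finite Uq_rep \<Rightarrow> 'n::finite Uq_rep \<Rightarrow> ('m \<times> 'n) Uq_rep" where
  "tensor_rep \<rho> \<rho>' =
     \<lparr> Eop = (\<lambda>i. Eop \<rho> i \<otimes> Kh \<rho>' i 1 + Kh \<rho> i (-1) \<otimes> Eop \<rho>' i),
       Fop = (\<lambda>i. Fop \<rho> i \<otimes> Kh \<rho>' i 1 + Kh \<rho> i (-1) \<otimes> Fop \<rho>' i),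
       Kh = (\<lambda>i m. Kh \<rho> i m \<otimes> Kh \<rho>' i m) \<rparr>"

definition intertwines :: "'n::finite Uq_rep \<Rightarrow> 'n Uq_rep \<Rightarrow> 'n cmat \<Rightarrow> bool" where
  "intertwines \<rho> \<rho>' A \<longleftrightarrow>
     (\<forall>i\<le>2. A ** Eop \<rho> i = Eop \<rho>' i ** A \<and> A ** Fop \<rho> i = Fop \<rho>' i ** A \<and>
       A ** Kh \<rho> i 2 = Kh \<rho>' i 2 ** A \<and> A ** Kh \<rho> i (-2) = Kh \<rho>' i (-2) ** A)"


section \<open>The module \<open>V(a)\<close>\<close>

text \<open>
  \<open>K\<^sub>i v\<^sub>j = q\<^bsup>kexp i j\<^esup> v\<^sub>j\<close>. The rows \<open>i = 1, 2\<close> follow from the weights of \<open>L\<^bsub>\<omega>1\<^esub>\<close>: with \<open>v\<^sub>1\<close>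
  of weight \<open>\<omega>\<^sub>1\<close>, applying \<open>F\<^sub>1\<close> multiplies the eigenvalues of \<open>K\<^sub>1, K\<^sub>2\<close> by \<open>q\<^sup>-\<^sup>2, q\<^sup>3\<close>, and
  applying \<open>F\<^sub>2\<close> multiplies them by \<open>q\<^sup>3, q\<^sup>-\<^sup>6\<close>.
\<close>

definition kexp :: "nat \<Rightarrow> nat \<Rightarrow> int" where
  "kexp i j = [[-3, -3, 0, 0, 0, 3, 3],
               [1, -1, 2, 0, -2, 1, -1],
               [0, 3, -3, 0, 3, -3, 0]] ! i ! (j - 1)"

definition V_F :: "complex \<Rightarrow> nat \<Rightarrow> 7 cmat" where
  "V_F t k =
     (if k = 1 then mat_unit 2 1 + t *\<^sub>c mat_unit 4 3 + t *\<^sub>c mat_unit 5 4 + mat_unit 7 6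
      else mat_unit 3 2 + mat_unit 6 5)"

definition V_E0 :: "complex \<Rightarrow> 7 cmat" where
  "V_E0 a = a *\<^sub>c (mat_unit 6 1 + mat_unit 7 2)"

definition V_rep :: "complex \<Rightarrow> complex \<Rightarrow> complex \<Rightarrow> 7 Uq_rep" where
  "V_rep h t a =
     \<lparr> Eop = (\<lambda>i. if i = 0 then V_E0 a else transpose (V_F t i)),
       Fop = (\<lambda>i. if i = 0 then transpose ((a powi (-2)) *\<^sub>c V_E0 a) else V_F t i),
       Kh = (\<lambda>i m. \<Sum>j=1..7. (h powi (m * kexp i j)) *\<^sub>c mat_unit j j) \<rparr>"

text \<open>These matrices do satisfy the relations; this is proved in \<open>V_rep_relations\<close>.\<close>

lemma exhaust_7: fixes x :: 7 shows "x = 1 \<or> x = 2 \<or> x = 3 \<or> x = 4 \<or> x = 5 \<or> x = 6 \<or> x = 7"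
proof (induct x)
  case (of_int z)
  then have "0 \<le> z" "z < 7" by simp_all
  then have "z = 0 \<or> z = 1 \<or> z = 2 \<or> z = 3 \<or> z = 4 \<or> z = 5 \<or> z = 6" by arith
  then show ?case by (elim disjE; simp)
qed

lemma forall_7: "(\<forall>x::7. P x) \<longleftrightarrow> P 1 \<and> P 2 \<and> P 3 \<and> P 4 \<and> P 5 \<and> P 6 \<and> P 7"
proof
  assume "P 1 \<and> P 2 \<and> P 3 \<and> P 4 \<and> P 5 \<and> P 6 \<and> P 7"
  then show "\<forall>x::7. P x" using exhaust_7 by (intro allI) (metis (full_types))
qed blast

lemma atLeastAtMost_7: "{Suc 0..7} = {Suc 0,2,3,4,5,6,7}" by auto

lemma mat_unit_mult: "mat_unit i j ** mat_unit k l = (if (of_nat j::7) = of_nat k then mat_unit i l else 0)"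
proof -
  have "(mat_unit i j ** mat_unit k l) $ r $ c = (if (of_nat j::7) = of_nat k then mat_unit i l else 0) $ r $ c" for r c
  proof -
    have "(mat_unit i j ** mat_unit k l) $ r $ c
      = (\<Sum>m\<in>(UNIV::7 set). if m = of_nat j then (if r = of_nat i \<and> (of_nat j::7) = of_nat k \<and> c = of_nat l then 1 else 0) else 0)"
      unfolding matrix_matrix_mult_def mat_unit_def vec_lambda_beta by (rule sum.cong) auto
    then show ?thesis by (simp add: mat_unit_def)
  qed
  then show ?thesis by (simp add: vec_eq_iff)
qed

lemma transpose_mat_unit: "transpose (mat_unit i j) = mat_unit j i" by (auto simp: transpose_def mat_unit_def vec_eq_iff)

lemma transpose_linear: "transpose (c *\<^sub>c A) = c *\<^sub>c transpose A" "transpose (A + B :: 'n::finite cmat) = transpose A + transpose B"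
  by (auto simp: transpose_def smult_mat_def vec_eq_iff)

lemma smult_mat_simps: "(c *\<^sub>c A) ** B = c *\<^sub>c (A ** B)" "A ** (c *\<^sub>c B) = c *\<^sub>c (A ** B)" "c *\<^sub>c (A + B) = c *\<^sub>c A + c *\<^sub>c B"
  "c *\<^sub>c (d *\<^sub>c A) = (c * d) *\<^sub>c A" "c *\<^sub>c 0 = 0" "c *\<^sub>c (A - B) = c *\<^sub>c A - c *\<^sub>c B"
  by (auto simp: smult_mat_def matrix_matrix_mult_def vec_eq_iff sum_distrib_left algebra_simps)

lemma mat_1_7: "(mat 1 :: 7 cmat) = mat_unit 1 1 + mat_unit 2 2 + mat_unit 3 3 + mat_unit 4 4 + mat_unit 5 5 + mat_unit 6 6 + mat_unit 7 7"
  by (simp add: vec_eq_iff mat_def mat_unit_def forall_7)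

lemma mat_mult_zero: "0 ** (A:: 'n::finite cmat) = 0" "A ** (0:: 'n::finite cmat) = 0"
  by (auto simp: matrix_matrix_mult_def vec_eq_iff)

lemma mat_mult_diff: "(A - B) ** (C:: 'n::finite cmat) = A ** C - B ** C" "C ** (A - B) = C ** A - C ** (B:: 'n::finite cmat)"
  by (simp_all add: matrix_matrix_mult_def vec_eq_iff algebra_simps sum_subtractf)

lemma mat_mult_add: "(A + B) ** (C:: 'n::finite cmat) = A ** C + B ** C" "C ** (A + B) = C ** A + C ** (B:: 'n::finite cmat)"
  by (simp_all add: matrix_matrix_mult_def vec_eq_iff algebra_simps sum.distrib)

lemmas mat_expand = mat_unit_mult transpose_mat_unit transpose_linear smult_mat_simps mat_mult_zero mat_mult_add mat_mult_diff

lemma all_le_2_iff: "(\<forall>i\<le>2. P i) \<longleftrightarrow> P 0 \<and> P (Suc 0) \<and> P (2::nat)"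
  using le_Suc_eq numeral_2_eq_2 by (auto simp: le_Suc_eq numeral_2_eq_2)

lemma smult_mat_scalar: "0 *\<^sub>c A = 0" "1 *\<^sub>c A = A" "(-c) *\<^sub>c A = - (c *\<^sub>c A)"
  by (auto simp: smult_mat_def vec_eq_iff)

definition kdiag :: "(nat \<Rightarrow> complex) \<Rightarrow> 7 cmat" where "kdiag f = (\<Sum>j=1..7. f j *\<^sub>c mat_unit j j)"

lemma kdiag_mult_unit: "j \<in> {1,2,3,4,5,6,7} \<Longrightarrow> kdiag f ** mat_unit j k = f j *\<^sub>c mat_unit j k"
  by (auto simp: kdiag_def atLeastAtMost_7 mat_expand)

lemma unit_mult_kdiag: "j \<in> {1,2,3,4,5,6,7} \<Longrightarrow> mat_unit k j ** kdiag f = f j *\<^sub>c mat_unit k j"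
  by (auto simp: kdiag_def atLeastAtMost_7 mat_expand)

lemma kdiag_mult: "kdiag f ** kdiag g = kdiag (\<lambda>j. f j * g j)"
  by (simp add: kdiag_def atLeastAtMost_7 mat_expand mult.commute)

lemma kdiag_one: "kdiag (\<lambda>j. 1) = mat 1"
  by (simp add: kdiag_def atLeastAtMost_7 mat_1_7 smult_mat_scalar)

lemma kdiag_cong: "(\<And>j. 1 \<le> j \<Longrightarrow> j \<le> 7 \<Longrightarrow> f j = g j) \<Longrightarrow> kdiag f = kdiag g"
  unfolding kdiag_def by (rule sum.cong) auto

lemma cartan_values: "cartan 0 0 = 2" "cartan 0 (Suc 0) = 0" "cartan 0 2 = -1" "cartan (Suc 0) 0 = 0" "cartan (Suc 0) (Suc 0) = 2" "cartan (Suc 0) 2 = -3"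
 "cartan 2 0 = -1" "cartan 2 (Suc 0) = -1" "cartan 2 2 = 2" "dsym 0 = 3" "dsym (Suc 0) = 1" "dsym 2 = 3"
  by (simp_all add: cartan_def dsym_def)

lemma V_rep_simps: "Eop (V_rep h t a) 0 = a *\<^sub>c (mat_unit 6 1 + mat_unit 7 2)"
  "Eop (V_rep h t a) (Suc 0) = mat_unit 1 2 + t *\<^sub>c mat_unit 3 4 + t *\<^sub>c mat_unit 4 5 + mat_unit 6 7"
  "Eop (V_rep h t a) 2 = mat_unit 2 3 + mat_unit 5 6"
  "Fop (V_rep h t a) 0 = (a powi (-2) * a) *\<^sub>c (mat_unit 1 6 + mat_unit 2 7)"
  "Fop (V_rep h t a) (Suc 0) = mat_unit 2 1 + t *\<^sub>c mat_unit 4 3 + t *\<^sub>c mat_unit 5 4 + mat_unit 7 6"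
  "Fop (V_rep h t a) 2 = mat_unit 3 2 + mat_unit 6 5"
  "Kh (V_rep h t a) i m = kdiag (\<lambda>j. h powi (m * kexp i j))"
  by (simp_all add: V_rep_def V_E0_def V_F_def mat_expand kdiag_def del: One_nat_def) 

lemma V_KE: assumes "h \<noteq> 0" shows "\<forall>i\<le>2. \<forall>j\<le>2. Kh (V_rep h t a) i 2 ** Eop (V_rep h t a) j ** Kh (V_rep h t a) i (-2) = (h\<^sup>2 powi (int (dsym i) * cartan i j)) *\<^sub>c Eop (V_rep h t a) j"
  using assms unfolding all_le_2_iff
  by (simp add: V_rep_simps mat_expand kdiag_mult_unit unit_mult_kdiag kexp_def cartan_values smult_mat_scalar)
    (simp add: power_int_def field_simps smult_mat_scalar)

lemma V_KF: assumes "h \<noteq> 0" shows "\<forall>i\<le>2. \<forall>j\<le>2. Kh (V_rep h t a) i 2 ** Fop (V_rep h t a) j ** Kh (V_rep h t a) i (-2) = (h\<^sup>2 powi (- int (dsym i) * cartan i j)) *\<^sub>c Fop (V_rep h t a) j"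
  using assms unfolding all_le_2_iff
  by (simp add: V_rep_simps mat_expand kdiag_mult_unit unit_mult_kdiag kexp_def cartan_values smult_mat_scalar)
    (simp add: power_int_def field_simps smult_mat_scalar)

lemma mat_pow_simps: "mat_pow A 0 = mat 1" "mat_pow A (Suc n) = A ** mat_pow A n" by (simp_all add: mat_pow_def)

lemma sum_upto: "sum f {0..2::nat} = f 0 + f 1 + f 2"  "sum f {0..4::nat} = f 0 + f 1 + f 2 + f 3 + f 4" "sum f {0..1::nat} = f 0 + f 1"
  by (simp_all add: eval_nat_numeral)

lemma mat_pow_numeral: "mat_pow A 1 = A" "mat_pow A 2 = A ** A" "mat_pow A 3 = A ** (A ** A)" "mat_pow A 4 = A ** (A ** (A ** A))"
  by (simp_all add: mat_pow_simps eval_nat_numeral)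

lemma qbinom_1: "qbinom x (Suc 0) (Suc 0) = qbinom x (Suc 0) 0" by (simp add: qbinom_def mult.commute)

lemma smult_mat_add: "c *\<^sub>c A + d *\<^sub>c A = (c + d) *\<^sub>c A" by (simp add: smult_mat_def vec_eq_iff algebra_simps)

lemma V_serre_E: "\<forall>i\<le>2. \<forall>j\<le>2. i \<noteq> j \<longrightarrow> serre q (Eop (V_rep h t a)) i j"
  unfolding all_le_2_iff
  by (simp add: V_rep_simps serre_def cartan_values sum_upto mat_pow_numeral mat_pow_simps mat_expand qbinom_1 smult_mat_add smult_mat_scalar)

lemma V_serre_F: "\<forall>i\<le>2. \<forall>j\<le>2. i \<noteq> j \<longrightarrow> serre q (Fop (V_rep h t a)) i j"
  unfolding all_le_2_iff
  by (simp add: V_rep_simps serre_def cartan_values sum_upto mat_pow_numeral mat_pow_simps mat_expand qbinom_1 smult_mat_add smult_mat_scalar)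

lemma V_Kh_0: "Kh (V_rep h t a) i 0 = mat 1" by (simp add: V_rep_simps kdiag_one)

lemma V_Kh_add: "h \<noteq> 0 \<Longrightarrow> Kh (V_rep h t a) i (m + n) = Kh (V_rep h t a) i m ** Kh (V_rep h t a) i n"
  by (simp add: V_rep_simps kdiag_mult distrib_right power_int_add)

lemma V_Kh_comm: "Kh (V_rep h t a) i m ** Kh (V_rep h t a) j n = Kh (V_rep h t a) j n ** Kh (V_rep h t a) i m"
  by (simp add: V_rep_simps kdiag_mult mult.commute)

lemma V_Kh_level_zero: assumes "h \<noteq> 0" shows "Kh (V_rep h t a) 0 2 ** mat_pow (Kh (V_rep h t a) 1 2) 3 ** mat_pow (Kh (V_rep h t a) 2 2) 2 = mat 1"
proof -
  have "kdiag (\<lambda>j. h powi (2 * kexp 0 j) * (h powi (2 * kexp (Suc 0) j) * (h powi (2 * kexp (Suc 0) j) * h powi (2 * kexp (Suc 0) j))) * (h powi (2 * kexp 2 j) * h powi (2 * kexp 2 j))) = kdiag (\<lambda>j. 1)"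
  proof (rule kdiag_cong)
    fix j :: nat assume "1 \<le> j" "j \<le> 7"
    then have "j = 1 \<or> j = 2 \<or> j = 3 \<or> j = 4 \<or> j = 5 \<or> j = 6 \<or> j = 7" by auto
    then show "h powi (2 * kexp 0 j) * (h powi (2 * kexp (Suc 0) j) * (h powi (2 * kexp (Suc 0) j) * h powi (2 * kexp (Suc 0) j))) * (h powi (2 * kexp 2 j) * h powi (2 * kexp 2 j)) = 1"
      using assms by (elim disjE) (simp_all add: kexp_def power_int_def field_simps flip: power_add)
  qed
  then show ?thesis by (simp add: V_rep_simps mat_pow_numeral kdiag_mult kdiag_one)
qed

lemma V_EF: assumes "h \<noteq> 0" "\<forall>n>0. (h\<^sup>2) ^ n \<noteq> 1" "a \<noteq> 0" "t\<^sup>2 = h\<^sup>2 + inverse (h\<^sup>2)"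
  shows "\<forall>i\<le>2. \<forall>j\<le>2. Eop (V_rep h t a) i ** Fop (V_rep h t a) j - Fop (V_rep h t a) j ** Eop (V_rep h t a) i =
          (if i = j
           then inverse ((h\<^sup>2) ^ dsym i - inverse ((h\<^sup>2) ^ dsym i)) *\<^sub>c (Kh (V_rep h t a) i 2 - Kh (V_rep h t a) i (-2))
           else 0)"
proof -
  have n: "x ^ k - inverse (x ^ k) \<noteq> 0" if "x \<noteq> 0" "\<forall>n>0. x ^ n \<noteq> 1" "k > 0" for k and x :: complex
  proof
    assume "x ^ k - inverse (x ^ k) = 0"
    then have "x ^ k * x ^ k = 1" using that(1) by (simp add: field_simps)
    then have "x ^ (k + k) = 1" by (simp only: power_add)
    then show False using that by simp
  qed
  define c where "c k = inverse ((h\<^sup>2) ^ k - inverse ((h\<^sup>2) ^ k))" for k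
  have c0: "c k * ((h\<^sup>2) ^ k - inverse ((h\<^sup>2) ^ k)) = 1" if "k > 0" for k
    unfolding c_def using n[of "h\<^sup>2" k] assms that by simp
  have hp: "h powi 2 = (h\<^sup>2) ^ Suc 0" "h powi (-2) = inverse ((h\<^sup>2) ^ Suc 0)" "h powi 6 = (h\<^sup>2) ^ 3" "h powi (-6) = inverse ((h\<^sup>2) ^ 3)"
    "h powi 4 = (h\<^sup>2)\<^sup>2" "h powi (-4) = inverse ((h\<^sup>2)\<^sup>2)"
    by (simp_all add: power_int_minus flip: power_mult)
  have tt: "t * t = h\<^sup>2 + inverse (h\<^sup>2)" using assms(4) by (simp add: power2_eq_square)
  have c1: "c (Suc 0) * h powi 2 - c (Suc 0) * h powi (-2) = 1" "c 3 * h powi 6 - c 3 * h powi (-6) = 1"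
    unfolding hp using c0[of "Suc 0"] c0[of 3] by (simp_all only: right_diff_distrib zero_less_Suc zero_less_numeral simp_thms)
  have "c (Suc 0) * h powi 4 - c (Suc 0) * h powi (-4) = t * t * (c (Suc 0) * (h\<^sup>2 - inverse (h\<^sup>2)))"
    unfolding hp tt by (simp add: algebra_simps power2_eq_square)
  then have c2: "c (Suc 0) * h powi 4 - c (Suc 0) * h powi (-4) = t * t"
    using c0[of "Suc 0"] by simp
  have c: "c (Suc 0) * h powi 2 - c (Suc 0) * h powi (-2) = 1" "c 3 * h powi 6 - c 3 * h powi (-6) = 1"
    "c (Suc 0) * h powi (-2) - c (Suc 0) * h powi 2 = -1" "c 3 * h powi (-6) - c 3 * h powi 6 = -1"
    "c (Suc 0) * h powi 4 - c (Suc 0) * h powi (-4) = t * t" "c (Suc 0) * h powi (-4) - c (Suc 0) * h powi 4 = - (t * t)"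
    using c1 c2 by (auto simp: algebra_simps)
  have kk: "x *\<^sub>c (kdiag f - kdiag g) = kdiag (\<lambda>j. x * f j - x * g j)" for x f g
    by (simp add: kdiag_def atLeastAtMost_7 smult_mat_def vec_eq_iff algebra_simps)
  have a: "a * (a powi (-2) * a) = 1" "a powi (-2) * a * a = 1" using assms(3) by (simp_all add: power_int_def power2_eq_square field_simps)
  show ?thesis unfolding c_def[symmetric] all_le_2_iff
    apply (simp only: V_rep_simps kk cartan_values simp_thms if_True if_False)
    apply (simp add: mat_expand)
    apply (simp add: kdiag_def atLeastAtMost_7 kexp_def c c[simplified] a smult_mat_scalar)
    done
qed

lemma V_rep_relations:
  assumes "h \<noteq> 0" "\<forall>n>0. (h\<^sup>2) ^ n \<noteq> 1" "a \<noteq> 0" "t\<^sup>2 = h\<^sup>2 + inverse (h\<^sup>2)"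
  shows "Uq_relations h (V_rep h t a)"
proof -
  let ?r = "V_rep h t a"
  have 1: "\<forall>i\<le>2. Kh ?r i 0 = mat 1 \<and> (\<forall>m n. Kh ?r i (m + n) = Kh ?r i m ** Kh ?r i n)"
    using V_Kh_0 V_Kh_add[OF assms(1)] by metis
  show ?thesis
    unfolding Uq_relations_def
    apply (intro conjI 1 V_Kh_level_zero[OF assms(1)])
    apply (intro allI impI conjI)
    subgoal by (rule V_Kh_comm)
    subgoal for i j using V_KE[OF assms(1), of t a, rule_format, of i j] by simp
    subgoal for i j using V_KF[OF assms(1), of t a, rule_format, of i j] by simp
    subgoal for i j using V_EF[OF assms, rule_format, of i j] by simp
    subgoal for i j using V_serre_E[rule_format, of i j] by simp
    subgoal for i j using V_serre_F[rule_format, of i j] by simp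
    done
qed


section \<open>The normalized intertwiner\<close>

text \<open>
  A rational function is evaluated in lowest terms, hence at every point where it is regular; by
  \<open>x / 0 = 0\<close> it is given the value \<open>0\<close> at its poles, which makes it unique as a function.
\<close>

definition rational_fun :: "(complex \<Rightarrow> complex) \<Rightarrow> bool" where
  "rational_fun f \<longleftrightarrow>
     (\<exists>n d. d \<noteq> 0 \<and> coprime n d \<and> (\<forall>z. f z = poly n z / poly d z))"

text \<open>\<open>\<forall>\<^sub>\<infinity>z\<close>, that is, all but finitely many \<open>z\<close>, renders ``for generic \<open>z\<close>''.\<close>

definition normalized_intertwiner ::
  "complex \<Rightarrow> complex \<Rightarrow> (complex \<Rightarrow> (7 \<times> 7) cmat) \<Rightarrow> bool" where
  "normalized_intertwiner h t R \<longleftrightarrow>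
     (\<forall>r c. rational_fun (\<lambda>z. R z $ r $ c)) \<and>
     (\<forall>\<^sub>\<infinity>z. intertwines (tensor_rep (V_rep h t z) (V_rep h t 1))
                      (tensor_rep (V_rep h t 1) (V_rep h t z)) (R z) \<and>
            R z *v bas2 1 1 = bas2 1 1)"


section \<open>Decomposition over \<open>U\<^sub>q(G\<^sub>2)\<close>\<close>

text \<open>
  \<open>U\<^sub>q(G\<^sub>2)\<close> is generated by the generators of index 1 and 2. A weight \<open>l\<^sub>1 \<omega>\<^sub>1 + l\<^sub>2 \<omega>\<^sub>2\<close> is
  written \<open>(l\<^sub>1, l\<^sub>2)\<close>.
\<close>

definition G2_submodule :: "'n::finite Uq_rep \<Rightarrow> (complex ^ 'n) set \<Rightarrow> bool" where
  "G2_submodule \<rho> W \<longleftrightarrow> vec.subspace W \<and>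
     (\<forall>i\<in>{1, 2}. \<forall>x\<in>W. Eop \<rho> i *v x \<in> W \<and> Fop \<rho> i *v x \<in> W \<and>
        Kh \<rho> i 2 *v x \<in> W \<and> Kh \<rho> i (-2) *v x \<in> W)"

definition G2_irreducible :: "'n::finite Uq_rep \<Rightarrow> (complex ^ 'n) set \<Rightarrow> bool" where
  "G2_irreducible \<rho> W \<longleftrightarrow> G2_submodule \<rho> W \<and> W \<noteq> {0} \<and>
     (\<forall>U. G2_submodule \<rho> U \<and> U \<subseteq> W \<longrightarrow> U = {0} \<or> U = W)"

definition highest_weight_vector ::
  "complex \<Rightarrow> 'n::finite Uq_rep \<Rightarrow> nat \<times> nat \<Rightarrow> complex ^ 'n \<Rightarrow> bool" where
  "highest_weight_vector q \<rho> l x \<longleftrightarrow> x \<noteq> 0 \<and> Eop \<rho> 1 *v x = 0 \<and> Eop \<rho> 2 *v x = 0 \<and>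
     Kh \<rho> 1 2 *v x = (q ^ dsym 1) ^ fst l *s x \<and> Kh \<rho> 2 2 *v x = (q ^ dsym 2) ^ snd l *s x"

text \<open>\<open>W\<close> is a submodule isomorphic to \<open>L\<^sub>\<lambda>\<close>:\<close>

definition is_L ::
  "complex \<Rightarrow> 'n::finite Uq_rep \<Rightarrow> nat \<times> nat \<Rightarrow> (complex ^ 'n) set \<Rightarrow> bool" where
  "is_L q \<rho> l W \<longleftrightarrow> G2_irreducible \<rho> W \<and> (\<exists>x\<in>W. highest_weight_vector q \<rho> l x)"

definition om0 :: "nat \<times> nat" where "om0 = (0, 0)"
definition om1 :: "nat \<times> nat" where "om1 = (1, 0)"
definition om2 :: "nat \<times> nat" where "om2 = (0, 1)"
definition twice_om1 :: "nat \<times> nat" where "twice_om1 = (2, 0)"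

definition G2_decomposition ::
  "complex \<Rightarrow> 'n::finite Uq_rep \<Rightarrow> (nat \<times> nat) set \<Rightarrow> (nat \<times> nat \<Rightarrow> (complex ^ 'n) set) \<Rightarrow> bool" where
  "G2_decomposition q \<rho> \<Lambda> W \<longleftrightarrow> (\<forall>l\<in>\<Lambda>. is_L q \<rho> l (W l)) \<and>
     (\<forall>x. \<exists>!f. f \<in> (\<Pi>\<^sub>E l\<in>\<Lambda>. W l) \<and> x = (\<Sum>l\<in>\<Lambda>. f l))"

definition is_projectors ::
  "(nat \<times> nat) set \<Rightarrow> (nat \<times> nat \<Rightarrow> (complex ^ 'n) set) \<Rightarrow> (nat \<times> nat \<Rightarrow> 'n::finite cmat) \<Rightarrow> bool" where
  "is_projectors \<Lambda> W P \<longleftrightarrow>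
     (\<forall>l\<in>\<Lambda>. \<forall>k\<in>\<Lambda>. \<forall>x\<in>W k. P l *v x = (if k = l then x else 0))"

text \<open>
  As a \<open>U\<^sub>q(G\<^sub>2)\<close>-module, \<open>V(a)\<close> does not depend on \<open>a\<close>. So \<open>VV\<close> is \<open>V \<otimes> V\<close>.
\<close>

definition VV :: "complex \<Rightarrow> complex \<Rightarrow> (7 \<times> 7) Uq_rep" where
  "VV h t = tensor_rep (V_rep h t 1) (V_rep h t 1)"


section \<open>The operators \<open>G\<^sub>\<lambda>\<close>\<close>

definition wt0 :: "nat \<Rightarrow> bool" where
  "wt0 i \<longleftrightarrow> (\<forall>k\<in>{1, 2}. kexp k i = 0)"

definition wt0_tensor :: "nat \<Rightarrow> nat \<Rightarrow> bool" where
  "wt0_tensor i j \<longleftrightarrow> (\<forall>k\<in>{1, 2}. kexp k i + kexp k j = 0)"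

text \<open>
  \<open>I s\<close> for \<open>1 \<le> s \<le> d\<close> are the ordered lists; the sums run over positions, \<open>m = |(i,k)|\<close> and
  \<open>n = |(j,l)|\<close>. The predicates \<open>c1\<close>, \<open>c2\<close> on \<open>(i,k)\<close> select the sums \<open>=,1\<close> and \<open>=,2\<close>.
\<close>

definition G_op ::
  "nat \<Rightarrow> (nat \<Rightarrow> (nat \<times> nat) list) \<Rightarrow> (nat \<Rightarrow> nat \<Rightarrow> bool) \<Rightarrow> (nat \<Rightarrow> nat \<Rightarrow> bool) \<Rightarrow>
   complex \<Rightarrow> complex \<Rightarrow> complex \<Rightarrow> complex \<Rightarrow> (nat \<Rightarrow> nat \<Rightarrow> nat \<Rightarrow> complex) \<Rightarrow> (7 \<times> 7) cmat" where
  "G_op d I c1 c2 am ap a1 a2 \<sigma> =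
     (\<Sum>s=1..d. \<Sum>m=1..length (I s). \<Sum>n=1..length (I s).
        let (i, k) = I s ! (m - 1); (j, l) = I s ! (n - 1);
            a = (if m + n < length (I s) + 1 then am
                 else if m + n > length (I s) + 1 then ap
                 else (if c1 i k then a1 else 0) + (if c2 i k then a2 else 0))
        in (a * \<sigma> s i k * \<sigma> s j l) *\<^sub>c (mat_unit i j \<otimes> mat_unit k l))"

definition I_om0 :: "nat \<Rightarrow> (nat \<times> nat) list" where
  "I_om0 s = [(1,7), (2,6), (3,5), (4,4), (5,3), (6,2), (7,1)]"

text \<open>The listed pairs (for \<open>s = 4\<close>, the first four) with the values of \<open>\<mu>\<close> at them:\<close>

definition mu_listed :: "complex \<Rightarrow> complex \<Rightarrow> nat \<Rightarrow> ((nat \<times> nat) \<times> complex) list" where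
  "mu_listed h t s =
     [[((1,4), h ^ 6), ((2,3), - (h ^ 3) * t)],
      [((1,5), h ^ 5 * t), ((2,4), - (h ^ 2))],
      [((1,6), h ^ 5 * t), ((3,4), - (h ^ 2))],
      [((1,7), h ^ 4), ((2,6), h ^ 6), ((3,5), - 1), ((4,4), - (h ^ 2 - inverse (h ^ 2)))],
      [((2,7), h ^ 5 * t), ((4,5), - (h ^ 2))],
      [((3,7), h ^ 5 * t), ((4,6), - (h ^ 2))],
      [((4,7), h ^ 6), ((5,6), - (h ^ 3) * t)]] ! (s - 1)"

definition I_om1 :: "nat \<Rightarrow> (nat \<times> nat) list" where
  "I_om1 s =
     [[(1,4), (2,3), (3,2), (4,1)],
      [(1,5), (2,4), (4,2), (5,1)],
      [(1,6), (3,4), (4,3), (6,1)],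
      [(1,7), (2,6), (3,5), (4,4), (5,3), (6,2), (7,1)],
      [(2,7), (4,5), (5,4), (7,2)],
      [(3,7), (4,6), (6,4), (7,3)],
      [(4,7), (5,6), (6,5), (7,4)]] ! (s - 1)"

definition G_om0 where
  "G_om0 = G_op 1 I_om0 (\<lambda>i k. wt0 i \<and> wt0 k) (\<lambda>i k. \<not> wt0 i \<and> \<not> wt0 k)"

definition G_om1 where
  "G_om1 = G_op 7 I_om1
     (\<lambda>i k. wt0 i \<or> wt0 k \<or> wt0_tensor i k)
     (\<lambda>i k. \<not> wt0 i \<and> \<not> wt0 k \<and> \<not> wt0_tensor i k)"

definition p_coord :: "complex \<Rightarrow> nat \<Rightarrow> nat \<Rightarrow> nat \<Rightarrow> complex" where
  "p_coord q s i j = (if i + j = 8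
     then [q ^ 5, - (q ^ 4), q, - 1, q powi (-1), - (q powi (-4)), q powi (-5)] ! (i - 1) else 0)"

text \<open>
  At the pairs that are not listed, \<open>\<mu>\<close> is determined by \<open>\<mu>\<^sup>q\<^sub>i\<^sub>j = - \<mu>\<^bsup>1/q\<^esup>\<^sub>j\<^sub>i\<close>, where
  \<open>q\<^sup>1\<^sup>/\<^sup>2\<close> is inverted and \<open>t\<close> is kept.
\<close>

definition mu_coord :: "complex \<Rightarrow> complex \<Rightarrow> nat \<Rightarrow> nat \<Rightarrow> nat \<Rightarrow> complex" where
  "mu_coord h t s i j =
     (case map_of (mu_listed h t s) (i, j) of
        Some x \<Rightarrow> x
      | None \<Rightarrow> (case map_of (mu_listed (inverse h) t s) (j, i) of Some x \<Rightarrow> - x | None \<Rightarrow> 0))"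

definition R_sl7 :: "complex \<Rightarrow> complex \<Rightarrow> (7 \<times> 7) cmat" where
  "R_sl7 q z =
     (\<Sum>i=1..7. mat_unit i i \<otimes> mat_unit i i)
     + (z * (q - q powi (-1)) / (q - q powi (-1) * z)) *\<^sub>c
         (\<Sum>(i, j) \<in> {(i, j). i \<in> {1..7} \<and> j \<in> {1..7} \<and> i < j}. mat_unit i i \<otimes> mat_unit j j)
     + ((q - q powi (-1)) / (q - q powi (-1) * z)) *\<^sub>c
         (\<Sum>(i, j) \<in> {(i, j). i \<in> {1..7} \<and> j \<in> {1..7} \<and> i > j}. mat_unit i i \<otimes> mat_unit j j)
     + ((1 - z) / (q - q powi (-1) * z)) *\<^sub>c
         (\<Sum>(i, j) \<in> {(i, j). i \<in> {1..7} \<and> j \<in> {1..7} \<and> i \<noteq> j}. mat_unit i j \<otimes> mat_unit j i)"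

definition S_op :: "complex \<Rightarrow> complex \<Rightarrow> complex \<Rightarrow> (7 \<times> 7) cmat" where
  "S_op h t z = (let q = h\<^sup>2 in
     G_om1 (z * q powi (-4)) (q ^ 4)
       ((h powi 7 + h powi (-7) * z) / (h + h powi (-1)))
       ((q ^ 3 + q powi (-3) * z) / (q + q powi (-1)))
       (mu_coord h t))"

definition Q_op :: "complex \<Rightarrow> complex \<Rightarrow> (7 \<times> 7) cmat" where
  "Q_op q z =
     G_om0 (z * q powi (-6)) (q ^ 6)
       ((q ^ 7 - q ^ 5 + q ^ 4 + (q powi (-4) - q powi (-5) + q powi (-7)) * z)
          / (q ^ 2 + q powi (-2)))
       ((q ^ 4 + q powi (-4) * z) / (q ^ 2 + q powi (-2)))
       (p_coord q)"

end

theory Submission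
  imports Defs
begin

text \<open>
  Everything rests on one matrix, \<open>R_expl h t z\<close>, which is the right-hand side of the formula in
  matrix units, and on the algebra of operators that commute with \<open>U\<^sub>q(G\<^sub>2)\<close>.

  \<^bold>\<open>The explicit matrix is an intertwiner.\<close> After multiplication by
  \<open>h\<^sup>2\<^sup>4 (h\<^sup>4 - z) (h\<^sup>1\<^sup>6 - z) (h\<^sup>2\<^sup>4 - z)\<close> its entries are polynomials in \<open>h\<close>, \<open>r = h t\<close> and \<open>z\<close>
  (\<open>entry_R_expl\<close>). A generator of \<open>V\<close> has at most one nonzero entry in every row and column, so
  the intertwining relation at a given position is a polynomial identity with at most four terms,
  modulo \<open>r\<^sup>2 = h\<^sup>4 + 1\<close>. Weights leave few positions at which it is not \<open>0 = 0\<close>, and these are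
  verified one by one (\<open>R_num_intertwines\<close>). Only \<open>E\<^sub>0, E\<^sub>1, E\<^sub>2\<close> have to be treated: the matrix is
  symmetric, and transposition turns their relations into those of \<open>F\<^sub>0, F\<^sub>1, F\<^sub>2\<close>.

  \<^bold>\<open>Operators commuting with\<close> \<open>U\<^sub>q(G\<^sub>2)\<close>. Solving \<open>E\<^sub>1 x = E\<^sub>2 x = 0\<close> in coordinates shows that
  the singular vectors of \<open>V \<otimes> V\<close> are the combinations of four explicit ones, \<open>x\<^sub>\<lambda>\<close>, of different
  weights \<open>\<lambda>\<close> (\<open>singular_expand\<close>). As \<open>E\<^sub>k\<close> and \<open>F\<^sub>k\<close> are transposes of each other, the annihilator
  of a submodule for the standard bilinear form is a submodule; if the submodule is proper, the
  annihilator contains a singular vector. The \<open>x\<^sub>\<lambda>\<close> are orthogonal and \<open>x\<^sub>\<lambda> \<cdot> x\<^sub>\<lambda> \<noteq> 0\<close> because \<open>q\<close> is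
  not a root of unity. So a submodule that contains all \<open>x\<^sub>\<lambda>\<close> is the whole space
  (\<open>submodule_UNIV\<close>). An operator that commutes with \<open>U\<^sub>q(G\<^sub>2)\<close> multiplies each \<open>x\<^sub>\<lambda>\<close> by a scalar,
  and it is determined by the four scalars (\<open>commutes_eqI\<close>).

  \<^bold>\<open>The decomposition and the spectral formula.\<close> The matrix at \<open>z = 0\<close> has four different
  eigenvalues on the \<open>x\<^sub>\<lambda>\<close>, so Lagrange interpolation in it gives projectors onto irreducible
  summands (\<open>component_decomposition\<close>). The projectors of any decomposition commute with \<open>U\<^sub>q(G\<^sub>2)\<close>
  and act in the same way on the \<open>x\<^sub>\<lambda>\<close>, hence are equal to these (\<open>projectors_unique\<close>). The formula
  in terms of projectors then only needs the eigenvalues of the explicit matrix on four vectors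
  (\<open>R_expl_sing_vec\<close>).

  \<^bold>\<open>Uniqueness.\<close> The difference \<open>D\<close> of an intertwiner and the explicit matrix, both fixing
  \<open>v\<^sub>1 \<otimes> v\<^sub>1\<close>, kills every vector obtained from \<open>v\<^sub>1 \<otimes> v\<^sub>1\<close> by the quantum affine algebra. Applying
  \<open>E\<^sub>0\<close> and then \<open>E\<^sub>1, E\<^sub>2\<close> gives vectors whose products with the remaining \<open>x\<^sub>\<lambda>\<close> are polynomials of
  degree one in \<open>z\<close>, with a zero only at a pole of the formula. It follows that the transpose of
  \<open>D\<close>, which belongs to the commutant too, kills all \<open>x\<^sub>\<lambda>\<close> (\<open>intertwiner_unique\<close>). Rational
  functions in lowest terms that agree at almost all points are equal, which extends the result to
  every regular point (\<open>normalized_intertwiner_eq\<close>).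
\<close>

(* Numerals are indices below, and 1 has to remain a numeral. *)
declare One_nat_def [simp del]

section \<open>Rational functions in lowest terms\<close>

text \<open>
  Writing the function as \<open>a / b\<close> in lowest terms, \<open>a D = n b\<close> holds as an identity of
  polynomials. A zero of \<open>b\<close> at which \<open>D\<close> does not vanish would be a common zero of \<open>a\<close> and \<open>b\<close>.
\<close>

lemma rational_fun_eqI:
  assumes f: "rational_fun f" and fin: "\<forall>\<^sub>\<infinity>z. f z * poly D z = poly n z" and D: "poly D z \<noteq> 0"
  shows "f z = poly n z / poly D z"
proof -
  obtain a b where b: "b \<noteq> 0" and cop: "coprime a b" and fz: "\<And>z. f z = poly a z / poly b z"
    using f unfolding rational_fun_def by blast
  have "\<forall>\<^sub>\<infinity>z. poly b z \<noteq> 0"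
    using poly_roots_finite[OF b] by (simp add: MOST_iff_cofinite)
  then have "\<forall>\<^sub>\<infinity>z. poly (a * D - n * b) z = 0"
    using fin by eventually_elim (simp add: fz field_simps)
  then have "infinite {z. poly (a * D - n * b) z = 0}"
    unfolding MOST_iff_cofinite
    using finite_Collect_not[of "\<lambda>z. poly (a * D - n * b) z = 0"] infinite_UNIV_char_0 by blast
  then have eq: "a * D = n * b"
    using poly_roots_finite[of "a * D - n * b"] by auto
  have "poly b z \<noteq> 0"
  proof
    assume bz: "poly b z = 0"
    then have "poly a z * poly D z = 0"
      using arg_cong[OF eq, of "\<lambda>p. poly p z"] by simp
    with D have "poly a z = 0" by simp
    with bz cop show False
      using coprime_poly_0 by blast
  qed
  moreover have "poly a z * poly D z = poly n z * poly b z"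
    using arg_cong[OF eq, of "\<lambda>p. poly p z"] by simp
  ultimately show ?thesis
    using D by (simp add: fz field_simps)
qed

text \<open>
  By the previous lemma the two functions agree wherever one of them is regular, and at a common
  pole both take the default value \<open>0\<close> of division by zero.
\<close>

lemma rational_fun_unique:
  assumes f: "rational_fun f" and g: "rational_fun g" and fg: "\<forall>\<^sub>\<infinity>z. f z = g z"
  shows "f = g"
proof
  fix z
  obtain a b where b: "b \<noteq> 0" and fz: "\<And>z. f z = poly a z / poly b z"
    using f unfolding rational_fun_def by blast
  obtain c d where d: "d \<noteq> 0" and gz: "\<And>z. g z = poly c z / poly d z"
    using g unfolding rational_fun_def by blast
  have "\<forall>\<^sub>\<infinity>z. poly b z \<noteq> 0" "\<forall>\<^sub>\<infinity>z. poly d z \<noteq> 0"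
    using poly_roots_finite b d by (simp_all add: MOST_iff_cofinite)
  then have 1: "\<forall>\<^sub>\<infinity>z. g z * poly b z = poly a z \<and> f z * poly d z = poly c z"
    using fg by eventually_elim (metis fz gz nonzero_eq_divide_eq)
  then have 2: "\<forall>\<^sub>\<infinity>z. g z * poly b z = poly a z" "\<forall>\<^sub>\<infinity>z. f z * poly d z = poly c z"
    by (simp_all add: eventually_conj_iff)
  show "f z = g z"
  proof (cases "poly b z = 0 \<and> poly d z = 0")
    case True
    then show ?thesis by (simp add: fz gz)
  next
    case False
    then show ?thesis
      using rational_fun_eqI[OF g 2(1), of z] rational_fun_eqI[OF f 2(2), of z] fz[of z] gz[of z]
      by metis
  qed
qed

text \<open>Cancelling the greatest common divisor only removes poles.\<close>

lemma rational_fun_exists: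
  assumes "D \<noteq> 0"
  shows "\<exists>f. rational_fun f \<and> (\<forall>z. poly D z \<noteq> 0 \<longrightarrow> f z = poly n z / poly D z)"
  using assms
proof (induction "degree D" arbitrary: n D rule: less_induct)
  case less
  show ?case
  proof (cases "coprime n D")
    case True
    then have "rational_fun (\<lambda>z. poly n z / poly D z)"
      using less.prems unfolding rational_fun_def by blast
    then show ?thesis by blast
  next
    case False
    then obtain c where c: "c dvd n" "c dvd D" "\<not> is_unit c"
      unfolding coprime_def by blast
    then obtain n' D' where nD: "n = c * n'" "D = c * D'"
      unfolding dvd_def by blast
    then have nz: "c \<noteq> 0" "D' \<noteq> 0" using less.prems by auto
    then have "degree c > 0" using c(3) is_unit_iff_degree by blast
    then have "degree D' < degree D" using nz by (simp add: nD(2) degree_mult_eq)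
    then obtain f where "rational_fun f" "\<forall>z. poly D' z \<noteq> 0 \<longrightarrow> f z = poly n' z / poly D' z"
      using less.hyps[of D' n'] nz(2) by blast
    then show ?thesis
      unfolding nD poly_mult by (intro exI[of _ f]) simp
  qed
qed

definition polynomial_fun :: "(complex \<Rightarrow> complex) \<Rightarrow> bool" where
  "polynomial_fun f \<longleftrightarrow> (\<exists>p. \<forall>z. f z = poly p z)"

lemma polynomial_fun_const: "polynomial_fun (\<lambda>z. c)"
  unfolding polynomial_fun_def by (rule exI[of _ "[:c:]"]) simp

lemma polynomial_fun_id: "polynomial_fun (\<lambda>z. z)"
  unfolding polynomial_fun_def by (rule exI[of _ "[:0, 1:]"]) simp

lemma polynomial_fun_arith:
  assumes "polynomial_fun f" "polynomial_fun g"
  shows "polynomial_fun (\<lambda>z. f z + g z)" "polynomial_fun (\<lambda>z. f z - g z)"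
    "polynomial_fun (\<lambda>z. f z * g z)"
  using assms unfolding polynomial_fun_def
  by (metis poly_add, metis poly_diff, metis poly_mult)

lemma polynomial_fun_uminus: "polynomial_fun f \<Longrightarrow> polynomial_fun (\<lambda>z. - f z)"
  unfolding polynomial_fun_def by (metis poly_minus)

lemma polynomial_fun_if:
  "(b \<Longrightarrow> polynomial_fun f) \<Longrightarrow> (\<not> b \<Longrightarrow> polynomial_fun g) \<Longrightarrow>
    polynomial_fun (\<lambda>z. if b then f z else g z)"
  by (cases b) simp_all

lemmas polynomial_fun_intros = polynomial_fun_const polynomial_fun_id polynomial_fun_arith
  polynomial_fun_uminus polynomial_fun_if


section \<open>Coordinates on the tensor square\<close>

text \<open>
  The basis vectors are addressed by the natural numbers \<open>1, \<dots>, 7\<close>. Their set is a constant of its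
  own, so that classical reasoning does not split membership into seven cases unasked.
\<close>

definition ix :: "nat set" where "ix = {1, 2, 3, 4, 5, 6, 7}"

lemma finite_ix [simp]: "finite ix"
  by (simp add: ix_def)

lemma of_nat_ix_inj:
  assumes "i \<in> ix" "j \<in> ix"
  shows "(of_nat i :: 7) = of_nat j \<longleftrightarrow> i = j"
  using assms unfolding ix_def by (elim insertE emptyE) simp_all

lemma of_nat_ix_surj: "\<exists>i\<in>ix. x = (of_nat i :: 7)"
  using exhaust_7[of x] by (auto simp: ix_def)

lemma bij_of_nat_ix: "bij_betw of_nat ix (UNIV :: 7 set)"
proof (rule bij_betwI')
  show "((of_nat i :: 7) = of_nat j) = (i = j)" if "i \<in> ix" "j \<in> ix" for i j
    by (rule of_nat_ix_inj[OF that])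
  show "\<exists>i\<in>ix. x = (of_nat i :: 7)" for x
    by (rule of_nat_ix_surj)
qed simp

definition nat_index :: "7 \<Rightarrow> nat" where
  "nat_index = inv_into ix of_nat"

lemma nat_index_of_nat: "i \<in> ix \<Longrightarrow> nat_index (of_nat i) = i"
  unfolding nat_index_def using bij_of_nat_ix by (rule bij_betw_inv_into_left)

definition coord :: "complex ^ (7 \<times> 7) \<Rightarrow> nat \<Rightarrow> nat \<Rightarrow> complex" where
  "coord x i k = x $ (of_nat i, of_nat k)"

definition vec_of :: "(nat \<Rightarrow> nat \<Rightarrow> complex) \<Rightarrow> complex ^ (7 \<times> 7)" where
  "vec_of f = (\<chi> p. f (nat_index (fst p)) (nat_index (snd p)))"

lemma coord_vec_of: "i \<in> ix \<Longrightarrow> k \<in> ix \<Longrightarrow> coord (vec_of f) i k = f i k"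
  by (simp only: coord_def vec_of_def vec_lambda_beta fst_conv snd_conv nat_index_of_nat)

lemma coord_eqI:
  assumes "\<And>i k. i \<in> ix \<Longrightarrow> k \<in> ix \<Longrightarrow> coord x i k = coord y i k"
  shows "x = y"
  unfolding vec_eq_iff
proof
  fix p :: "7 \<times> 7"
  show "x $ p = y $ p"
  proof -
    obtain i k where "i \<in> ix" "k \<in> ix" "p = (of_nat i, of_nat k)"
      using of_nat_ix_surj[of "fst p"] of_nat_ix_surj[of "snd p"] by (metis prod.collapse)
    with assms[of i k] show ?thesis by (simp only: coord_def)
  qed
qed

lemma coord_simps:
  "coord (x + y) i k = coord x i k + coord y i k" "coord (x - y) i k = coord x i k - coord y i k"
  "coord (c *s x) i k = c * coord x i k" "coord 0 i k = 0"
  by (simp_all add: coord_def)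

lemma sum_UNIV_7: "sum f (UNIV :: 7 set) = (\<Sum>i\<in>ix. f (of_nat i))"
  by (rule sum.reindex_bij_betw[OF bij_of_nat_ix, symmetric])

lemma sum_UNIV_77: "sum f (UNIV :: (7 \<times> 7) set) = (\<Sum>i\<in>ix. \<Sum>k\<in>ix. f (of_nat i, of_nat k))"
  by (simp only: UNIV_Times_UNIV[symmetric] sum.cartesian_product' sum_UNIV_7)

definition entry :: "(7 \<times> 7) cmat \<Rightarrow> nat \<Rightarrow> nat \<Rightarrow> nat \<Rightarrow> nat \<Rightarrow> complex" where
  "entry A i k j l = A $ (of_nat i, of_nat k) $ (of_nat j, of_nat l)"

lemma entry_eqI:
  assumes "\<And>i k j l. i \<in> ix \<Longrightarrow> k \<in> ix \<Longrightarrow> j \<in> ix \<Longrightarrow> l \<in> ix \<Longrightarrow> entry A i k j l = entry B i k j l"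
  shows "A = B"
  unfolding vec_eq_iff
proof (intro allI)
  fix p r :: "7 \<times> 7"
  show "A $ p $ r = B $ p $ r"
  proof -
    obtain i k where "i \<in> ix" "k \<in> ix" "p = (of_nat i, of_nat k)"
      using of_nat_ix_surj[of "fst p"] of_nat_ix_surj[of "snd p"] by (metis prod.collapse)
    moreover obtain j l where "j \<in> ix" "l \<in> ix" "r = (of_nat j, of_nat l)"
      using of_nat_ix_surj[of "fst r"] of_nat_ix_surj[of "snd r"] by (metis prod.collapse)
    ultimately show ?thesis using assms[of i k j l] by (simp only: entry_def)
  qed
qed

lemma entry_simps:
  "entry (A + B) i k j l = entry A i k j l + entry B i k j l"
  "entry (A - B) i k j l = entry A i k j l - entry B i k j l"
  "entry (c *\<^sub>c A) i k j l = c * entry A i k j l"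
  "entry (transpose A) i k j l = entry A j l i k"
  "entry 0 i k j l = 0"
  by (simp_all add: entry_def smult_mat_def transpose_def)

lemma entry_sum: "entry (sum f S) i k j l = (\<Sum>x\<in>S. entry (f x) i k j l)"
  by (induct S rule: infinite_finite_induct) (simp_all add: entry_simps)

lemma entry_mult: "entry (A ** B) i k j l = (\<Sum>m\<in>ix. \<Sum>n\<in>ix. entry A i k m n * entry B m n j l)"
  by (simp only: entry_def matrix_matrix_mult_def vec_lambda_beta sum_UNIV_77)

lemma coord_mult: "coord (A *v x) i k = (\<Sum>j\<in>ix. \<Sum>l\<in>ix. entry A i k j l * coord x j l)"
  by (simp only: entry_def coord_def matrix_vector_mult_def vec_lambda_beta sum_UNIV_77)

lemma entry_kron: "entry (A \<otimes> B) i k j l = A $ of_nat i $ of_nat j * B $ of_nat k $ of_nat l"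
  by (simp add: entry_def kron_def)

lemma smult_mat_vec: "(c *\<^sub>c A) *v x = c *s (A *v x)"
  by (simp add: smult_mat_def matrix_vector_mult_def vec_eq_iff sum_distrib_left mult.assoc)


section \<open>The bilinear form\<close>

text \<open>
  For this form, which is complex bilinear and not hermitian, the generators \<open>E\<^sub>k\<close> and \<open>F\<^sub>k\<close> are
  adjoint to each other.
\<close>

definition bilinear :: "complex ^ 'n::finite \<Rightarrow> complex ^ 'n \<Rightarrow> complex" where
  "bilinear x y = (\<Sum>p\<in>UNIV. x $ p * y $ p)"

lemma bilinear_transpose: "bilinear x (A *v y) = bilinear (transpose A *v x) y"
proof -
  have "bilinear x (A *v y) = (\<Sum>p\<in>UNIV. \<Sum>r\<in>UNIV. x $ p * (A $ p $ r * y $ r))"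
    by (simp add: bilinear_def matrix_vector_mult_def sum_distrib_left)
  also have "\<dots> = (\<Sum>r\<in>UNIV. \<Sum>p\<in>UNIV. x $ p * (A $ p $ r * y $ r))"
    by (rule sum.swap)
  also have "\<dots> = bilinear (transpose A *v x) y"
    unfolding bilinear_def matrix_vector_mult_def transpose_def vec_lambda_beta sum_distrib_right
    by (intro sum.cong refl) (simp only: mult_ac)
  finally show ?thesis .
qed

lemma bilinear_linear:
  "bilinear (x + y) w = bilinear x w + bilinear y w" "bilinear w (x + y) = bilinear w x + bilinear w y"
  "bilinear (c *s x) w = c * bilinear x w" "bilinear w (c *s x) = c * bilinear w x" "bilinear 0 w = 0" "bilinear w 0 = 0"
  by (simp_all add: bilinear_def algebra_simps sum.distrib sum_distrib_left)

lemma bilinear_coord: "bilinear x y = (\<Sum>i\<in>ix. \<Sum>k\<in>ix. coord x i k * coord y i k)"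
  by (simp only: bilinear_def coord_def sum_UNIV_77)

text \<open>
  Nondegeneracy is taken from the real inner product, whose orthogonal vectors are
  conjugated to pass to the bilinear form.
\<close>

lemma proper_subspace_annihilator:
  fixes U :: "(complex ^ 'n::finite) set"
  assumes U: "vec.subspace U" "U \<noteq> UNIV"
  shows "\<exists>y. y \<noteq> 0 \<and> (\<forall>u\<in>U. bilinear y u = 0)"
proof -
  have sc: "c *\<^sub>R u = complex_of_real c *s u" for c and u :: "complex ^ 'n"
  proof -
    have "(c *\<^sub>R u) $ i = (complex_of_real c *s u) $ i" for i
      unfolding vector_scaleR_component vector_smult_component by (rule scaleR_conv_of_real)
    then show ?thesis unfolding vec_eq_iff by (rule allI)
  qed
  have "subspace U"
    using U(1) unfolding subspace_def vec.subspace_def sc by simp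
  then have "span U = U" by (simp add: span_eq_iff)
  then obtain a where a: "a \<noteq> 0" "\<And>u. u \<in> U \<Longrightarrow> a \<bullet> u = 0"
    using span_not_UNIV_orthogonal[of U] U(2) by (metis inner_commute)
  define y where "y = (\<chi> p. cnj (a $ p))"
  have y: "y \<noteq> 0" using a(1) by (auto simp: y_def vec_eq_iff)
  have re: "Re (bilinear y u) = a \<bullet> u" for u
    by (simp add: bilinear_def inner_vec_def y_def inner_complex_def)
  have "bilinear y u = 0" if "u \<in> U" for u
  proof -
    have iu: "\<i> *s u \<in> U" using U(1) that by (simp add: vec.subspace_def)
    have "Re (bilinear y u) = 0" using re a(2)[OF that] by simp
    moreover have "Re (\<i> * bilinear y u) = 0"
      using re[of "\<i> *s u"] a(2)[OF iu] by (simp add: bilinear_linear)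
    ultimately show ?thesis by (simp add: complex_eq_iff)
  qed
  with y show ?thesis by blast
qed

section \<open>The generators in coordinates\<close>

text \<open>
  In every row and every column of \<open>E\<^sub>g\<close> there is at most one nonzero entry. For the row \<open>i\<close> it is
  in column \<open>row_source g i\<close>, for the column \<open>j\<close> in row \<open>col_target g j\<close>; the index \<open>0\<close> stands for
  a vanishing row or column. The entries \<open>1\<close> and \<open>t\<close> are replaced by parameters \<open>c\<close> and \<open>d\<close>, since
  the scaled pair \<open>h\<close>, \<open>h t\<close> is needed as well.
\<close>

definition row_source :: "nat \<Rightarrow> nat \<Rightarrow> nat" where
  "row_source g i = [[0,0,0,0,0,1,2], [2,0,4,5,0,7,0], [0,3,0,0,6,0,0]] ! g ! (i - 1)"

definition col_target :: "nat \<Rightarrow> nat \<Rightarrow> nat" where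
  "col_target g j = [[6,7,0,0,0,0,0], [0,1,0,3,4,0,6], [0,0,2,0,0,5,0]] ! g ! (j - 1)"

definition row_coeff :: "complex \<Rightarrow> complex \<Rightarrow> nat \<Rightarrow> nat \<Rightarrow> complex" where
  "row_coeff c d g i = [[0,0,0,0,0,c,c], [c,0,d,d,0,c,0], [0,c,0,0,c,0,0]] ! g ! (i - 1)"

definition col_coeff :: "complex \<Rightarrow> complex \<Rightarrow> nat \<Rightarrow> nat \<Rightarrow> complex" where
  "col_coeff c d g j = [[c,c,0,0,0,0,0], [0,c,0,d,d,0,c], [0,0,c,0,0,c,0]] ! g ! (j - 1)"

text \<open>
  Of the operators \<open>E\<^sub>g\<close> only \<open>E\<^sub>0\<close> depends on the evaluation parameter.
\<close>

definition param :: "complex \<Rightarrow> nat \<Rightarrow> complex" where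
  "param a g = (if g = 0 then a else 1)"

lemma mat_unit_entry: "mat_unit a b $ i $ j = (if i = of_nat a \<and> j = of_nat b then 1 else 0)"
  by (simp add: mat_unit_def)

lemma ix_eq: "{1..7} = ix"
  by (auto simp: ix_def)

lemma le_2_cases: "g \<le> 2 \<Longrightarrow> g \<in> {0, 1, 2 :: nat}"
  by auto

lemma V_E_entry:
  assumes "g \<le> 2" "i \<in> ix" "j \<in> ix"
  shows "Eop (V_rep h t a) g $ of_nat i $ of_nat j =
      param a g * (if j = row_source g i then row_coeff 1 t g i else 0)" (is ?A)
    and "Eop (V_rep h t a) g $ of_nat i $ of_nat j =
      param a g * (if i = col_target g j then col_coeff 1 t g j else 0)" (is ?B)
proof -
  note defs = V_rep_def V_E0_def V_F_def smult_mat_def transpose_def mat_unit_entry row_source_def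
    row_coeff_def col_target_def col_coeff_def param_def
  from le_2_cases[OF assms(1)] assms(2,3) show ?A unfolding ix_def
    by (elim insertE emptyE) (simp_all add: defs)
  from le_2_cases[OF assms(1)] assms(2,3) show ?B unfolding ix_def
    by (elim insertE emptyE) (simp_all add: defs)
qed

lemma V_K_entry:
  assumes "i \<in> ix" "j \<in> ix"
  shows "Kh (V_rep h t a) g m $ of_nat i $ of_nat j = (if i = j then h powi (m * kexp g i) else 0)"
proof -
  have "Kh (V_rep h t a) g m $ of_nat i $ of_nat j =
      (\<Sum>n\<in>ix. h powi (m * kexp g n) * (if (of_nat i :: 7) = of_nat n \<and> (of_nat j :: 7) = of_nat n then 1 else 0))"
    unfolding V_rep_def ix_eq
    by (simp only: Uq_rep.select_convs sum_component smult_mat_def vec_lambda_beta mat_unit_entry)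
  also have "\<dots> = (\<Sum>n\<in>ix. if n = i then (if i = j then h powi (m * kexp g i) else 0) else 0)"
  proof (rule sum.cong[OF refl])
    fix n assume n: "n \<in> ix"
    show "h powi (m * kexp g n) * (if (of_nat i :: 7) = of_nat n \<and> (of_nat j :: 7) = of_nat n then 1 else 0) =
        (if n = i then (if i = j then h powi (m * kexp g i) else 0) else 0)"
      unfolding of_nat_ix_inj[OF assms(1) n] of_nat_ix_inj[OF assms(2) n] by (cases "n = i") simp_all
  qed
  also have "\<dots> = (if i = j then h powi (m * kexp g i) else 0)"
    using assms(1) by (subst sum.delta) simp_all
  finally show ?thesis .
qed

lemma sum_delta_pair:
  assumes "finite S" "finite T"
  shows "(\<Sum>m\<in>S. \<Sum>n\<in>T. if m = a then if n = b then g m n else 0 else 0) =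
    (if a \<in> S \<and> b \<in> T then g a b else (0 :: complex))"
proof -
  have "(\<Sum>m\<in>S. \<Sum>n\<in>T. if m = a then if n = b then g m n else 0 else 0) =
      (\<Sum>m\<in>S. if m = a then if b \<in> T then g a b else 0 else 0)"
    using assms by (intro sum.cong refl) (simp add: sum.delta)
  then show ?thesis using assms by (simp add: sum.delta)
qed

text \<open>
  The two sums over a row and over a column of the coproduct of \<open>E\<^sub>g\<close> reduce to two terms each.
  They are stated for an arbitrary function \<open>f\<close> in order to serve for vectors and for matrix
  products.
\<close>

lemma tensor_E_row:
  assumes g: "g \<le> 2" and i: "i \<in> ix" and k: "k \<in> ix"
  shows "(\<Sum>m\<in>ix. \<Sum>n\<in>ix. entry (Eop (tensor_rep (V_rep h t a) (V_rep h t b)) g) i k m n * f m n) =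
    param a g * row_coeff 1 t g i * h powi kexp g k * f (row_source g i) k +
    param b g * row_coeff 1 t g k * h powi (- kexp g i) * f i (row_source g k)"
proof -
  have z: "row_source g i \<notin> ix \<Longrightarrow> row_coeff 1 t g i = 0" if "i \<in> ix" for i
    using le_2_cases[OF g] that unfolding ix_def
    by (elim insertE emptyE) (simp_all add: row_source_def row_coeff_def)
  have "(\<Sum>m\<in>ix. \<Sum>n\<in>ix. entry (Eop (tensor_rep (V_rep h t a) (V_rep h t b)) g) i k m n * f m n) =
    (\<Sum>m\<in>ix. \<Sum>n\<in>ix. (if m = row_source g i then if n = k then
        param a g * row_coeff 1 t g i * h powi kexp g k * f m n else 0 else 0) +
      (if m = i then if n = row_source g k then
        param b g * row_coeff 1 t g k * h powi (- kexp g i) * f m n else 0 else 0))"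
    by (intro sum.cong refl)
      (simp add: tensor_rep_def entry_simps entry_kron V_E_entry(1)[OF g] V_K_entry i k, simp add: algebra_simps)
  also have "\<dots> = (if row_source g i \<in> ix then
        param a g * row_coeff 1 t g i * h powi kexp g k * f (row_source g i) k else 0) +
      (if row_source g k \<in> ix then
        param b g * row_coeff 1 t g k * h powi (- kexp g i) * f i (row_source g k) else 0)"
    using i k by (simp add: sum.distrib sum_delta_pair )
  finally show ?thesis using z[OF i] z[OF k] by auto
qed

lemma tensor_E_col:
  assumes g: "g \<le> 2" and j: "j \<in> ix" and l: "l \<in> ix"
  shows "(\<Sum>m\<in>ix. \<Sum>n\<in>ix. f m n * entry (Eop (tensor_rep (V_rep h t a) (V_rep h t b)) g) m n j l) =
    param a g * col_coeff 1 t g j * h powi kexp g l * f (col_target g j) l +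
    param b g * col_coeff 1 t g l * h powi (- kexp g j) * f j (col_target g l)"
proof -
  have z: "col_target g i \<notin> ix \<Longrightarrow> col_coeff 1 t g i = 0" if "i \<in> ix" for i
    using le_2_cases[OF g] that unfolding ix_def
    by (elim insertE emptyE) (simp_all add: col_target_def col_coeff_def)
  have "(\<Sum>m\<in>ix. \<Sum>n\<in>ix. f m n * entry (Eop (tensor_rep (V_rep h t a) (V_rep h t b)) g) m n j l) =
    (\<Sum>m\<in>ix. \<Sum>n\<in>ix. (if m = col_target g j then if n = l then
        param a g * col_coeff 1 t g j * h powi kexp g l * f m n else 0 else 0) +
      (if m = j then if n = col_target g l then
        param b g * col_coeff 1 t g l * h powi (- kexp g j) * f m n else 0 else 0))"
    by (intro sum.cong refl)
      (simp add: tensor_rep_def entry_simps entry_kron V_E_entry(2)[OF g] V_K_entry j l, simp add: algebra_simps)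
  also have "\<dots> = (if col_target g j \<in> ix then
        param a g * col_coeff 1 t g j * h powi kexp g l * f (col_target g j) l else 0) +
      (if col_target g l \<in> ix then
        param b g * col_coeff 1 t g l * h powi (- kexp g j) * f j (col_target g l) else 0)"
    using j l by (simp add: sum.distrib sum_delta_pair )
  finally show ?thesis using z[OF j] z[OF l] by auto
qed

lemma coord_tensor_E:
  assumes "g \<le> 2" "i \<in> ix" "k \<in> ix"
  shows "coord (Eop (tensor_rep (V_rep h t a) (V_rep h t b)) g *v x) i k =
    param a g * row_coeff 1 t g i * h powi kexp g k * coord x (row_source g i) k +
    param b g * row_coeff 1 t g k * h powi (- kexp g i) * coord x i (row_source g k)"
  unfolding coord_mult by (rule tensor_E_row[OF assms])

lemma entry_tensor_K:
  assumes "i \<in> ix" "k \<in> ix" "j \<in> ix" "l \<in> ix"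
  shows "entry (Kh (tensor_rep (V_rep h t a) (V_rep h t b)) g m) i k j l =
    (if i = j \<and> k = l then h powi (m * kexp g i) * h powi (m * kexp g k) else 0)"
  by (simp add: tensor_rep_def entry_kron V_K_entry assms)

lemma coord_tensor_K:
  assumes i: "i \<in> ix" and k: "k \<in> ix"
  shows "coord (Kh (tensor_rep (V_rep h t a) (V_rep h t b)) g m *v x) i k =
    h powi (m * kexp g i) * h powi (m * kexp g k) * coord x i k"
proof -
  have "coord (Kh (tensor_rep (V_rep h t a) (V_rep h t b)) g m *v x) i k =
      (\<Sum>j\<in>ix. \<Sum>l\<in>ix. if j = i then if l = k then
        h powi (m * kexp g i) * h powi (m * kexp g k) * coord x i k else 0 else 0)"
    unfolding coord_mult
    by (intro sum.cong refl) (simp add: entry_tensor_K i k)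
  then show ?thesis using i k by (simp add: sum_delta_pair )
qed

lemma transpose_tensor_K:
  "transpose (Kh (tensor_rep (V_rep h t a) (V_rep h t b)) g m) =
    Kh (tensor_rep (V_rep h t a) (V_rep h t b)) g m"
  by (rule entry_eqI) (simp add: entry_simps entry_tensor_K)

lemma transpose_kron: "transpose (A \<otimes> B) = transpose A \<otimes> transpose B"
  by (simp add: transpose_def kron_def vec_eq_iff)

lemma transpose_V_K: "transpose (Kh (V_rep h t a) g m) = Kh (V_rep h t a) g m"
proof -
  have "transpose (Kh (V_rep h t a) g m) $ x $ y = Kh (V_rep h t a) g m $ x $ y" for x y
  proof -
    obtain i j where "i \<in> ix" "x = of_nat i" "j \<in> ix" "y = of_nat j"
      using of_nat_ix_surj[of x] of_nat_ix_surj[of y] by blast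
    then show ?thesis
      by (simp only: transpose_def vec_lambda_beta V_K_entry) metis
  qed
  then show ?thesis by (simp add: vec_eq_iff)
qed

lemma tensor_F:
  assumes "g \<in> {1, 2}"
  shows "Fop (tensor_rep (V_rep h t a) (V_rep h t b)) g =
    transpose (Eop (tensor_rep (V_rep h t a) (V_rep h t b)) g)"
proof -
  have "Fop (V_rep h t c) g = transpose (Eop (V_rep h t c) g)" for c
    using assms by (auto simp: V_rep_def transpose_transpose)
  then show ?thesis
    by (simp add: tensor_rep_def transpose_linear transpose_kron transpose_V_K)
qed

lemma tensor_E_indep:
  assumes "g \<in> {1, 2}"
  shows "Eop (tensor_rep (V_rep h t a) (V_rep h t b)) g = Eop (VV h t) g"
  using assms by (auto simp: VV_def tensor_rep_def V_rep_def)

lemma tensor_F_indep: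
  assumes "g \<in> {1, 2}"
  shows "Fop (tensor_rep (V_rep h t a) (V_rep h t b)) g = Fop (VV h t) g"
  using assms by (auto simp: VV_def tensor_rep_def V_rep_def)

lemma tensor_K_indep: "Kh (tensor_rep (V_rep h t a) (V_rep h t b)) = Kh (VV h t)"
  by (simp add: VV_def tensor_rep_def V_rep_def)

text \<open>
  For \<open>g = 0\<close> transposition exchanges the two orders of the tensor factors, up to a scalar,
  because \<open>F\<^sub>0(a) = a\<^sup>-\<^sup>1 F\<^sub>0(1)\<close> whereas \<open>E\<^sub>0(a) = a E\<^sub>0(1)\<close>.
\<close>

lemma tensor_F0:
  assumes "z \<noteq> 0"
  shows "Fop (tensor_rep (V_rep h t z) (V_rep h t 1)) 0 =
      inverse z *\<^sub>c transpose (Eop (tensor_rep (V_rep h t 1) (V_rep h t z)) 0)"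
    and "Fop (tensor_rep (V_rep h t 1) (V_rep h t z)) 0 =
      inverse z *\<^sub>c transpose (Eop (tensor_rep (V_rep h t z) (V_rep h t 1)) 0)"
proof -
  have E: "Eop (V_rep h t a) 0 = a *\<^sub>c V_E0 1" for a
    by (simp add: V_rep_def V_E0_def smult_mat_def vec_eq_iff)
  have F: "Fop (V_rep h t a) 0 = inverse a *\<^sub>c transpose (V_E0 1)" if "a \<noteq> 0" for a
    using that by (simp add: V_rep_def V_E0_def smult_mat_def transpose_def vec_eq_iff power_int_minus
      power2_eq_square)
  have K: "Kh (V_rep h t z) = Kh (V_rep h t 1)"
    by (simp add: V_rep_def)
  have kron_l: "(c *\<^sub>c A) \<otimes> B = c *\<^sub>c (A \<otimes> B)" "A \<otimes> (c *\<^sub>c B) = c *\<^sub>c (A \<otimes> B)"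
    for c and A B :: "7 cmat"
    by (simp_all add: kron_def smult_mat_def vec_eq_iff)
  show "Fop (tensor_rep (V_rep h t z) (V_rep h t 1)) 0 =
      inverse z *\<^sub>c transpose (Eop (tensor_rep (V_rep h t 1) (V_rep h t z)) 0)"
    using assms by (simp add: tensor_rep_def E F K kron_l transpose_linear transpose_kron transpose_V_K
      smult_mat_simps smult_mat_scalar)
  show "Fop (tensor_rep (V_rep h t 1) (V_rep h t z)) 0 =
      inverse z *\<^sub>c transpose (Eop (tensor_rep (V_rep h t z) (V_rep h t 1)) 0)"
    using assms by (simp add: tensor_rep_def E F K kron_l transpose_linear transpose_kron transpose_V_K
      smult_mat_simps smult_mat_scalar)
qed

section \<open>The matrix entries of the operator\<close>

text \<open>
  The number of the list \<open>I\<^sub>s\<close> for \<open>\<omega>\<^sub>1\<close> that contains \<open>(i,k)\<close>, or \<open>0\<close> if there is none; in other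
  words, \<open>v\<^sub>i \<otimes> v\<^sub>k\<close> has the same weight as \<open>v\<^sub>s\<close>.
\<close>

definition block :: "nat \<Rightarrow> nat \<Rightarrow> nat" where
  "block i k = [[0,0,0,1,2,3,4],[0,0,1,2,0,4,5],[0,1,0,3,4,0,6],[1,2,3,4,5,6,7],[2,0,4,5,0,7,0],
    [3,4,0,6,7,0,0],[4,5,6,7,0,0,0]] ! (i - 1) ! (k - 1)"

text \<open>
  This is \<open>h\<^sup>6 \<mu>\<close>, written with \<open>r = h t\<close>. The factor removes all negative powers, and the square
  of \<open>r\<close> is the polynomial \<open>h\<^sup>4 + 1\<close>, whereas \<open>t\<^sup>2\<close> involves \<open>h\<^sup>-\<^sup>2\<close>.
\<close>

definition mu_num :: "complex \<Rightarrow> complex \<Rightarrow> nat \<Rightarrow> nat \<Rightarrow> complex" where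
  "mu_num h r i k =
    [[0, 0, 0, h^12, h^10 * r, h^10 * r, h^10],
     [0, 0, -(h^8 * r), -(h^8), 0, h^12, h^10 * r],
     [0, h^2 * r, 0, -(h^8), -(h^6), 0, h^10 * r],
     [-1, h^4, h^4, -(h^8) + h^4, -(h^8), -(h^8), h^12],
     [-r, 0, h^6, h^4, 0, -(h^8 * r), 0],
     [-r, -1, 0, h^4, h^2 * r, 0, 0],
     [-(h^2), -r, -r, -1, 0, 0, 0]] ! (i - 1) ! (k - 1)"

text \<open>
  This is \<open>h\<^sup>1\<^sup>0 p\<close>, in which no negative powers are left.
\<close>

definition p_num :: "complex \<Rightarrow> nat \<Rightarrow> complex" where
  "p_num h i = [h^20, -(h^18), h^12, -(h^10), h^8, -(h^2), 1] ! (i - 1)"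

text \<open>
  The three summands of the operator, with their scalar factors, have the following numerators
  over \<open>h\<^sup>4 - z\<close>, over \<open>h\<^sup>1\<^sup>2 (h\<^sup>4 - z) (h\<^sup>1\<^sup>6 - z)\<close> and over \<open>h\<^sup>2\<^sup>4 (h\<^sup>4 - z) (h\<^sup>2\<^sup>4 - z)\<close>. The lists of
  \<open>\<omega>\<^sub>0\<close> and \<open>\<omega>\<^sub>1\<close> are sorted by the first index, and \<open>(j,l)\<close> and \<open>(l,j)\<close> stand at opposite
  positions, so that the three parts of \<open>G\<^sub>\<lambda>\<close> are told apart by comparing \<open>i\<close> and \<open>l\<close>. For \<open>i = l\<close>
  the denominators of the parameters \<open>a\<^sub>0\<close> cancel against \<open>\<mu>\<^sub>i\<^sub>k \<mu>\<^sub>k\<^sub>i\<close> or against the scalar factor.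
\<close>

definition sl7_num :: "complex \<Rightarrow> complex \<Rightarrow> nat \<Rightarrow> nat \<Rightarrow> nat \<Rightarrow> nat \<Rightarrow> complex" where
  "sl7_num h z i k j l =
    (if i = j \<and> k = l then if i = k then h^4 - z else if i < k then z * (h^4 - 1) else h^4 - 1
     else if i = l \<and> k = j then (1 - z) * h^2 else 0)"

definition S_num :: "complex \<Rightarrow> complex \<Rightarrow> complex \<Rightarrow> nat \<Rightarrow> nat \<Rightarrow> nat \<Rightarrow> nat \<Rightarrow> complex" where
  "S_num h r z i k j l =
    (if block i k = block j l \<and> block i k \<noteq> 0 then
       (1 - z) *
       (if i < l then (h^4 - 1) * z * (mu_num h r i k * mu_num h r j l)
        else if i > l then (h^4 - 1) * h^16 * (mu_num h r i k * mu_num h r j l)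
        else if i = 4 \<and> k = 4 then (h^2 - 1) * (h^14 + z) * h^10 * (h^4 - 1)^2
        else if i = 4 \<or> k = 4 \<or> i + k = 8 then - (h^14 * (h^2 - 1) * (h^14 + z))
        else - (h^14 * (h^4 - 1) * (h^12 + z)))
     else 0)"

definition Q_num :: "complex \<Rightarrow> complex \<Rightarrow> nat \<Rightarrow> nat \<Rightarrow> nat \<Rightarrow> nat \<Rightarrow> complex" where
  "Q_num h z i k j l =
    (if i + k = 8 \<and> j + l = 8 then
       (1 - z) * (h^4 - 1) *
       (if i < l then (h^8 + 1) * z * (p_num h i * p_num h j)
        else if i > l then (h^8 + 1) * h^24 * (p_num h i * p_num h j)
        else if i = 4 then h^22 * (h^28 - h^24 + h^22 + (h^6 - h^4 + 1) * z)
        else h^28 * (h^16 + z))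
     else 0)"

definition R_num :: "complex \<Rightarrow> complex \<Rightarrow> complex \<Rightarrow> nat \<Rightarrow> nat \<Rightarrow> nat \<Rightarrow> nat \<Rightarrow> complex" where
  "R_num h r z i k j l =
    h^24 * (h^16 - z) * (h^24 - z) * sl7_num h z i k j l
    + h^12 * (h^24 - z) * S_num h r z i k j l
    - (h^16 - z) * Q_num h z i k j l"

definition R_den :: "complex \<Rightarrow> complex \<Rightarrow> complex" where
  "R_den h z = h^24 * (h^4 - z) * (h^16 - z) * (h^24 - z)"

definition R_expl :: "complex \<Rightarrow> complex \<Rightarrow> complex \<Rightarrow> (7 \<times> 7) cmat" where
  "R_expl h t z = (let q = h\<^sup>2 in
     R_sl7 q z
          + ((q - q powi (-1)) * (1 - z) /
              ((q - q powi (-1) * z) * (q ^ 4 - q powi (-4) * z))) *\<^sub>c S_op h t z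
          - ((q - q powi (-1)) * (q ^ 2 + q powi (-2)) * (1 - z) /
              ((q - q powi (-1) * z) * (q ^ 6 - q powi (-6) * z))) *\<^sub>c Q_op q z)"

lemma entry_unit_kron:
  assumes "i \<in> ix" "k \<in> ix" "j \<in> ix" "l \<in> ix" "a \<in> ix" "b \<in> ix" "c \<in> ix" "d \<in> ix"
  shows "entry (mat_unit a b \<otimes> mat_unit c d) i k j l = (if (a, c) = (i, k) \<and> (b, d) = (j, l) then 1 else 0)"
  unfolding entry_kron mat_unit_entry
    of_nat_ix_inj[OF assms(1) assms(5)] of_nat_ix_inj[OF assms(2) assms(7)]
    of_nat_ix_inj[OF assms(3) assms(6)] of_nat_ix_inj[OF assms(4) assms(8)]
  by auto

lemma entry_R_sl7:
  assumes "i \<in> ix" "k \<in> ix" "j \<in> ix" "l \<in> ix"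
  shows "entry (R_sl7 q z) i k j l =
    (if i = j \<and> k = l then if i = k then 1
       else if i < k then z * (q - q powi (-1)) / (q - q powi (-1) * z)
       else (q - q powi (-1)) / (q - q powi (-1) * z)
     else if i = l \<and> k = j then (1 - z) / (q - q powi (-1) * z) else 0)"
proof -
  define T where "T P = {(a, b). a \<in> {1..7} \<and> b \<in> {1..7} \<and> P a b}" for P :: "nat \<Rightarrow> nat \<Rightarrow> bool"
  have fin: "finite (T P)" for P
    by (rule finite_subset[of _ "{1..7} \<times> {1..7}"]) (auto simp: T_def)
  have T: "(a, b) \<in> T P \<longleftrightarrow> a \<in> ix \<and> b \<in> ix \<and> P a b" for P a b
    by (simp only: T_def ix_eq mem_Collect_eq case_prod_conv)
  have 1: "(\<Sum>a = 1..7. entry (mat_unit a a \<otimes> mat_unit a a) i k j l) = (if i = j \<and> k = l \<and> i = k then 1 else 0)"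
  proof -
    have "(\<Sum>a = 1..7. entry (mat_unit a a \<otimes> mat_unit a a) i k j l) =
        (\<Sum>a\<in>ix. if a = i then if i = j \<and> k = l \<and> i = k then 1 else 0 else 0)"
      unfolding ix_eq using assms by (intro sum.cong refl) (auto simp add: entry_unit_kron)
    also have "\<dots> = (if i = j \<and> k = l \<and> i = k then 1 else 0)"
      using assms(1) by (simp add: sum.delta)
    finally show ?thesis .
  qed
  have 2: "(\<Sum>(a, b)\<in>T P. entry (mat_unit a a \<otimes> mat_unit b b) i k j l) =
      (if i = j \<and> k = l \<and> P i k then 1 else 0)" for P
  proof -
    have "(\<Sum>(a, b)\<in>T P. entry (mat_unit a a \<otimes> mat_unit b b) i k j l) =
        (\<Sum>p\<in>T P. if p = (i, k) then if i = j \<and> k = l then 1 else 0 else 0)"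
      using assms by (intro sum.cong refl) (auto simp add: entry_unit_kron T split: if_splits)
    also have "\<dots> = (if (i, k) \<in> T P then if i = j \<and> k = l then 1 else 0 else 0)"
      by (rule sum.delta[OF fin])
    finally show ?thesis using assms by (auto simp: T)
  qed
  have 3: "(\<Sum>(a, b)\<in>T P. entry (mat_unit a b \<otimes> mat_unit b a) i k j l) =
      (if i = l \<and> k = j \<and> P i k then 1 else 0)" for P
  proof -
    have "(\<Sum>(a, b)\<in>T P. entry (mat_unit a b \<otimes> mat_unit b a) i k j l) =
        (\<Sum>p\<in>T P. if p = (i, k) then if i = l \<and> k = j then 1 else 0 else 0)"
      using assms by (intro sum.cong refl) (auto simp add: entry_unit_kron T split: if_splits)
    also have "\<dots> = (if (i, k) \<in> T P then if i = l \<and> k = j then 1 else 0 else 0)"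
      by (rule sum.delta[OF fin])
    finally show ?thesis using assms by (auto simp: T)
  qed
  have "entry (R_sl7 q z) i k j l =
      (\<Sum>a = 1..7. entry (mat_unit a a \<otimes> mat_unit a a) i k j l)
      + z * (q - q powi (-1)) / (q - q powi (-1) * z) *
          (\<Sum>(a, b)\<in>T (<). entry (mat_unit a a \<otimes> mat_unit b b) i k j l)
      + (q - q powi (-1)) / (q - q powi (-1) * z) *
          (\<Sum>(a, b)\<in>T (>). entry (mat_unit a a \<otimes> mat_unit b b) i k j l)
      + (1 - z) / (q - q powi (-1) * z) *
          (\<Sum>(a, b)\<in>T (\<noteq>). entry (mat_unit a b \<otimes> mat_unit b a) i k j l)"
    unfolding R_sl7_def T_def entry_simps entry_sum by (simp only: case_prod_unfold)
  moreover have "(if i = j \<and> k = l \<and> i = k then 1 else 0) + x * (if i = j \<and> k = l \<and> i < k then 1 else 0) +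
      y * (if i = j \<and> k = l \<and> i > k then 1 else 0) + w * (if i = l \<and> k = j \<and> i \<noteq> k then 1 else 0) =
    (if i = j \<and> k = l then if i = k then 1 else if i < k then x else y
     else if i = l \<and> k = j then w else 0)" for x y w :: complex
    by (cases "i = j \<and> k = l"; cases i k rule: linorder_cases) auto
  ultimately show ?thesis unfolding 1 2 3 by (simp only:)
qed

definition position :: "'a list \<Rightarrow> 'a \<Rightarrow> nat" where
  "position xs x = Suc (length (takeWhile (\<lambda>y. y \<noteq> x) xs))"

lemma position_iff: "distinct xs \<Longrightarrow> n \<in> {1..length xs} \<Longrightarrow> xs ! (n - 1) = x \<longleftrightarrow> x \<in> set xs \<and> n = position xs x"
proof (induction xs arbitrary: n)
  case (Cons y ys)
  show ?case
  proof (cases "n = 1")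
    case True
    then show ?thesis by (auto simp: position_def)
  next
    case False
    then have n: "n = Suc (n - 1)" "n - 1 \<in> {1..length ys}" "n - 1 = Suc (n - 1 - 1)"
      using Cons.prems(2) by auto
    have "(y # ys) ! (n - 1) = ys ! (n - 1 - 1)"
      using n(3) by (metis nth_Cons_Suc)
    then show ?thesis
      using Cons.IH[OF _ n(2)] Cons.prems(1) n by (auto simp: position_def)
  qed
qed simp

lemma position_range: "x \<in> set xs \<Longrightarrow> position xs x \<in> {1..length xs}"
  by (induction xs) (auto simp: position_def One_nat_def)

text \<open>
  In terms of positions, the entry at \<open>((i,k),(j,l))\<close> only receives contributions of the lists
  that contain both pairs.
\<close>

lemma entry_G_op:
  assumes ij: "i \<in> ix" "k \<in> ix" "j \<in> ix" "l \<in> ix"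
    and I: "\<And>s. s \<in> {1..d} \<Longrightarrow> distinct (I s)" "\<And>s. s \<in> {1..d} \<Longrightarrow> set (I s) \<subseteq> ix \<times> ix"
  shows "entry (G_op d I c1 c2 am ap a1 a2 \<sigma>) i k j l =
    (\<Sum>s = 1..d. if (i, k) \<in> set (I s) \<and> (j, l) \<in> set (I s) then
       (if position (I s) (i, k) + position (I s) (j, l) < length (I s) + 1 then am
        else if position (I s) (i, k) + position (I s) (j, l) > length (I s) + 1 then ap
        else (if c1 i k then a1 else 0) + (if c2 i k then a2 else 0)) * \<sigma> s i k * \<sigma> s j l
     else 0)"
  unfolding G_op_def entry_sum
proof (rule sum.cong[OF refl])
  fix s assume s: "s \<in> {1..d}"
  define A where "A m n i k = (if m + n < length (I s) + 1 then am
        else if m + n > length (I s) + 1 then ap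
        else (if c1 i k then a1 else 0) + (if c2 i k then a2 else 0))" for m n i k
  have posin: "position (I s) p \<in> {1..length (I s)}" if "p \<in> set (I s)" for p
    using that by (rule position_range)
  have "(\<Sum>m = 1..length (I s). \<Sum>n = 1..length (I s).
      entry (let (i, k) = I s ! (m - 1); (j, l) = I s ! (n - 1); a = A m n i k
        in (a * \<sigma> s i k * \<sigma> s j l) *\<^sub>c (mat_unit i j \<otimes> mat_unit k l)) i k j l) =
    (\<Sum>m = 1..length (I s). \<Sum>n = 1..length (I s).
      if m = position (I s) (i, k) then if n = position (I s) (j, l) then
        if (i, k) \<in> set (I s) \<and> (j, l) \<in> set (I s) then A m n i k * \<sigma> s i k * \<sigma> s j l else 0 else 0 else 0)"
  proof (intro sum.cong refl)
    fix m n assume m: "m \<in> {1..length (I s)}" and n: "n \<in> {1..length (I s)}"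
    obtain a c where ac: "I s ! (m - 1) = (a, c)" by fastforce
    obtain b e where be: "I s ! (n - 1) = (b, e)" by fastforce
    have "I s ! (m - 1) \<in> set (I s)" "I s ! (n - 1) \<in> set (I s)"
      using m n by (auto simp: One_nat_def)
    then have mem: "a \<in> ix" "c \<in> ix" "b \<in> ix" "e \<in> ix"
      using I(2)[OF s] unfolding ac be by blast+
    have "(a, c) = (i, k) \<longleftrightarrow> (i, k) \<in> set (I s) \<and> m = position (I s) (i, k)"
      "(b, e) = (j, l) \<longleftrightarrow> (j, l) \<in> set (I s) \<and> n = position (I s) (j, l)"
      unfolding ac[symmetric] be[symmetric] by (rule position_iff[OF I(1)[OF s]], fact)+
    then show "entry (let (i, k) = I s ! (m - 1); (j, l) = I s ! (n - 1); a = A m n i k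
        in (a * \<sigma> s i k * \<sigma> s j l) *\<^sub>c (mat_unit i j \<otimes> mat_unit k l)) i k j l =
      (if m = position (I s) (i, k) then if n = position (I s) (j, l) then
        if (i, k) \<in> set (I s) \<and> (j, l) \<in> set (I s) then A m n i k * \<sigma> s i k * \<sigma> s j l else 0 else 0 else 0)"
      unfolding ac be Let_def case_prod_conv entry_simps entry_unit_kron[OF ij mem(1) mem(3) mem(2) mem(4)]
      by (cases "(a, c) = (i, k)"; cases "(b, e) = (j, l)") simp_all
  qed
  also have "\<dots> = (if (i, k) \<in> set (I s) \<and> (j, l) \<in> set (I s) then
      A (position (I s) (i, k)) (position (I s) (j, l)) i k * \<sigma> s i k * \<sigma> s j l else 0)"
    unfolding sum_delta_pair[OF finite_atLeastAtMost finite_atLeastAtMost] using posin by auto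
  finally show "(\<Sum>m = 1..length (I s). \<Sum>n = 1..length (I s).
      entry (let (i, k) = I s ! (m - 1); (j, l) = I s ! (n - 1);
            a = (if m + n < length (I s) + 1 then am
                 else if m + n > length (I s) + 1 then ap
                 else (if c1 i k then a1 else 0) + (if c2 i k then a2 else 0))
        in (a * \<sigma> s i k * \<sigma> s j l) *\<^sub>c (mat_unit i j \<otimes> mat_unit k l)) i k j l) =
    (if (i, k) \<in> set (I s) \<and> (j, l) \<in> set (I s) then
       (if position (I s) (i, k) + position (I s) (j, l) < length (I s) + 1 then am
        else if position (I s) (i, k) + position (I s) (j, l) > length (I s) + 1 then ap
        else (if c1 i k then a1 else 0) + (if c2 i k then a2 else 0)) * \<sigma> s i k * \<sigma> s j l
     else 0)"
    unfolding A_def .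
qed

lemma I_om1_block:
  assumes "i \<in> ix" "k \<in> ix" "s \<in> ix"
  shows "(i, k) \<in> set (I_om1 s) \<longleftrightarrow> block i k = s"
  using assms unfolding ix_def by (elim insertE emptyE) (simp_all add: I_om1_def block_def)

text \<open>
  The lists are sorted by the first index and closed under exchange of the two indices, which
  reverses them. Hence \<open>|(i,k)| + |(j,l)| < |I| + 1\<close> says that \<open>(i,k)\<close> stands before \<open>(l,j)\<close>.
\<close>

lemma I_om1_pos:
  assumes "s \<in> ix" "p \<in> set (I_om1 s)" "p' \<in> set (I_om1 s)"
  shows "position (I_om1 s) p + position (I_om1 s) p' < length (I_om1 s) + 1 \<longleftrightarrow> fst p < snd p'"
    "position (I_om1 s) p + position (I_om1 s) p' > length (I_om1 s) + 1 \<longleftrightarrow> fst p > snd p'"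
proof -
  have "\<forall>p\<in>set (I_om1 s). \<forall>p'\<in>set (I_om1 s).
      (position (I_om1 s) p + position (I_om1 s) p' < length (I_om1 s) + 1 \<longleftrightarrow> fst p < snd p') \<and>
      (position (I_om1 s) p + position (I_om1 s) p' > length (I_om1 s) + 1 \<longleftrightarrow> fst p > snd p')"
    using assms(1) unfolding ix_def
    by (elim insertE emptyE) (simp_all add: I_om1_def position_def)
  with assms(2,3) show "position (I_om1 s) p + position (I_om1 s) p' < length (I_om1 s) + 1 \<longleftrightarrow> fst p < snd p'"
    "position (I_om1 s) p + position (I_om1 s) p' > length (I_om1 s) + 1 \<longleftrightarrow> fst p > snd p'"
    by blast+
qed

lemma I_om1_wf:
  assumes "s \<in> ix"
  shows "distinct (I_om1 s)" "set (I_om1 s) \<subseteq> ix \<times> ix"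
  using assms unfolding ix_def by (elim insertE emptyE; simp add: I_om1_def)+

lemma I_om0_wf: "distinct (I_om0 s)" "set (I_om0 s) \<subseteq> ix \<times> ix"
  unfolding ix_def by (simp_all add: I_om0_def)

lemma I_om0_mem:
  assumes "i \<in> ix" "k \<in> ix"
  shows "(i, k) \<in> set (I_om0 s) \<longleftrightarrow> i + k = 8"
  using assms unfolding ix_def by (elim insertE emptyE) (simp_all add: I_om0_def)

lemma I_om0_pos:
  assumes "p \<in> set (I_om0 s)" "p' \<in> set (I_om0 s)"
  shows "position (I_om0 s) p + position (I_om0 s) p' < length (I_om0 s) + 1 \<longleftrightarrow> fst p < snd p'"
    "position (I_om0 s) p + position (I_om0 s) p' > length (I_om0 s) + 1 \<longleftrightarrow> fst p > snd p'"
proof -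
  have "I_om0 s = I_om1 4" by (simp add: I_om0_def I_om1_def)
  then show "position (I_om0 s) p + position (I_om0 s) p' < length (I_om0 s) + 1 \<longleftrightarrow> fst p < snd p'"
    "position (I_om0 s) p + position (I_om0 s) p' > length (I_om0 s) + 1 \<longleftrightarrow> fst p > snd p'"
    using I_om1_pos[of 4 p p'] assms by (simp_all add: ix_def)
qed

lemma block_in_ix: "i \<in> ix \<Longrightarrow> k \<in> ix \<Longrightarrow> block i k \<noteq> 0 \<Longrightarrow> block i k \<in> ix"
  unfolding ix_def by (elim insertE emptyE) (simp_all add: block_def)

lemma block_not_0: "s \<in> ix \<Longrightarrow> s \<noteq> 0"
  by (auto simp: ix_def)

text \<open>
  The lists of \<open>\<omega>\<^sub>1\<close> are disjoint, so that at most one of them contributes.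
\<close>

lemma entry_G_om1:
  assumes "i \<in> ix" "k \<in> ix" "j \<in> ix" "l \<in> ix"
  shows "entry (G_om1 am ap a1 a2 \<sigma>) i k j l =
    (if block i k = block j l \<and> block i k \<noteq> 0 then
       (if i < l then am else if i > l then ap
        else if wt0 i \<or> wt0 k \<or> wt0_tensor i k then a1 else a2) * \<sigma> (block i k) i k * \<sigma> (block i k) j l
     else 0)"
proof -
  define A where "A = (if i < l then am else if i > l then ap
        else if wt0 i \<or> wt0 k \<or> wt0_tensor i k then a1 else a2)"
  have "entry (G_om1 am ap a1 a2 \<sigma>) i k j l = (\<Sum>s\<in>ix. if s = block i k then
       if block j l = s then A * \<sigma> s i k * \<sigma> s j l else 0 else 0)"
    unfolding G_om1_def ix_eq
  proof (subst entry_G_op[OF assms], unfold ix_eq)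
    show "distinct (I_om1 s)" "set (I_om1 s) \<subseteq> ix \<times> ix" if "s \<in> ix" for s
      using I_om1_wf[OF that] by auto
    show "(\<Sum>s\<in>ix. if (i, k) \<in> set (I_om1 s) \<and> (j, l) \<in> set (I_om1 s) then
       (if position (I_om1 s) (i, k) + position (I_om1 s) (j, l) < length (I_om1 s) + 1 then am
        else if position (I_om1 s) (i, k) + position (I_om1 s) (j, l) > length (I_om1 s) + 1 then ap
        else (if wt0 i \<or> wt0 k \<or> wt0_tensor i k then a1 else 0) +
          (if \<not> wt0 i \<and> \<not> wt0 k \<and> \<not> wt0_tensor i k then a2 else 0)) * \<sigma> s i k * \<sigma> s j l
     else 0) = (\<Sum>s\<in>ix. if s = block i k then
       if block j l = s then A * \<sigma> s i k * \<sigma> s j l else 0 else 0)"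
    proof (rule sum.cong[OF refl])
      fix s assume s: "s \<in> ix"
      show "(if (i, k) \<in> set (I_om1 s) \<and> (j, l) \<in> set (I_om1 s) then
       (if position (I_om1 s) (i, k) + position (I_om1 s) (j, l) < length (I_om1 s) + 1 then am
        else if position (I_om1 s) (i, k) + position (I_om1 s) (j, l) > length (I_om1 s) + 1 then ap
        else (if wt0 i \<or> wt0 k \<or> wt0_tensor i k then a1 else 0) +
          (if \<not> wt0 i \<and> \<not> wt0 k \<and> \<not> wt0_tensor i k then a2 else 0)) * \<sigma> s i k * \<sigma> s j l
     else 0) = (if s = block i k then
       if block j l = s then A * \<sigma> s i k * \<sigma> s j l else 0 else 0)"
      proof (cases "(i, k) \<in> set (I_om1 s) \<and> (j, l) \<in> set (I_om1 s)")
        case True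
        then have "block i k = s" "block j l = s"
          using I_om1_block s assms by blast+
        then show ?thesis
          using True I_om1_pos[OF s conjunct1[OF True] conjunct2[OF True]] by (simp add: A_def)
      next
        case False
        then have "\<not> (block i k = s \<and> block j l = s)"
          using I_om1_block s assms by blast
        with False show ?thesis by auto
      qed
    qed
  qed
  also have "\<dots> = (if block i k \<in> ix then if block j l = block i k then A * \<sigma> (block i k) i k * \<sigma> (block i k) j l else 0 else 0)"
    by (rule sum.delta[OF finite_ix])
  also have "\<dots> = (if block i k = block j l \<and> block i k \<noteq> 0 then A * \<sigma> (block i k) i k * \<sigma> (block i k) j l else 0)"
    using block_in_ix[OF assms(1,2)] block_not_0[of "block i k"] by (cases "block i k = 0") auto
  finally show ?thesis unfolding A_def .
qed

lemma entry_G_om0: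
  assumes "i \<in> ix" "k \<in> ix" "j \<in> ix" "l \<in> ix"
  shows "entry (G_om0 am ap a1 a2 \<sigma>) i k j l =
    (if i + k = 8 \<and> j + l = 8 then
       (if i < l then am else if i > l then ap
        else (if wt0 i \<and> wt0 k then a1 else 0) + (if \<not> wt0 i \<and> \<not> wt0 k then a2 else 0)) * \<sigma> 1 i k * \<sigma> 1 j l
     else 0)"
proof -
  have *: "(i, k) \<in> set (I_om0 1) \<longleftrightarrow> i + k = 8" "(j, l) \<in> set (I_om0 1) \<longleftrightarrow> j + l = 8"
    using I_om0_mem assms by blast+
  have "{1..1::nat} = {1}" by auto
  then have "entry (G_om0 am ap a1 a2 \<sigma>) i k j l =
    (if (i, k) \<in> set (I_om0 1) \<and> (j, l) \<in> set (I_om0 1) then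
       (if position (I_om0 1) (i, k) + position (I_om0 1) (j, l) < length (I_om0 1) + 1 then am
        else if position (I_om0 1) (i, k) + position (I_om0 1) (j, l) > length (I_om0 1) + 1 then ap
        else (if wt0 i \<and> wt0 k then a1 else 0) + (if \<not> wt0 i \<and> \<not> wt0 k then a2 else 0)) * \<sigma> 1 i k * \<sigma> 1 j l
     else 0)"
    unfolding G_om0_def by (subst entry_G_op[OF assms I_om0_wf]) (simp only: sum.insert sum.empty finite.emptyI empty_iff not_False_eq_True add_0_right)
  also have "\<dots> = (if i + k = 8 \<and> j + l = 8 then
       (if i < l then am else if i > l then ap
        else (if wt0 i \<and> wt0 k then a1 else 0) + (if \<not> wt0 i \<and> \<not> wt0 k then a2 else 0)) * \<sigma> 1 i k * \<sigma> 1 j l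
     else 0)"
    using I_om0_pos[of "(i, k)" 1 "(j, l)"] unfolding * by simp
  finally show ?thesis .
qed

lemma mu_coord_num:
  assumes h: "h \<noteq> 0" and i: "i \<in> ix" and k: "k \<in> ix" and b: "block i k \<noteq> 0"
  shows "mu_coord h t (block i k) i k = mu_num h (h * t) i k / h ^ 6"
  using i k b unfolding ix_def
  by (elim insertE emptyE)
    (simp_all add: block_def mu_coord_def mu_listed_def mu_num_def h field_simps flip: power_Suc power_add)

lemma p_coord_num:
  assumes h: "h \<noteq> 0" and i: "i \<in> ix" "i + k = 8"
  shows "p_coord (h\<^sup>2) s i k = p_num h i / h ^ 10"
  using i unfolding ix_def
  by (elim insertE emptyE)
    (simp_all add: p_coord_def p_num_def h power_int_minus field_simps flip: power_mult power_add)

text \<open>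
  The products \<open>\<mu>\<^sub>i\<^sub>k \<mu>\<^sub>k\<^sub>i\<close> occur together with the parameters \<open>a\<^sub>0\<close>. The first two cases are those
  with the first parameter; in the last one, with the second parameter, the product is \<open>-[2]\<close> up
  to the scaling.
\<close>

lemma mu_num_swap:
  assumes "r * r = h ^ 4 + (1 :: complex)" and i: "i \<in> ix" and k: "k \<in> ix" and b: "block i k \<noteq> 0"
  shows "mu_num h r i k * mu_num h r k i =
    (if i = 4 \<and> k = 4 then h ^ 8 * (h ^ 4 - 1)\<^sup>2
     else if i = 4 \<or> k = 4 \<or> i + k = 8 then - (h ^ 12) else - (h ^ 10 * (h ^ 4 + 1)))"
  using i k b unfolding ix_def assms(1)[symmetric]
  by (elim insertE emptyE)
    (simp_all add: block_def mu_num_def power2_eq_square algebra_simps flip: power_add power_Suc)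

section \<open>The intertwining identities\<close>

text \<open>
  The exponents \<open>kexp g i\<close> lie between \<open>-3\<close> and \<open>3\<close>; the shift by \<open>3\<close> makes the powers polynomial.
\<close>

definition K_pow :: "complex \<Rightarrow> nat \<Rightarrow> int \<Rightarrow> nat \<Rightarrow> complex" where
  "K_pow h g e i = h ^ nat (3 + e * kexp g i)"

lemma block_weight:
  assumes "i \<in> ix" "k \<in> ix" "g \<in> {0, 1, 2}"
  shows "block i k \<noteq> 0 \<longrightarrow> kexp g i + kexp g k = kexp g (block i k)"
    and "i + k = 8 \<longrightarrow> kexp g i + kexp g k = 0"
  using assms unfolding ix_def
  by (elim insertE emptyE; simp add: block_def kexp_def)+

lemma R_num_weight:
  assumes "R_num h r z i k j l \<noteq> 0" and "i \<in> ix" "k \<in> ix" "j \<in> ix" "l \<in> ix" "g \<in> {0, 1, 2}"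
  shows "kexp g i + kexp g k = kexp g j + kexp g l"
proof -
  have "i = j \<and> k = l \<or> i = l \<and> k = j \<or> block i k = block j l \<and> block i k \<noteq> 0 \<or> i + k = 8 \<and> j + l = 8"
  proof (rule ccontr)
    assume "\<not> ?thesis"
    then have n: "\<not> (i = j \<and> k = l)" "\<not> (i = l \<and> k = j)" "\<not> (block i k = block j l \<and> block i k \<noteq> 0)"
      "\<not> (i + k = 8 \<and> j + l = 8)" by blast+
    have "R_num h r z i k j l = 0"
      unfolding R_num_def sl7_num_def S_num_def Q_num_def n[THEN if_not_P] by simp
    with assms(1) show False by contradiction
  qed
  then show ?thesis
    using block_weight[OF assms(2,3,6)] block_weight[OF assms(4,5,6)] by auto
qed

text \<open>
  One integer in place of the two components of a weight keeps the case distinctions below short.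
  The numbers \<open>root_code g\<close> are the shifts of the weight by \<open>E\<^sub>g\<close>.
\<close>

definition weight_code :: "nat \<Rightarrow> int" where
  "weight_code i = [1, 29, -28, 0, 28, -29, -1] ! (i - 1)"

definition root_code :: "nat \<Rightarrow> int" where
  "root_code g = [-30, -28, 57] ! g"

lemma weight_code_kexp: "i \<in> ix \<Longrightarrow> weight_code i = kexp 1 i + 10 * kexp 2 i"
  unfolding ix_def by (elim insertE emptyE) (simp_all add: weight_code_def kexp_def)

lemma weight_code_source: "g \<in> {0, 1, 2} \<Longrightarrow> i \<in> ix \<Longrightarrow>
    row_coeff c d g i = 0 \<or> row_source g i \<in> ix \<and> weight_code (row_source g i) = weight_code i - root_code g"
  unfolding ix_def
  by (elim insertE emptyE) (simp_all add: weight_code_def root_code_def row_coeff_def row_source_def)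

lemma weight_code_target: "g \<in> {0, 1, 2} \<Longrightarrow> i \<in> ix \<Longrightarrow>
    col_coeff c d g i = 0 \<or> col_target g i \<in> ix \<and> weight_code (col_target g i) = weight_code i + root_code g"
  unfolding ix_def
  by (elim insertE emptyE) (simp_all add: weight_code_def root_code_def col_coeff_def col_target_def)

lemma R_num_weight_code:
  assumes "weight_code i + weight_code k \<noteq> weight_code j + weight_code l" and "i \<in> ix" "k \<in> ix" "j \<in> ix" "l \<in> ix"
  shows "R_num h r z i k j l = 0"
proof (rule ccontr)
  assume "R_num h r z i k j l \<noteq> 0"
  note w = R_num_weight[OF this assms(2-5)]
  from w[of 1] w[of 2] assms(1) show False
    unfolding weight_code_kexp[OF assms(2)] weight_code_kexp[OF assms(3)] weight_code_kexp[OF assms(4)] weight_code_kexp[OF assms(5)]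
    by simp
qed

text \<open>
  The verification of the polynomial identities. The weights are compared by a conditional, of
  which the simplifier evaluates the condition first; the entries are unfolded only for the few
  quadruples that satisfy it.
\<close>

lemma R_num_intertwines_block:
  fixes h r z :: complex
  assumes rr: "r * r = h ^ 4 + 1"
    and g: "g \<in> {0, 1, 2}" and i: "i \<in> ix" and k: "k \<in> ix"
  shows "\<forall>j\<in>ix. \<forall>l\<in>ix. if weight_code i + weight_code k = weight_code j + weight_code l + root_code g then
    R_num h r z i k (col_target g j) l * (param z g * col_coeff h r g j * K_pow h g 1 l) +
      R_num h r z i k j (col_target g l) * (col_coeff h r g l * K_pow h g (-1) j) =
    R_num h r z (row_source g i) k j l * (row_coeff h r g i * K_pow h g 1 k) +
      R_num h r z i (row_source g k) j l * (param z g * row_coeff h r g k * K_pow h g (-1) i) else True"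
  using g i unfolding ix_def
  apply (elim insertE emptyE)
  (* One goal for each pair (g, i); each identity left by the simplifier holds either outright
     or modulo the relation for r. *)
  apply ((use k[unfolded ix_def] in \<open>elim insertE emptyE; (simp add: weight_code_def root_code_def)?;
    (simp add: R_num_def sl7_num_def S_num_def Q_num_def block_def mu_num_def p_num_def
      row_source_def row_coeff_def col_target_def col_coeff_def K_pow_def param_def kexp_def
      del: mult_cancel_left mult_cancel_right mult_eq_0_iff)?; (intro conjI)?;
    (thin_tac "_ = (_ :: nat)")+; (algebra | (insert rr, algebra))\<close>)[1])+
  done

text \<open>
  At the positions where the weights do not match, all four terms vanish.
\<close>

lemma R_num_intertwines:
  fixes h r z :: complex
  assumes rr: "r * r = h ^ 4 + 1"
    and g: "g \<in> {0, 1, 2}" and i: "i \<in> ix" and k: "k \<in> ix" and j: "j \<in> ix" and l: "l \<in> ix"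
  shows "R_num h r z i k (col_target g j) l * (param z g * col_coeff h r g j * K_pow h g 1 l) +
      R_num h r z i k j (col_target g l) * (col_coeff h r g l * K_pow h g (-1) j) =
    R_num h r z (row_source g i) k j l * (row_coeff h r g i * K_pow h g 1 k) +
      R_num h r z i (row_source g k) j l * (param z g * row_coeff h r g k * K_pow h g (-1) i)"
proof (cases "weight_code i + weight_code k = weight_code j + weight_code l + root_code g")
  case True
  then show ?thesis
    using bspec[OF bspec[OF R_num_intertwines_block[OF rr g i k] j] l] by (simp only: if_True)
next
  case False
  have "row_coeff h r g i = 0 \<or> R_num h r z (row_source g i) k j l = 0"
    using weight_code_source[OF g i] R_num_weight_code[of "row_source g i" k j l] False k j l by fastforce
  moreover have "row_coeff h r g k = 0 \<or> R_num h r z i (row_source g k) j l = 0"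
    using weight_code_source[OF g k] R_num_weight_code[of i "row_source g k" j l] False i j l by fastforce
  moreover have "col_coeff h r g j = 0 \<or> R_num h r z i k (col_target g j) l = 0"
    using weight_code_target[OF g j] R_num_weight_code[of i k "col_target g j" l] False i k l by fastforce
  moreover have "col_coeff h r g l = 0 \<or> R_num h r z i k j (col_target g l) = 0"
    using weight_code_target[OF g l] R_num_weight_code[of i k j "col_target g l"] False i k j by fastforce
  ultimately show ?thesis
    by (elim disjE) (simp_all only: mult_zero_left mult_zero_right)
qed

text \<open>
  Both comparisons say which of \<open>(i,k)\<close> and \<open>(l,j)\<close> stands first in the common list.
\<close>

lemma block_swap_order:
  assumes "i \<in> ix" "k \<in> ix" "j \<in> ix" "l \<in> ix" "block i k = block j l" "block i k \<noteq> 0"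
  shows "i < l \<longleftrightarrow> j < k" "i = l \<longleftrightarrow> j = k"
proof -
  let ?s = "block i k"
  have s: "?s \<in> ix" by (rule block_in_ix[OF assms(1,2,6)])
  have m: "(i, k) \<in> set (I_om1 ?s)" "(j, l) \<in> set (I_om1 ?s)"
    using I_om1_block[OF assms(1,2) s] I_om1_block[OF assms(3,4) s] assms(5) by simp_all
  show 1: "i < l \<longleftrightarrow> j < k"
    using I_om1_pos(1)[OF s m] I_om1_pos(1)[OF s m(2,1)] by (simp add: add.commute)
  have "i > l \<longleftrightarrow> j > k"
    using I_om1_pos(2)[OF s m] I_om1_pos(2)[OF s m(2,1)] by (simp add: add.commute)
  with 1 show "i = l \<longleftrightarrow> j = k" by linarith
qed

lemma R_num_sym:
  assumes "i \<in> ix" "k \<in> ix" "j \<in> ix" "l \<in> ix"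
  shows "R_num h r z i k j l = R_num h r z j l i k"
proof -
  have "sl7_num h z i k j l = sl7_num h z j l i k"
  proof (cases "i = j \<and> k = l")
    case True
    then show ?thesis by (elim conjE) (simp only:)
  next
    case False
    then have "\<not> (j = i \<and> l = k)" "(j = k \<and> l = i) = (i = l \<and> k = j)" by auto
    with False show ?thesis by (simp only: sl7_num_def if_False)
  qed
  moreover have "S_num h r z i k j l = S_num h r z j l i k"
  proof (cases "block i k = block j l \<and> block i k \<noteq> 0")
    case True
    note o = block_swap_order[OF assms conjunct1[OF True] conjunct2[OF True]]
    have m: "mu_num h r i k * mu_num h r j l = mu_num h r j l * mu_num h r i k" by (rule mult.commute)
    from True have T: "block j l = block i k \<and> block j l \<noteq> 0" by simp
    consider "i < l" "j < k" | "\<not> i < l" "\<not> j < k" "l < i" "k < j" | "i = l" "j = k"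
      using o by (metis linorder_neqE_nat not_less_iff_gr_or_eq)
    then show ?thesis
      unfolding S_num_def if_P[OF True] if_P[OF T] m
    proof cases
      case 3
      have "k = 4 \<and> l = 4 \<longleftrightarrow> l = 4 \<and> k = 4" "k = 4 \<or> l = 4 \<or> k + l = 8 \<longleftrightarrow> l = 4 \<or> k = 4 \<or> l + k = 8"
        by auto
      with 3 show "(1 - z) * (if i < l then (h ^ 4 - 1) * z * (mu_num h r j l * mu_num h r i k)
          else if l < i then (h ^ 4 - 1) * h ^ 16 * (mu_num h r j l * mu_num h r i k)
          else if i = 4 \<and> k = 4 then (h\<^sup>2 - 1) * (h ^ 14 + z) * h ^ 10 * (h ^ 4 - 1)\<^sup>2
          else if i = 4 \<or> k = 4 \<or> i + k = 8 then - (h ^ 14 * (h\<^sup>2 - 1) * (h ^ 14 + z))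
          else - (h ^ 14 * (h ^ 4 - 1) * (h ^ 12 + z))) =
        (1 - z) * (if j < k then (h ^ 4 - 1) * z * (mu_num h r j l * mu_num h r i k)
          else if k < j then (h ^ 4 - 1) * h ^ 16 * (mu_num h r j l * mu_num h r i k)
          else if j = 4 \<and> l = 4 then (h\<^sup>2 - 1) * (h ^ 14 + z) * h ^ 10 * (h ^ 4 - 1)\<^sup>2
          else if j = 4 \<or> l = 4 \<or> j + l = 8 then - (h ^ 14 * (h\<^sup>2 - 1) * (h ^ 14 + z))
          else - (h ^ 14 * (h ^ 4 - 1) * (h ^ 12 + z)))"
        by (simp only: order_less_irrefl if_False)
    qed (simp_all only: if_True if_False)
  next
    case False
    then have "\<not> (block j l = block i k \<and> block j l \<noteq> 0)" by auto
    with False show ?thesis by (simp only: S_num_def if_False)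
  qed
  moreover have "Q_num h z i k j l = Q_num h z j l i k"
  proof (cases "i + k = 8 \<and> j + l = 8")
    case True
    then have "i < l \<longleftrightarrow> j < k" "l < i \<longleftrightarrow> k < j" by linarith+
    moreover have "i = 4 \<longleftrightarrow> j = 4" if "\<not> i < l" "\<not> l < i" using True that by linarith
    moreover have "p_num h i * p_num h j = p_num h j * p_num h i" by (rule mult.commute)
    moreover have "j + l = 8 \<and> i + k = 8" using True by simp
    ultimately show ?thesis
      using True by (simp only: Q_num_def simp_thms if_True cong: if_cong)
  next
    case False
    then have "\<not> (j + l = 8 \<and> i + k = 8)" by auto
    with False show ?thesis by (simp only: Q_num_def if_False)
  qed
  ultimately show ?thesis by (simp add: R_num_def)
qed

section \<open>The explicit operator is an intertwiner\<close>

locale G2_parameters =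
  fixes h t :: complex
  assumes h_nz: "h \<noteq> 0"
    and generic: "n > 0 \<Longrightarrow> (h\<^sup>2) ^ n \<noteq> 1"
    and t_sq: "t\<^sup>2 = h\<^sup>2 + inverse (h\<^sup>2)"
begin

text \<open>
  Since \<open>h\<close> is a square root of \<open>q\<close>, it is not a root of unity either. All nonvanishing statements
  below are reduced to this.
\<close>

lemma h_power_ne_1: "n > 0 \<Longrightarrow> h ^ n \<noteq> 1"
  using generic[of n] by (metis power_mult power_one mult.commute)

lemma h_power_ne_minus_1: "n > 0 \<Longrightarrow> h ^ n + 1 \<noteq> 0"
proof
  assume n: "n > 0" "h ^ n + 1 = 0"
  then have "h ^ (n + n) = 1" unfolding power_add by (simp add: eq_neg_iff_add_eq_0[symmetric])
  with h_power_ne_1[of "n + n"] n(1) show False by simp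
qed

lemma r_sq: "(h * t) * (h * t) = h ^ 4 + 1"
proof -
  have "(h * t) * (h * t) = h\<^sup>2 * t\<^sup>2" by (simp add: power2_eq_square)
  also have "\<dots> = h ^ 4 + 1" unfolding t_sq using h_nz by (simp add: field_simps flip: power_add)
  finally show ?thesis .
qed

lemma t_nz: "t \<noteq> 0"
  using r_sq h_power_ne_minus_1[of 4] by auto

definition poles :: "complex set" where "poles = {h ^ 4, h ^ 16, h ^ 24}"

lemma R_den_nz: "z \<notin> poles \<Longrightarrow> R_den h z \<noteq> 0"
  using h_nz by (auto simp: R_den_def poles_def)

lemma powi_neg: "(x :: complex) powi (- 1) = inverse x" "x powi (- numeral n) = inverse (x ^ numeral n)"
  by (simp_all add: power_int_minus)

lemma q_factors:
  "h\<^sup>2 - (h\<^sup>2) powi (- 1) = (h ^ 4 - 1) / h ^ 2"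
  "h\<^sup>2 - (h\<^sup>2) powi (- 1) * z = (h ^ 4 - z) / h ^ 2"
  "(h\<^sup>2) ^ 4 - (h\<^sup>2) powi (- 4) * z = (h ^ 16 - z) / h ^ 8"
  "(h\<^sup>2) ^ 6 - (h\<^sup>2) powi (- 6) * z = (h ^ 24 - z) / h ^ 12"
  "(h\<^sup>2) ^ 2 + (h\<^sup>2) powi (- 2) = (h ^ 8 + 1) / h ^ 4"
  using h_nz by (simp_all add: powi_neg field_simps flip: power_mult power_add)

lemma entry_R_sl7_num:
  assumes "i \<in> ix" "k \<in> ix" "j \<in> ix" "l \<in> ix" "z \<notin> poles"
  shows "entry (R_sl7 (h\<^sup>2) z) i k j l = sl7_num h z i k j l / (h ^ 4 - z)"
proof -
  define a where "a = h ^ 4 - z"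
  have a: "a \<noteq> 0" using assms(5) by (auto simp: a_def poles_def)
  have e: "x / (a / h\<^sup>2) = x * h\<^sup>2 / a" "x * ((h ^ 4 - 1) / h\<^sup>2) * h\<^sup>2 = x * (h ^ 4 - 1)"
    "(h ^ 4 - 1) / h\<^sup>2 * h\<^sup>2 = h ^ 4 - 1" for x
    using h_nz a by simp_all
  show ?thesis
    unfolding entry_R_sl7[OF assms(1-4)] q_factors sl7_num_def if_distrib[of "\<lambda>x. x / (h ^ 4 - z)"]
    unfolding a_def[symmetric] e divide_self[OF a] div_0 ..
qed

lemma wt0_iff: "i \<in> ix \<Longrightarrow> wt0 i \<longleftrightarrow> i = 4"
  unfolding ix_def by (elim insertE emptyE) (simp_all add: wt0_def kexp_def)

lemma wt0_tensor_iff: "i \<in> ix \<Longrightarrow> k \<in> ix \<Longrightarrow> wt0_tensor i k \<longleftrightarrow> i + k = 8"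
  unfolding ix_def by (elim insertE emptyE) (simp_all add: wt0_tensor_def kexp_def)

lemma block_swap: "i \<in> ix \<Longrightarrow> k \<in> ix \<Longrightarrow> j \<in> ix \<Longrightarrow> block i k = block j i \<Longrightarrow> block i k \<noteq> 0 \<Longrightarrow> j = k"
  unfolding ix_def by (elim insertE emptyE) (simp_all add: block_def)

text \<open>
  The two parameters \<open>a\<^sub>0\<close> of \<open>\<omega>\<^sub>1\<close>. The second one is multiplied by \<open>h\<^sup>4 + 1\<close>, the numerator of
  \<open>[2]\<close>, which is supplied by \<open>\<mu>\<^sub>i\<^sub>k \<mu>\<^sub>k\<^sub>i\<close>.
\<close>

lemma S_diag:
  assumes "h ^ 4 + 1 \<noteq> (0 :: complex)" "h\<^sup>2 + 1 \<noteq> 0" "h \<noteq> 0"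
  shows "(h ^ 4 - 1) * ((h powi 7 + h powi - 7 * z) / (h + h powi - 1)) = (h\<^sup>2 - 1) * (h ^ 14 + z) / h ^ 6"
    "(h ^ 4 - 1) * (((h\<^sup>2) ^ 3 + (h\<^sup>2) powi - 3 * z) / (h\<^sup>2 + (h\<^sup>2) powi - 1)) * (h ^ 4 + 1) = (h ^ 4 - 1) * (h ^ 12 + z) / h ^ 4"
proof -
  define X Y where "X = h\<^sup>2 + 1" and "Y = h ^ 4 + 1"
  have nz: "X \<noteq> 0" "Y \<noteq> 0" using assms by (simp_all add: X_def Y_def)
  have 1: "h + h powi - 1 = X / h" unfolding X_def
    using assms(3) by (simp add: powi_neg field_simps power2_eq_square)
  have 2: "h powi 7 + h powi - 7 * z = (h ^ 14 + z) / h ^ 7"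
    "(h\<^sup>2) ^ 3 + (h\<^sup>2) powi - 3 * z = (h ^ 12 + z) / h ^ 6" "h\<^sup>2 + (h\<^sup>2) powi - 1 = Y / h ^ 2"
    unfolding Y_def using assms(3) by (simp_all add: powi_neg field_simps flip: power_mult power_add)
  have 3: "h ^ 4 - 1 = X * (h\<^sup>2 - 1)"
    unfolding X_def by (simp add: algebra_simps flip: power_add)
  have 4: "h ^ 7 = h ^ 6 * h" by (simp flip: power_Suc2)
  have 5: "x * (y / h ^ 6 / (Y / h\<^sup>2)) * Y = x * y / h ^ 4" for x y
    using assms(3) nz by (simp add: field_simps flip: power_add)
  show "(h ^ 4 - 1) * ((h powi 7 + h powi - 7 * z) / (h + h powi - 1)) = (h\<^sup>2 - 1) * (h ^ 14 + z) / h ^ 6"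
    unfolding 1 2 3 4 using assms(3) nz by simp
  show "(h ^ 4 - 1) * (((h\<^sup>2) ^ 3 + (h\<^sup>2) powi - 3 * z) / (h\<^sup>2 + (h\<^sup>2) powi - 1)) * (h ^ 4 + 1) = (h ^ 4 - 1) * (h ^ 12 + z) / h ^ 4"
    unfolding 1 2 Y_def[symmetric] by (rule 5)
qed

lemma entry_S_num:
  assumes "i \<in> ix" "k \<in> ix" "j \<in> ix" "l \<in> ix" "z \<notin> poles"
  shows "((h\<^sup>2 - (h\<^sup>2) powi (- 1)) * (1 - z) /
      ((h\<^sup>2 - (h\<^sup>2) powi (- 1) * z) * ((h\<^sup>2) ^ 4 - (h\<^sup>2) powi (- 4) * z))) * entry (S_op h t z) i k j l =
    S_num h (h * t) z i k j l / (h ^ 12 * ((h ^ 4 - z) * (h ^ 16 - z)))"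
proof -
  define a b where "a = h ^ 4 - z" and "b = h ^ 16 - z"
  have ab: "a \<noteq> 0" "b \<noteq> 0" using assms(5) by (auto simp: poles_def a_def b_def)
  have pre: "(h\<^sup>2 - (h\<^sup>2) powi (- 1)) * (1 - z) /
      ((h\<^sup>2 - (h\<^sup>2) powi (- 1) * z) * ((h\<^sup>2) ^ 4 - (h\<^sup>2) powi (- 4) * z)) =
      (h ^ 4 - 1) * (1 - z) * h ^ 8 / (a * b)"
    unfolding q_factors a_def[symmetric] b_def[symmetric] using h_nz ab by (simp add: field_simps)
  show ?thesis
    unfolding pre a_def[symmetric] b_def[symmetric]
  proof (cases "block i k = block j l \<and> block i k \<noteq> 0")
    case False
    then show "(h ^ 4 - 1) * (1 - z) * h ^ 8 / (a * b) * entry (S_op h t z) i k j l =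
        S_num h (h * t) z i k j l / (h ^ 12 * (a * b))"
      unfolding S_op_def Let_def entry_G_om1[OF assms(1-4)] S_num_def if_not_P[OF False] by simp
  next
    case True
    note mu = mu_coord_num[OF h_nz assms(1,2) conjunct2[OF True], of t]
      mu_coord_num[OF h_nz assms(3,4), of t, folded conjunct1[OF True], OF conjunct2[OF True]]
    consider "i < l" | "i > l" | "i = l" "j = k"
      using block_swap[OF assms(1-3)] True by (metis linorder_neqE_nat)
    then show "(h ^ 4 - 1) * (1 - z) * h ^ 8 / (a * b) * entry (S_op h t z) i k j l =
        S_num h (h * t) z i k j l / (h ^ 12 * (a * b))"
    proof cases
      case 1
      have "c * (1 - z) * h ^ 8 / (a * b) * (z * inverse (h ^ 8) * (x / h ^ 6) * (y / h ^ 6)) =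
          (1 - z) * (c * z * (x * y)) / (h ^ 12 * (a * b))" for c x y
        using h_nz ab by (simp add: field_simps flip: power_add)
      with 1 show ?thesis
        unfolding S_op_def Let_def entry_G_om1[OF assms(1-4)] S_num_def if_P[OF True] mu
        by (simp add: powi_neg flip: power_mult)
    next
      case 2
      then show ?thesis
        unfolding S_op_def Let_def entry_G_om1[OF assms(1-4)] S_num_def if_P[OF True] mu
        using h_nz ab by (simp add: field_simps flip: power_mult power_add)
    next
      case 3
      have lk: "l = i" "j = k" and nl: "\<not> i < l" "\<not> l < i" using 3 by simp_all
      have g: "c * (1 - z) * h ^ 8 / (a * b) * (A * (x / h ^ 6) * (y / h ^ 6)) =
          (1 - z) * h ^ 8 / (a * b) * (c * A * (x * y)) / h ^ 12" for c A x y
        using h_nz ab by (simp add: field_simps flip: power_add)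
      let ?A1 = "(h powi 7 + h powi - 7 * z) / (h + h powi - 1)"
      let ?A2 = "((h\<^sup>2) ^ 3 + (h\<^sup>2) powi - 3 * z) / (h\<^sup>2 + (h\<^sup>2) powi - 1)"
      let ?c1 = "i = 4 \<or> k = 4 \<or> i + k = 8"
      have "(h ^ 4 - 1) * (1 - z) * h ^ 8 / (a * b) * entry (S_op h t z) i k j l =
          (1 - z) * h ^ 8 / (a * b) * ((h ^ 4 - 1) * (if ?c1 then ?A1 else ?A2) * (mu_num h (h * t) i k * mu_num h (h * t) k i)) / h ^ 12"
        unfolding S_op_def Let_def entry_G_om1[OF assms(1-4)] if_P[OF True] mu if_not_P[OF nl(1)] if_not_P[OF nl(2)]
          wt0_iff[OF assms(1)] wt0_iff[OF assms(2)] wt0_tensor_iff[OF assms(1,2)]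
        unfolding lk g ..
      also have "(h ^ 4 - 1) * (if ?c1 then ?A1 else ?A2) * (mu_num h (h * t) i k * mu_num h (h * t) k i) =
         (if i = 4 \<and> k = 4 then (h\<^sup>2 - 1) * (h ^ 14 + z) / h ^ 6 * (h ^ 8 * (h ^ 4 - 1)\<^sup>2)
          else if ?c1 then (h\<^sup>2 - 1) * (h ^ 14 + z) / h ^ 6 * - (h ^ 12)
          else (h ^ 4 - 1) * (h ^ 12 + z) / h ^ 4 * - (h ^ 10))"
        unfolding mu_num_swap[OF r_sq assms(1,2) conjunct2[OF True]]
          S_diag[OF h_power_ne_minus_1[of 4] h_power_ne_minus_1[of 2] h_nz, simplified, symmetric]
        by simp
      also have "(1 - z) * h ^ 8 / (a * b) * \<dots> / h ^ 12 = S_num h (h * t) z i k j l / (h ^ 12 * (a * b))"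
        unfolding S_num_def if_P[OF True] using 3 h_nz ab by (simp add: field_simps flip: power_add)
      finally show ?thesis .
    qed
  qed
qed

lemma entry_Q_num:
  assumes "i \<in> ix" "k \<in> ix" "j \<in> ix" "l \<in> ix" "z \<notin> poles"
  shows "((h\<^sup>2 - (h\<^sup>2) powi (- 1)) * ((h\<^sup>2) ^ 2 + (h\<^sup>2) powi (- 2)) * (1 - z) /
      ((h\<^sup>2 - (h\<^sup>2) powi (- 1) * z) * ((h\<^sup>2) ^ 6 - (h\<^sup>2) powi (- 6) * z))) * entry (Q_op (h\<^sup>2) z) i k j l =
    Q_num h z i k j l / (h ^ 24 * ((h ^ 4 - z) * (h ^ 24 - z)))"
proof -
  define a b where "a = h ^ 4 - z" and "b = h ^ 24 - z"
  have ab: "a \<noteq> 0" "b \<noteq> 0" using assms(5) by (auto simp: poles_def a_def b_def)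
  have pre: "(h\<^sup>2 - (h\<^sup>2) powi (- 1)) * ((h\<^sup>2) ^ 2 + (h\<^sup>2) powi (- 2)) * (1 - z) /
      ((h\<^sup>2 - (h\<^sup>2) powi (- 1) * z) * ((h\<^sup>2) ^ 6 - (h\<^sup>2) powi (- 6) * z)) =
      (h ^ 4 - 1) * (h ^ 8 + 1) * (1 - z) * h ^ 8 / (a * b)"
    unfolding q_factors a_def[symmetric] b_def[symmetric] using h_nz ab
    by (simp add: field_simps flip: power_add)
  have h8: "h ^ 8 + 1 \<noteq> 0" by (rule h_power_ne_minus_1) simp
  show ?thesis
    unfolding pre a_def[symmetric] b_def[symmetric]
  proof (cases "i + k = 8 \<and> j + l = 8")
    case False
    then show "(h ^ 4 - 1) * (h ^ 8 + 1) * (1 - z) * h ^ 8 / (a * b) * entry (Q_op (h\<^sup>2) z) i k j l =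
        Q_num h z i k j l / (h ^ 24 * (a * b))"
      unfolding Q_op_def Let_def entry_G_om0[OF assms(1-4)] Q_num_def if_not_P[OF False] by simp
  next
    case True
    note p = p_coord_num[OF h_nz assms(1) conjunct1[OF True]] p_coord_num[OF h_nz assms(3) conjunct2[OF True]]
    consider "i < l" | "i > l" | "i = l" "j = k" "i = 4" "k = 4" | "i = l" "j = k" "i \<noteq> 4" "k \<noteq> 4"
      using True by linarith
    then show "(h ^ 4 - 1) * (h ^ 8 + 1) * (1 - z) * h ^ 8 / (a * b) * entry (Q_op (h\<^sup>2) z) i k j l =
        Q_num h z i k j l / (h ^ 24 * (a * b))"
    proof cases
      case 1
      then show ?thesis
        unfolding Q_op_def Let_def entry_G_om0[OF assms(1-4)] Q_num_def if_P[OF True] p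
        using h_nz ab by (simp add: powi_neg field_simps flip: power_mult power_add)
    next
      case 2
      then show ?thesis
        unfolding Q_op_def Let_def entry_G_om0[OF assms(1-4)] Q_num_def if_P[OF True] p
        using h_nz ab by (simp add: field_simps flip: power_mult power_add)
    next
      case 3
      have p4: "p_num h 4 * p_num h 4 = h ^ 20" by (simp add: p_num_def flip: power_add)
      have e: "(h\<^sup>2) ^ 7 - (h\<^sup>2) ^ 5 + (h\<^sup>2) ^ 4 + ((h\<^sup>2) powi - 4 - (h\<^sup>2) powi - 5 + (h\<^sup>2) powi - 7) * z
          = (h ^ 28 - h ^ 24 + h ^ 22 + (h ^ 6 - h ^ 4 + 1) * z) / h ^ 14"
        using h_nz by (simp add: powi_neg field_simps flip: power_mult power_add)
      have g: "c * d * w * h ^ 8 / (a * b) * (u / h ^ 14 / (d / h ^ 4) * (x / h ^ 10) * (x / h ^ 10)) =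
          w * c * (h\<^sup>2 * (x * x) * u) / (h ^ 24 * (a * b))" if "d \<noteq> 0" for c d w u x
        using that h_nz ab by (simp add: field_simps flip: power_add)
      have "(h ^ 4 - 1) * (h ^ 8 + 1) * (1 - z) * h ^ 8 / (a * b) * entry (Q_op (h\<^sup>2) z) i k j l =
          (1 - z) * (h ^ 4 - 1) * (h\<^sup>2 * (p_num h 4 * p_num h 4) *
            (h ^ 28 - h ^ 24 + h ^ 22 + (h ^ 6 - h ^ 4 + 1) * z)) / (h ^ 24 * (a * b))"
        unfolding Q_op_def Let_def entry_G_om0[OF assms(1-4)] if_P[OF True] p q_factors e
          g[OF h8, symmetric]
        using 3 wt0_iff[OF assms(1)] by (simp only: simp_thms if_True if_False order_less_irrefl add_0_right)
      also have "h\<^sup>2 * (p_num h 4 * p_num h 4) = h ^ 22"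
        unfolding p4 by (simp flip: power_add)
      also have "(1 - z) * (h ^ 4 - 1) * (h ^ 22 * (h ^ 28 - h ^ 24 + h ^ 22 + (h ^ 6 - h ^ 4 + 1) * z)) =
          Q_num h z i k j l"
        using 3 by (simp add: Q_num_def)
      finally show ?thesis .
    next
      case 4
      have "p_num h i * p_num h k = h ^ 20"
        using assms(1,2) conjunct1[OF True] unfolding ix_def
        by (elim insertE emptyE) (simp_all add: p_num_def flip: power_add)
      then have pp: "p_num h i * p_num h j = h ^ 20" using 4 by simp
      have e: "(h\<^sup>2) ^ 4 + (h\<^sup>2) powi - 4 * z = (h ^ 16 + z) / h ^ 8"
        using h_nz by (simp add: powi_neg field_simps flip: power_mult power_add)
      have g: "c * d * w * h ^ 8 / (a * b) * (u / h ^ 8 / (d / h ^ 4) * (x / h ^ 10) * (y / h ^ 10)) =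
          w * c * (h ^ 8 * (x * y) * u) / (h ^ 24 * (a * b))" if "d \<noteq> 0" for c d w u x y
        using that h_nz ab by (simp add: field_simps flip: power_add)
      have "(h ^ 4 - 1) * (h ^ 8 + 1) * (1 - z) * h ^ 8 / (a * b) * entry (Q_op (h\<^sup>2) z) i k j l =
          (1 - z) * (h ^ 4 - 1) * (h ^ 8 * (p_num h i * p_num h j) * (h ^ 16 + z)) / (h ^ 24 * (a * b))"
        unfolding Q_op_def Let_def entry_G_om0[OF assms(1-4)] if_P[OF True] p q_factors e
          g[OF h8, symmetric]
        using 4 wt0_iff[OF assms(1)] wt0_iff[OF assms(2)]
        by (simp only: simp_thms if_True if_False order_less_irrefl add_0_left)
      also have "h ^ 8 * (p_num h i * p_num h j) = h ^ 28"
        unfolding pp by (simp flip: power_add)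
      also have "(1 - z) * (h ^ 4 - 1) * (h ^ 28 * (h ^ 16 + z)) = Q_num h z i k j l"
        using 4 True by (simp add: Q_num_def)
      finally show ?thesis .
    qed
  qed
qed

lemma entry_R_expl:
  assumes "i \<in> ix" "k \<in> ix" "j \<in> ix" "l \<in> ix" "z \<notin> poles"
  shows "entry (R_expl h t z) i k j l = R_num h (h * t) z i k j l / R_den h z"
proof -
  define a b c where "a = h ^ 4 - z" and "b = h ^ 16 - z" and "c = h ^ 24 - z"
  have abc: "a \<noteq> 0" "b \<noteq> 0" "c \<noteq> 0" using assms(5) by (auto simp: poles_def a_def b_def c_def)
  have "x / a + y / (h ^ 12 * (a * b)) - w / (h ^ 24 * (a * c)) =
      (h ^ 24 * b * c * x + h ^ 12 * c * y - b * w) / (h ^ 24 * a * b * c)" for x y w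
    using h_nz abc by (simp add: field_simps flip: power_add)
  then show ?thesis
    unfolding R_expl_def Let_def entry_simps entry_R_sl7_num[OF assms] entry_S_num[OF assms] entry_Q_num[OF assms]
      R_num_def R_den_def a_def b_def c_def .
qed

lemma scaled_coeffs:
  assumes "g \<le> 2" "i \<in> ix"
  shows "row_coeff h (h * t) g i = h * row_coeff 1 t g i" "col_coeff h (h * t) g i = h * col_coeff 1 t g i"
    "K_pow h g 1 i = h ^ 3 * h powi kexp g i" "K_pow h g (-1) i = h ^ 3 * h powi (- kexp g i)"
proof -
  show "row_coeff h (h * t) g i = h * row_coeff 1 t g i" "col_coeff h (h * t) g i = h * col_coeff 1 t g i"
    using le_2_cases[OF assms(1)] assms(2) unfolding ix_def
    by (elim insertE emptyE; simp add: row_coeff_def col_coeff_def)+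
  have "kexp g i \<in> {-3, -2, -1, 0, 1, 2, 3}"
    using le_2_cases[OF assms(1)] assms(2) unfolding ix_def
    by (elim insertE emptyE; simp add: kexp_def)
  then show "K_pow h g 1 i = h ^ 3 * h powi kexp g i" "K_pow h g (-1) i = h ^ 3 * h powi (- kexp g i)"
    using h_nz unfolding K_pow_def
    by (elim insertE emptyE; simp add: power_int_minus field_simps flip: power_add power_Suc power_Suc2)+
qed

lemma le_2_iff: "g \<le> 2 \<longleftrightarrow> g \<in> {0, 1, 2 :: nat}"
  by auto

text \<open>
  The relation at one position, multiplied by \<open>h\<^sup>4\<close> and the common denominator, is the polynomial
  identity \<open>R_num_intertwines\<close>.
\<close>

lemma R_expl_intertwines_E:
  assumes g: "g \<le> 2" and z: "z \<notin> poles"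
  shows "R_expl h t z ** Eop (tensor_rep (V_rep h t z) (V_rep h t 1)) g =
    Eop (tensor_rep (V_rep h t 1) (V_rep h t z)) g ** R_expl h t z"
proof (rule entry_eqI)
  fix i k j l assume ix: "i \<in> ix" "k \<in> ix" "j \<in> ix" "l \<in> ix"
  let ?R = "entry (R_expl h t z)" and ?N = "R_num h (h * t) z" and ?D = "R_den h z"
  have g': "g \<in> {0, 1, 2}" using g by (simp add: le_2_iff)
  have h4: "h ^ 4 = h * h ^ 3" by (simp flip: power_Suc)
  have param1: "param 1 g = 1" by (simp add: param_def)
  have N: "i' \<in> ix \<Longrightarrow> k' \<in> ix \<Longrightarrow> j' \<in> ix \<Longrightarrow> l' \<in> ix \<Longrightarrow> ?R i' k' j' l' * ?D = ?N i' k' j' l'" for i' k' j' l'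
    using R_den_nz[OF z] by (simp add: entry_R_expl[OF _ _ _ _ z])
  have 1: "col_coeff 1 t g j * (?R i k (col_target g j) l * ?D) = col_coeff 1 t g j * ?N i k (col_target g j) l"
    using weight_code_target[OF g' ix(3), of 1 t] N ix by force
  have 2: "col_coeff 1 t g l * (?R i k j (col_target g l) * ?D) = col_coeff 1 t g l * ?N i k j (col_target g l)"
    using weight_code_target[OF g' ix(4), of 1 t] N ix by force
  have 3: "row_coeff 1 t g i * (?R (row_source g i) k j l * ?D) = row_coeff 1 t g i * ?N (row_source g i) k j l"
    using weight_code_source[OF g' ix(1), of 1 t] N ix by force
  have 4: "row_coeff 1 t g k * (?R i (row_source g k) j l * ?D) = row_coeff 1 t g k * ?N i (row_source g k) j l"
    using weight_code_source[OF g' ix(2), of 1 t] N ix by force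
  define lhs where "lhs = param z g * col_coeff 1 t g j * h powi kexp g l * ?R i k (col_target g j) l +
    col_coeff 1 t g l * h powi (- kexp g j) * ?R i k j (col_target g l)"
  define rhs where "rhs = row_coeff 1 t g i * h powi kexp g k * ?R (row_source g i) k j l +
    param z g * row_coeff 1 t g k * h powi (- kexp g i) * ?R i (row_source g k) j l"
  have "lhs * ?D * h ^ 4 = h ^ 4 * (param z g * h powi kexp g l * (col_coeff 1 t g j * (?R i k (col_target g j) l * ?D)) +
    h powi (- kexp g j) * (col_coeff 1 t g l * (?R i k j (col_target g l) * ?D)))"
    unfolding lhs_def by (simp only: ring_distribs mult_ac)
  also have "\<dots> = ?N i k (col_target g j) l * (param z g * (h * col_coeff 1 t g j) * (h ^ 3 * h powi kexp g l)) +
      ?N i k j (col_target g l) * ((h * col_coeff 1 t g l) * (h ^ 3 * h powi (- kexp g j)))"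
    unfolding 1 2 h4 by (simp only: ring_distribs mult_ac)
  also have "\<dots> = ?N (row_source g i) k j l * ((h * row_coeff 1 t g i) * (h ^ 3 * h powi kexp g k)) +
      ?N i (row_source g k) j l * (param z g * (h * row_coeff 1 t g k) * (h ^ 3 * h powi (- kexp g i)))"
    using R_num_intertwines[OF r_sq g' ix, of z] unfolding scaled_coeffs[OF g ix(1)] scaled_coeffs[OF g ix(2)]
      scaled_coeffs[OF g ix(3)] scaled_coeffs[OF g ix(4)] .
  also have "\<dots> = h ^ 4 * (h powi kexp g k * (row_coeff 1 t g i * (?R (row_source g i) k j l * ?D)) +
      param z g * h powi (- kexp g i) * (row_coeff 1 t g k * (?R i (row_source g k) j l * ?D)))"
    unfolding 3 4 h4 by (simp only: ring_distribs mult_ac)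
  also have "\<dots> = rhs * ?D * h ^ 4"
    unfolding rhs_def by (simp only: ring_distribs mult_ac)
  finally have "lhs = rhs" using R_den_nz[OF z] h_nz by simp
  then show "entry (R_expl h t z ** Eop (tensor_rep (V_rep h t z) (V_rep h t 1)) g) i k j l =
      entry (Eop (tensor_rep (V_rep h t 1) (V_rep h t z)) g ** R_expl h t z) i k j l"
    unfolding entry_mult tensor_E_col[OF g ix(3,4)] tensor_E_row[OF g ix(1,2)] lhs_def rhs_def param1
    by (simp only: mult_1_left)
qed

lemma R_expl_sym: "z \<notin> poles \<Longrightarrow> transpose (R_expl h t z) = R_expl h t z"
  by (rule entry_eqI) (simp add: entry_simps entry_R_expl R_num_sym)

lemma R_expl_K:
  assumes z: "z \<notin> poles" and g: "g \<le> 2"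
  shows "R_expl h t z ** Kh (VV h t) g m = Kh (VV h t) g m ** R_expl h t z"
proof (rule entry_eqI)
  fix i k j l assume ix: "i \<in> ix" "k \<in> ix" "j \<in> ix" "l \<in> ix"
  let ?R = "entry (R_expl h t z)"
  define c where "c i k = h powi (m * kexp g i) * h powi (m * kexp g k)" for i k
  have K: "entry (Kh (VV h t) g m) a b a' b' = (if a = a' then if b = b' then c a b else 0 else 0)"
    if "a \<in> ix" "b \<in> ix" "a' \<in> ix" "b' \<in> ix" for a b a' b'
    unfolding VV_def c_def by (simp add: entry_tensor_K that)
  have "entry (R_expl h t z ** Kh (VV h t) g m) i k j l =
      (\<Sum>a\<in>ix. \<Sum>b\<in>ix. if a = j then if b = l then ?R i k j l * c j l else 0 else 0)"
    unfolding entry_mult by (intro sum.cong refl) (simp add: K ix)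
  also have "\<dots> = ?R i k j l * c j l" by (simp add: sum_delta_pair ix)
  also have "\<dots> = c i k * ?R i k j l"
  proof (cases "?R i k j l = 0")
    case False
    then have "R_num h (h * t) z i k j l \<noteq> 0" by (simp add: entry_R_expl[OF ix z])
    then have "kexp g i + kexp g k = kexp g j + kexp g l"
      using R_num_weight ix g by (simp add: le_2_iff)
    then have "m * kexp g i + m * kexp g k = m * kexp g j + m * kexp g l"
      by (simp flip: distrib_left)
    then have "c i k = c j l"
      using h_nz unfolding c_def by (simp flip: power_int_add)
    then show ?thesis by simp
  qed simp
  also have "\<dots> = (\<Sum>a\<in>ix. \<Sum>b\<in>ix. if a = i then if b = k then c i k * ?R i k j l else 0 else 0)"
    by (simp add: sum_delta_pair ix)
  also have "\<dots> = entry (Kh (VV h t) g m ** R_expl h t z) i k j l"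
    unfolding entry_mult by (intro sum.cong refl) (simp add: K ix)
  finally show "entry (R_expl h t z ** Kh (VV h t) g m) i k j l = entry (Kh (VV h t) g m ** R_expl h t z) i k j l" .
qed

lemma R_expl_intertwines:
  assumes z: "z \<notin> poles" "z \<noteq> 0"
  shows "intertwines (tensor_rep (V_rep h t z) (V_rep h t 1)) (tensor_rep (V_rep h t 1) (V_rep h t z)) (R_expl h t z)"
  unfolding intertwines_def
proof (intro allI impI conjI)
  fix g :: nat assume g: "g \<le> 2"
  let ?s = "tensor_rep (V_rep h t z) (V_rep h t 1)" and ?t = "tensor_rep (V_rep h t 1) (V_rep h t z)"
  let ?R = "R_expl h t z"
  show E: "?R ** Eop ?s g = Eop ?t g ** ?R"
    by (rule R_expl_intertwines_E[OF g z(1)])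
  have "transpose (Eop ?s g) ** ?R = ?R ** transpose (Eop ?t g)"
    using arg_cong[OF E, of transpose] by (simp add: matrix_transpose_mul R_expl_sym[OF z(1)])
  then show "?R ** Fop ?s g = Fop ?t g ** ?R"
    using g by (cases "g = 0") (simp_all add: tensor_F0 z(2) smult_mat_simps tensor_F le_2_iff tensor_E_indep)
  show "?R ** Kh ?s g 2 = Kh ?t g 2 ** ?R" "?R ** Kh ?s g (-2) = Kh ?t g (-2) ** ?R"
    unfolding tensor_K_indep by (rule R_expl_K[OF z(1) g])+
qed

end

section \<open>Singular vectors\<close>

definition weights :: "(nat \<times> nat) set" where
  "weights = {twice_om1, om2, om1, om0}"

lemma weights_distinct:
  "twice_om1 \<noteq> om2" "twice_om1 \<noteq> om1" "twice_om1 \<noteq> om0" "om2 \<noteq> om1" "om2 \<noteq> om0" "om1 \<noteq> om0"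
  by (simp_all add: twice_om1_def om2_def om1_def om0_def)

context G2_parameters
begin

definition singular :: "complex ^ (7 \<times> 7) \<Rightarrow> bool" where
  "singular x \<longleftrightarrow> (\<forall>g\<in>{1, 2}. Eop (VV h t) g *v x = 0)"

text \<open>
  For the weights \<open>\<omega>\<^sub>1\<close> and \<open>\<omega>\<^sub>0\<close> these are, up to scalars, the vectors with coordinates \<open>\<mu>\<^sub>i\<^sub>k\<close>,
  \<open>s = 1\<close>, and \<open>p\<^sub>i\<^sub>k\<close> from which the operators \<open>G\<^sub>\<lambda>\<close> are built.
\<close>

definition sing_coord :: "nat \<times> nat \<Rightarrow> nat \<Rightarrow> nat \<Rightarrow> complex" where
  "sing_coord l i k =
    (if l = twice_om1 then if i = 1 \<and> k = 1 then 1 else 0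
     else if l = om2 then if i = 1 \<and> k = 2 then h\<^sup>2 else if i = 2 \<and> k = 1 then -1 else 0
     else if l = om1 then if block i k = 1 then mu_num h (h * t) i k else 0
     else if i + k = 8 then p_num h i else 0)"

definition sing_vec :: "nat \<times> nat \<Rightarrow> complex ^ (7 \<times> 7)" where
  "sing_vec l = vec_of (sing_coord l)"

lemma coord_sing_vec: "i \<in> ix \<Longrightarrow> k \<in> ix \<Longrightarrow> coord (sing_vec l) i k = sing_coord l i k"
  unfolding sing_vec_def by (rule coord_vec_of)

lemma sing_coord_simps:
  "sing_coord twice_om1 i k = (if i = 1 \<and> k = 1 then 1 else 0)"
  "sing_coord om2 i k = (if i = 1 \<and> k = 2 then h\<^sup>2 else if i = 2 \<and> k = 1 then -1 else 0)"
  "sing_coord om1 i k = (if block i k = 1 then mu_num h (h * t) i k else 0)"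
  "sing_coord om0 i k = (if i + k = 8 then p_num h i else 0)"
  using weights_distinct by (simp_all add: sing_coord_def)

lemma coord_E:
  assumes "g \<in> {1, 2}" "i \<in> ix" "k \<in> ix"
  shows "coord (Eop (VV h t) g *v x) i k =
    row_coeff 1 t g i * h powi kexp g k * coord x (row_source g i) k +
    row_coeff 1 t g k * h powi (- kexp g i) * coord x i (row_source g k)"
  using coord_tensor_E[of g i k h t 1 1 x] assms by (simp add: VV_def param_def le_2_iff)

lemma sing_vec_singular:
  assumes "l \<in> weights"
  shows "singular (sing_vec l)"
  unfolding singular_def
proof (intro ballI coord_eqI)
  fix g i k :: nat assume g: "g \<in> {1, 2}" and i: "i \<in> ix" and k: "k \<in> ix"
  have cv: "c = 0 \<or> a \<in> ix \<and> b \<in> ix \<Longrightarrow> c * e * coord (sing_vec l) a b = c * e * sing_coord l a b" for a b c e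
    by (auto simp: coord_sing_vec)
  have g3: "g \<in> {0, 1, 2}" using g by auto
  have "coord (Eop (VV h t) g *v sing_vec l) i k =
      row_coeff 1 t g i * h powi kexp g k * sing_coord l (row_source g i) k +
      row_coeff 1 t g k * h powi (- kexp g i) * sing_coord l i (row_source g k)"
    unfolding coord_E[OF g i k]
    using weight_code_source[OF g3 i, of 1 t] weight_code_source[OF g3 k, of 1 t] i k by (intro arg_cong2[of _ _ _ _ "(+)"] cv) auto
  also have "\<dots> = 0"
  proof -
    have g2: "g \<le> 2" using g3 by auto
    have "row_coeff h (h * t) g i * K_pow h g 1 k * sing_coord l (row_source g i) k +
        row_coeff h (h * t) g k * K_pow h g (-1) i * sing_coord l i (row_source g k) = 0"
      using g i k assms unfolding ix_def weights_def
      by (elim insertE emptyE;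
        simp add: row_coeff_def row_source_def kexp_def K_pow_def sing_coord_simps block_def mu_num_def p_num_def;
        (thin_tac "_ = _")+; algebra)
    then have "(row_coeff 1 t g i * h powi kexp g k * sing_coord l (row_source g i) k +
        row_coeff 1 t g k * h powi (- kexp g i) * sing_coord l i (row_source g k)) * (h * h ^ 3) = 0"
      unfolding scaled_coeffs[OF g2 i] scaled_coeffs[OF g2 k] by (simp only: ring_distribs mult_ac)
    then show ?thesis using h_nz by simp
  qed
  finally show "coord (Eop (VV h t) g *v sing_vec l) i k = coord 0 i k"
    by (simp add: coord_simps)
qed

text \<open>
  Each coordinate of \<open>E\<^sub>1 x\<close> and \<open>E\<^sub>2 x\<close> involves at most two coordinates of \<open>x\<close>, with nonzero
  coefficients. If one of the two is zero, so is the other. Starting from the equations with one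
  term and from the four given zeros, this reaches all \<open>49\<close> coordinates.
\<close>

lemma singular_zero:
  assumes "singular x" and "coord x 1 1 = 0" "coord x 2 1 = 0" "coord x 4 1 = 0" "coord x 7 1 = 0"
  shows "x = 0"
proof -
  define X where "X = coord x"
  have e: "row_coeff 1 t g i * h powi kexp g k * X (row_source g i) k +
    row_coeff 1 t g k * h powi (- kexp g i) * X i (row_source g k) = 0"
    if "g \<in> {1, 2}" "i \<in> ix" "k \<in> ix" for g i k
    using assms(1) coord_E[OF that, of x] that(1) unfolding singular_def X_def by (metis coord_simps(4))
  note [simp] = ix_def row_coeff_def row_source_def kexp_def h_nz t_nz
  have pivots [simp]: "X 1 1 = 0" "X 2 1 = 0" "X 4 1 = 0" "X 7 1 = 0"
    using assms(2-) by (simp_all add: X_def)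
  (* Each round uses the zeros found in the rounds before it. *)
  note z0 [simp] = e[of 1 1 2, simplified] e[of 1 1 5, simplified] e[of 1 1 7, simplified]
    e[of 1 2 3, simplified] e[of 1 3 2, simplified] e[of 1 3 5, simplified]
    e[of 1 3 7, simplified] e[of 1 4 2, simplified] e[of 1 4 5, simplified]
    e[of 1 4 7, simplified] e[of 1 6 2, simplified] e[of 1 6 5, simplified]
    e[of 1 6 7, simplified] e[of 1 7 3, simplified] e[of 2 1 2, simplified]
    e[of 2 1 5, simplified] e[of 2 2 1, simplified] e[of 2 2 3, simplified]
    e[of 2 2 4, simplified] e[of 2 2 6, simplified] e[of 2 2 7, simplified]
    e[of 2 4 2, simplified] e[of 2 4 5, simplified] e[of 2 5 1, simplified]
    e[of 2 5 3, simplified] e[of 2 5 4, simplified] e[of 2 5 6, simplified]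
    e[of 2 5 7, simplified] e[of 2 7 2, simplified] e[of 2 7 5, simplified]
  note z1 [simp] = e[of 1 4 1, simplified] e[of 1 4 4, simplified] e[of 1 4 6, simplified]
    e[of 1 1 4, simplified] e[of 1 1 1, simplified] e[of 1 3 1, simplified]
    e[of 1 6 1, simplified]
  note z2 [simp] = e[of 2 5 5, simplified] e[of 2 2 2, simplified] e[of 2 5 2, simplified]
  note z3 [simp] = e[of 1 1 3, simplified] e[of 1 4 3, simplified]
  note z4 [simp] = e[of 1 3 4, simplified]
  note z5 [simp] = e[of 2 2 5, simplified]
  note z6 [simp] = e[of 1 1 6, simplified]
  have "\<forall>i\<in>ix. \<forall>k\<in>ix. X i k = 0"
    by simp
  then show ?thesis
    by (intro coord_eqI) (simp add: X_def coord_simps del: ix_def)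
qed

lemma singular_linear:
  "singular x \<Longrightarrow> singular y \<Longrightarrow> singular (x + y)" "singular x \<Longrightarrow> singular (c *s x)"
  "singular x \<Longrightarrow> singular y \<Longrightarrow> singular (x - y)"
  by (simp_all add: singular_def matrix_vector_right_distrib vector_scalar_commute
      matrix_vector_mult_diff_distrib)

definition sing_comb :: "complex \<Rightarrow> complex \<Rightarrow> complex \<Rightarrow> complex \<Rightarrow> complex ^ (7 \<times> 7)" where
  "sing_comb a b c d = a *s sing_vec twice_om1 + b *s sing_vec om2 + c *s sing_vec om1 + d *s sing_vec om0"

lemma coord_sing_comb:
  "coord (sing_comb a b c d) 1 1 = a" "coord (sing_comb a b c d) 2 1 = - b"
  "coord (sing_comb a b c d) 4 1 = - c" "coord (sing_comb a b c d) 7 1 = d"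
  by (simp_all add: sing_comb_def coord_simps coord_sing_vec sing_coord_simps ix_def block_def mu_num_def p_num_def)

lemma singular_sing_comb: "singular (sing_comb a b c d)"
  unfolding sing_comb_def by (intro singular_linear sing_vec_singular) (simp_all add: weights_def)

text \<open>
  The coefficients are read off at the index pairs \<open>(1,1)\<close>, \<open>(2,1)\<close>, \<open>(4,1)\<close> and \<open>(7,1)\<close>, one in
  the support of each of the four vectors.
\<close>

lemma singular_expand:
  assumes "singular x"
  shows "x = sing_comb (coord x 1 1) (- coord x 2 1) (- coord x 4 1) (coord x 7 1)" (is "x = ?y")
proof -
  have "x - ?y = 0"
    by (rule singular_zero) (simp_all add: singular_linear assms singular_sing_comb coord_simps coord_sing_comb)
  then show ?thesis by simp
qed

text \<open>
  \<open>K\<^sub>g\<close> acts on vectors of weight \<open>l\<close> by \<open>q\<close> to this power; the factor \<open>3\<close> is \<open>d\<^sub>2\<close>.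
\<close>

definition K_weight :: "nat \<times> nat \<Rightarrow> nat \<Rightarrow> int" where
  "K_weight l g = (if g = 1 then int (fst l) else 3 * int (snd l))"

lemma coord_K:
  assumes "i \<in> ix" "k \<in> ix"
  shows "coord (Kh (VV h t) g 2 *v x) i k = (h\<^sup>2) powi (kexp g i + kexp g k) * coord x i k"
proof -
  have "h powi (2 * kexp g i) * h powi (2 * kexp g k) = (h\<^sup>2) powi (kexp g i + kexp g k)"
    using h_nz by (simp add: power_int_add power_int_mult power2_eq_square power_int_mult_distrib)
  then show ?thesis unfolding VV_def coord_tensor_K[OF assms] by simp
qed

lemma sing_vec_K:
  assumes "l \<in> weights" "g \<in> {1, 2}"
  shows "Kh (VV h t) g 2 *v sing_vec l = (h\<^sup>2) powi K_weight l g *s sing_vec l"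
proof (rule coord_eqI)
  fix i k assume i: "i \<in> ix" and k: "k \<in> ix"
  have "sing_coord l i k = 0 \<or> kexp g i + kexp g k = K_weight l g"
    using assms i k unfolding weights_def ix_def
    by (elim insertE emptyE) (simp_all add: sing_coord_simps block_def kexp_def K_weight_def
      twice_om1_def[symmetric] om2_def[symmetric] om1_def[symmetric] om0_def[symmetric],
      simp_all add: twice_om1_def om2_def om1_def om0_def)
  then show "coord (Kh (VV h t) g 2 *v sing_vec l) i k = coord ((h\<^sup>2) powi K_weight l g *s sing_vec l) i k"
    by (auto simp: coord_K[OF i k] coord_simps coord_sing_vec i k)
qed

lemma powi_eq_iff: "(h\<^sup>2) powi a = (h\<^sup>2) powi b \<longleftrightarrow> a = b"
proof
  have *: "a \<le> b" if "(h\<^sup>2) powi a = (h\<^sup>2) powi b" for a b :: int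
  proof (rule ccontr)
    assume "\<not> a \<le> b"
    then obtain n where n: "n > 0" "a = b + int n"
      using zero_less_imp_eq_int[of "a - b"] by (metis add.commute diff_add_cancel diff_gt_0_iff_gt not_le)
    have "(h\<^sup>2) powi b * (h\<^sup>2) ^ n = (h\<^sup>2) powi b"
      using that h_nz unfolding n(2) by (simp add: power_int_add)
    then have "(h\<^sup>2) ^ n = 1" using h_nz by simp
    with generic[OF n(1)] show False by simp
  qed
  show "a = b" if "(h\<^sup>2) powi a = (h\<^sup>2) powi b"
    using *[OF that] *[OF that[symmetric]] by simp
qed simp

text \<open>
  The four singular vectors have different weights, so at most one of them can contribute.
\<close>

lemma singular_of_weight:
  assumes x: "singular x" and l: "l \<in> weights"
    and K: "\<And>g. g \<in> {1, 2} \<Longrightarrow> Kh (VV h t) g 2 *v x = (h\<^sup>2) powi K_weight l g *s x"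
  shows "\<exists>c. x = c *s sing_vec l"
proof -
  have *: "coord x i k = 0 \<or> kexp g i + kexp g k = K_weight l g" if "g \<in> {1, 2}" "i \<in> ix" "k \<in> ix" for g i k
    using arg_cong[OF K[OF that(1)], of "\<lambda>x. coord x i k"]
    by (simp add: coord_K[OF that(2,3)] coord_simps powi_eq_iff)
  note w = *[of 1] *[of 2]
  obtain a b c d where abcd: "x = sing_comb a b c d"
    using singular_expand[OF x] by blast
  have p: "a = 0 \<or> l = twice_om1" "b = 0 \<or> l = om2" "c = 0 \<or> l = om1" "d = 0 \<or> l = om0"
    using w[of 1 1] w[of 2 1] w[of 4 1] w[of 7 1] unfolding abcd coord_sing_comb
    by (auto simp: ix_def kexp_def K_weight_def twice_om1_def om2_def om1_def om0_def prod_eq_iff)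
  from l consider "l = twice_om1" | "l = om2" | "l = om1" | "l = om0" unfolding weights_def by blast
  then show ?thesis
  proof cases
    case 1
    with p weights_distinct have "x = a *s sing_vec l" by (simp add: abcd sing_comb_def)
    then show ?thesis ..
  next
    case 2
    with p weights_distinct have "x = b *s sing_vec l" by (simp add: abcd sing_comb_def)
    then show ?thesis ..
  next
    case 3
    with p weights_distinct have "x = c *s sing_vec l" by (simp add: abcd sing_comb_def)
    then show ?thesis ..
  next
    case 4
    with p weights_distinct have "x = d *s sing_vec l" by (simp add: abcd sing_comb_def)
    then show ?thesis ..
  qed
qed

lemma sing_vec_nz: "l \<in> weights \<Longrightarrow> sing_vec l \<noteq> 0"
proof
  assume l: "l \<in> weights" and z: "sing_vec l = 0"
  have "sing_coord l i k = 0" if "i \<in> ix" "k \<in> ix" for i k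
    using arg_cong[OF z, of "\<lambda>x. coord x i k"] by (simp add: coord_simps coord_sing_vec that)
  from this[of 1 1] this[of 2 1] this[of 4 1] this[of 7 1] l show False
    unfolding weights_def
    by (auto simp: sing_coord_simps ix_def block_def mu_num_def p_num_def)
qed

lemma h_power_diff_nz: "n > 0 \<Longrightarrow> h ^ n - 1 \<noteq> 0"
  using h_power_ne_1[of n] by simp

text \<open>
  The squared lengths are quotients of products of factors \<open>h\<^sup>n - 1\<close> and \<open>h\<^sup>n + 1\<close>. For \<open>\<omega>\<^sub>0\<close> the
  length is the quantum dimension of \<open>V\<close> up to a power of \<open>q\<close>.
\<close>

lemma bilinear_sing_vec_nz:
  assumes "l \<in> weights"
  shows "bilinear (sing_vec l) (sing_vec l) \<noteq> 0"
proof -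
  have b: "bilinear (sing_vec l) (sing_vec l) = (\<Sum>i\<in>ix. \<Sum>k\<in>ix. (sing_coord l i k)\<^sup>2)"
    unfolding bilinear_coord by (intro sum.cong refl) (simp add: coord_sing_vec power2_eq_square)
  from assms consider "l = twice_om1" | "l = om2" | "l = om1" | "l = om0"
    unfolding weights_def by blast
  then show ?thesis
  proof cases
    case 1
    then show ?thesis unfolding b ix_def by (simp add: sing_coord_simps)
  next
    case 2
    then have "bilinear (sing_vec l) (sing_vec l) = h ^ 4 + 1"
      unfolding b ix_def by (simp add: sing_coord_simps flip: power_mult)
    then show ?thesis using h_power_ne_minus_1[of 4] by simp
  next
    case 3
    have "bilinear (sing_vec l) (sing_vec l) = (h ^ 12)\<^sup>2 + h ^ 16 * ((h * t) * (h * t)) + h ^ 4 * ((h * t) * (h * t)) + 1"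
      unfolding b unfolding 3 ix_def by (simp add: sing_coord_simps block_def mu_num_def) algebra
    then have "bilinear (sing_vec l) (sing_vec l) * (h ^ 4 - 1) = (h ^ 12 - 1) * (h ^ 16 + 1)"
      unfolding r_sq by algebra
    then show ?thesis using h_power_diff_nz[of 12] h_power_ne_minus_1[of 16] by auto
  next
    case 4
    have "bilinear (sing_vec l) (sing_vec l) = h ^ 40 + h ^ 36 + h ^ 24 + h ^ 20 + h ^ 16 + h ^ 4 + 1"
      unfolding b unfolding 4 ix_def by (simp add: sing_coord_simps p_num_def flip: power_mult)
    then have "bilinear (sing_vec l) (sing_vec l) * ((h ^ 4 - 1) * (h ^ 16 - 1) * (h ^ 24 - 1)) =
        (h ^ 28 - 1) * (h ^ 48 - 1) * (h ^ 8 - 1)"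
      by algebra
    then show ?thesis using h_power_diff_nz[of 28] h_power_diff_nz[of 48] h_power_diff_nz[of 8] by auto
  qed
qed

lemma sing_coord_weight:
  assumes "l \<in> weights" "g \<in> {1, 2}" "i \<in> ix" "k \<in> ix" "sing_coord l i k \<noteq> 0"
  shows "kexp g i + kexp g k = K_weight l g"
proof -
  have "Kh (VV h t) g 2 *v sing_vec l = (h\<^sup>2) powi K_weight l g *s sing_vec l"
    by (rule sing_vec_K[OF assms(1,2)])
  from arg_cong[OF this, of "\<lambda>x. coord x i k"] show ?thesis
    using assms(5) by (simp add: coord_K[OF assms(3,4)] coord_simps coord_sing_vec assms(3,4) powi_eq_iff)
qed

lemma K_weight_inj:
  assumes "l \<in> weights" "m \<in> weights" "\<And>g. g \<in> {1, 2} \<Longrightarrow> K_weight l g = K_weight m g"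
  shows "l = m"
  using assms(3)[of 1] assms(3)[of 2] by (simp add: K_weight_def prod_eq_iff)

lemma bilinear_sing_vec_orthogonal:
  assumes "l \<in> weights" "m \<in> weights" "l \<noteq> m"
  shows "bilinear (sing_vec l) (sing_vec m) = 0"
  unfolding bilinear_coord
proof (intro sum.neutral ballI)
  fix i k assume ix: "i \<in> ix" "k \<in> ix"
  have "sing_coord l i k = 0 \<or> sing_coord m i k = 0"
    using sing_coord_weight[OF assms(1) _ ix] sing_coord_weight[OF assms(2) _ ix] K_weight_inj[OF assms(1,2)] assms(3)
    by metis
  then show "coord (sing_vec l) i k * coord (sing_vec m) i k = 0"
    by (auto simp: coord_sing_vec ix)
qed

section \<open>Submodules\<close>

text \<open>
  \<open>E\<^sub>1\<close> and \<open>E\<^sub>2\<close> map \<open>v\<^sub>i\<close> to a multiple of \<open>v\<^sub>i\<^sub>-\<^sub>1\<close>. So they lower the largest sum \<open>i + k\<close> of an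
  index pair in the support, and a nonzero vector for which it is minimal has to be killed.
\<close>

lemma singular_in_subspace:
  assumes W: "vec.subspace W" and E: "\<And>g x. g \<in> {1, 2} \<Longrightarrow> x \<in> W \<Longrightarrow> Eop (VV h t) g *v x \<in> W"
    and x: "x \<in> W" "x \<noteq> 0"
  shows "\<exists>w\<in>W. w \<noteq> 0 \<and> singular w"
proof -
  define P where "P n \<longleftrightarrow> (\<exists>w\<in>W. w \<noteq> 0 \<and> (\<forall>i\<in>ix. \<forall>k\<in>ix. coord w i k \<noteq> 0 \<longrightarrow> i + k \<le> n))" for n
  (* The largest possible sum of two indices is 7 + 7. *)
  have "P 14"
    unfolding P_def using x by (intro bexI[of _ x]) (auto simp: ix_def)
  define n where "n = (LEAST n. P n)"
  have "P n" unfolding n_def using \<open>P 14\<close> by (rule LeastI)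
  then obtain w where w: "w \<in> W" "w \<noteq> 0" "\<And>i k. i \<in> ix \<Longrightarrow> k \<in> ix \<Longrightarrow> coord w i k \<noteq> 0 \<Longrightarrow> i + k \<le> n"
    unfolding P_def by blast
  have "Eop (VV h t) g *v w = 0" if g: "g \<in> {1, 2}" for g
  proof (rule ccontr)
    assume nz: "Eop (VV h t) g *v w \<noteq> 0"
    have g3: "g \<in> {0, 1, 2}" using g by auto
    have src: "row_coeff 1 t g i = 0 \<or> row_source g i \<in> ix \<and> row_source g i = Suc i" if "i \<in> ix" for i
      using g that unfolding ix_def
      by (elim insertE emptyE) (simp_all add: row_coeff_def row_source_def)
    have low: "Suc (i + k) \<le> n" if ix: "i \<in> ix" "k \<in> ix" and c: "coord (Eop (VV h t) g *v w) i k \<noteq> 0" for i k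
    proof -
      have "row_coeff 1 t g i * h powi kexp g k * coord w (row_source g i) k \<noteq> 0 \<or>
          row_coeff 1 t g k * h powi (- kexp g i) * coord w i (row_source g k) \<noteq> 0"
        using c unfolding coord_E[OF g ix] by auto
      then have "row_source g i \<in> ix \<and> row_source g i = Suc i \<and> coord w (row_source g i) k \<noteq> 0 \<or>
          row_source g k \<in> ix \<and> row_source g k = Suc k \<and> coord w i (row_source g k) \<noteq> 0"
        using src[OF ix(1)] src[OF ix(2)] by auto
      then show ?thesis
        using w(3)[of "row_source g i" k] w(3)[of i "row_source g k"] ix by auto
    qed
    have "P (n - 1)"
      unfolding P_def using E[OF g w(1)] nz low by fastforce
    moreover have "n \<noteq> 0"
    proof
      assume "n = 0"
      with low have "coord (Eop (VV h t) g *v w) i k = 0" if "i \<in> ix" "k \<in> ix" for i k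
        using that by fastforce
      then have "Eop (VV h t) g *v w = 0"
        by (intro coord_eqI) (simp add: coord_simps)
      with nz show False by contradiction
    qed
    ultimately show False
      using not_less_Least[of "n - 1" P] unfolding n_def by simp
  qed
  with w show ?thesis unfolding singular_def by blast
qed

lemma adjoint_E_F:
  assumes "g \<in> {1, 2}"
  shows "bilinear (Eop (VV h t) g *v x) y = bilinear x (Fop (VV h t) g *v y)"
  unfolding bilinear_transpose VV_def tensor_F[OF assms] transpose_transpose ..

text \<open>
  Otherwise the annihilator of \<open>U\<close> is a nonzero submodule. It contains a singular vector, which is
  orthogonal to all four basic ones and hence zero.
\<close>

lemma submodule_UNIV:
  assumes U: "G2_submodule (VV h t) U" and s: "\<And>l. l \<in> weights \<Longrightarrow> sing_vec l \<in> U"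
  shows "U = UNIV"
proof (rule ccontr)
  assume "U \<noteq> UNIV"
  define W where "W = {y. \<forall>u\<in>U. bilinear y u = 0}"
  obtain y where y: "y \<noteq> 0" "y \<in> W"
    using proper_subspace_annihilator[of U] U \<open>U \<noteq> UNIV\<close> unfolding G2_submodule_def W_def by blast
  have "vec.subspace W"
    unfolding W_def vec.subspace_def by (simp add: bilinear_linear)
  moreover have "Eop (VV h t) g *v x \<in> W" if "g \<in> {1, 2}" "x \<in> W" for g x
  proof -
    have "Fop (VV h t) g *v u \<in> U" if "u \<in> U" for u
      using U \<open>g \<in> {1, 2}\<close> that unfolding G2_submodule_def by blast
    then show ?thesis using that unfolding W_def by (simp add: adjoint_E_F)
  qed
  ultimately obtain w where w: "w \<in> W" "w \<noteq> 0" "singular w"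
    using singular_in_subspace y by blast
  obtain a b c d where abcd: "w = sing_comb a b c d"
    using singular_expand[OF w(3)] by blast
  have z: "bilinear (sing_comb a b c d) (sing_vec l) = 0" if "l \<in> weights" for l
    using w(1) s[OF that] unfolding W_def abcd by blast
  have mem: "twice_om1 \<in> weights" "om2 \<in> weights" "om1 \<in> weights" "om0 \<in> weights"
    by (simp_all add: weights_def)
  have "a = 0" "b = 0" "c = 0" "d = 0"
    using z[OF mem(1)] z[OF mem(2)] z[OF mem(3)] z[OF mem(4)] mem weights_distinct bilinear_sing_vec_nz
    unfolding sing_comb_def bilinear_linear by (simp_all add: bilinear_sing_vec_orthogonal)
  with abcd w(2) show False by (simp add: sing_comb_def)
qed


section \<open>The commutant\<close>

definition commutes :: "(7 \<times> 7) cmat \<Rightarrow> bool" where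
  "commutes A \<longleftrightarrow> (\<forall>g\<in>{1, 2}. A ** Eop (VV h t) g = Eop (VV h t) g ** A \<and>
     A ** Fop (VV h t) g = Fop (VV h t) g ** A \<and>
     (\<forall>m\<in>{2, -2}. A ** Kh (VV h t) g m = Kh (VV h t) g m ** A))"

lemma commutes_one: "commutes (mat 1)"
  by (simp add: commutes_def)

lemma commutes_add: "commutes A \<Longrightarrow> commutes B \<Longrightarrow> commutes (A + B)"
  by (simp add: commutes_def mat_mult_add)

lemma commutes_diff: "commutes A \<Longrightarrow> commutes B \<Longrightarrow> commutes (A - B)"
  by (simp add: commutes_def mat_mult_diff)

lemma commutes_smult: "commutes A \<Longrightarrow> commutes (c *\<^sub>c A)"
  by (simp add: commutes_def smult_mat_simps)

lemma commutes_mult: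
  assumes "commutes A" "commutes B"
  shows "commutes (A ** B)"
proof -
  have "(A ** B) ** X = X ** (A ** B)" if "A ** X = X ** A" "B ** X = X ** B" for X
  proof -
    have "(A ** B) ** X = A ** (X ** B)"
      unfolding matrix_mul_assoc[symmetric] that(2) ..
    also have "\<dots> = X ** (A ** B)"
      unfolding matrix_mul_assoc that(1) ..
    finally show ?thesis .
  qed
  then show ?thesis
    using assms unfolding commutes_def by blast
qed

lemma commutes_sum: "(\<And>x. x \<in> S \<Longrightarrow> commutes (f x)) \<Longrightarrow> commutes (sum f S)"
  by (induct S rule: infinite_finite_induct)
    (auto intro: commutes_add simp: commutes_def[of 0] mat_mult_zero)

lemma commutes_transpose:
  assumes "commutes A"
  shows "commutes (transpose A)"
proof -
  have F: "Fop (VV h t) g = transpose (Eop (VV h t) g)" "transpose (Fop (VV h t) g) = Eop (VV h t) g" if "g \<in> {1, 2}" for g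
    unfolding VV_def tensor_F[OF that] by (simp_all add: transpose_transpose)
  have K: "transpose (Kh (VV h t) g m) = Kh (VV h t) g m" for g m
    unfolding VV_def by (rule transpose_tensor_K)
  have *: "transpose A ** transpose X = transpose X ** transpose A" if "A ** X = X ** A" for X
    using arg_cong[OF that, of transpose] by (simp add: matrix_transpose_mul)
  show ?thesis
    unfolding commutes_def
  proof (intro ballI conjI)
    fix g :: nat assume g: "g \<in> {1, 2}"
    show "transpose A ** Eop (VV h t) g = Eop (VV h t) g ** transpose A"
      using *[of "Fop (VV h t) g"] assms g unfolding F(2)[OF g] commutes_def by blast
    show "transpose A ** Fop (VV h t) g = Fop (VV h t) g ** transpose A"
      using *[of "Eop (VV h t) g"] assms g unfolding F(1)[OF g, symmetric] commutes_def by blast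
    show "transpose A ** Kh (VV h t) g m = Kh (VV h t) g m ** transpose A" if "m \<in> {2, -2}" for m
      using *[of "Kh (VV h t) g m"] assms g that unfolding K commutes_def by blast
  qed
qed

lemma preimage_submodule:
  assumes A: "commutes A" and U: "G2_submodule (VV h t) U"
  shows "G2_submodule (VV h t) {x. A *v x \<in> U}"
proof -
  have comm: "A *v (X *v x) = X *v (A *v x)" if "A ** X = X ** A" for X x
    by (simp add: matrix_vector_mul_assoc that)
  show ?thesis
    using A U unfolding G2_submodule_def commutes_def vec.subspace_def
    by (simp add: comm matrix_vector_right_distrib vector_scalar_commute)
qed

text \<open>
  The kernel is a submodule that contains the four singular vectors.
\<close>

lemma commutes_zero:
  assumes A: "commutes A" and s: "\<And>l. l \<in> weights \<Longrightarrow> A *v sing_vec l = 0"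
  shows "A = 0"
proof -
  have "G2_submodule (VV h t) {0}"
    by (simp add: G2_submodule_def)
  from preimage_submodule[OF A this] have "{x. A *v x \<in> {0}} = UNIV"
    by (rule submodule_UNIV) (simp add: s)
  then have "A *v x = 0 *v x" for x by auto
  then show ?thesis unfolding matrix_eq by blast
qed

lemma commutes_eqI:
  assumes "commutes A" "commutes B" "\<And>l. l \<in> weights \<Longrightarrow> A *v sing_vec l = B *v sing_vec l"
  shows "A = B"
  using commutes_zero[OF commutes_diff[OF assms(1,2)]] assms(3)
  by (simp add: matrix_vector_mult_diff_rdistrib)

text \<open>
  The image of a singular vector is singular of the same weight.
\<close>

lemma commutes_sing_vec:
  assumes A: "commutes A" and l: "l \<in> weights"
  shows "\<exists>d. A *v sing_vec l = d *s sing_vec l"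
proof (rule singular_of_weight[OF _ l])
  have comm: "X *v (A *v x) = A *v (X *v x)" if "A ** X = X ** A" for X x
    by (simp add: matrix_vector_mul_assoc that)
  show "singular (A *v sing_vec l)"
    using A sing_vec_singular[OF l] unfolding singular_def commutes_def by (simp add: comm)
  show "Kh (VV h t) g 2 *v (A *v sing_vec l) = (h\<^sup>2) powi K_weight l g *s (A *v sing_vec l)" if "g \<in> {1, 2}" for g
  proof -
    have "A ** Kh (VV h t) g 2 = Kh (VV h t) g 2 ** A"
      using A that unfolding commutes_def by blast
    then show ?thesis
      by (simp add: comm sing_vec_K[OF l that] vector_scalar_commute)
  qed
qed

lemma R_expl_commutes:
  assumes z: "z \<notin> poles"
  shows "commutes (R_expl h t z)"
  unfolding commutes_def
proof (intro ballI conjI)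
  fix g :: nat assume g: "g \<in> {1, 2}"
  then have g2: "g \<le> 2" by auto
  show E: "R_expl h t z ** Eop (VV h t) g = Eop (VV h t) g ** R_expl h t z"
    using R_expl_intertwines_E[OF g2 z] unfolding tensor_E_indep[OF g] .
  have F: "Fop (VV h t) g = transpose (Eop (VV h t) g)"
    unfolding VV_def by (rule tensor_F[OF g])
  show "R_expl h t z ** Fop (VV h t) g = Fop (VV h t) g ** R_expl h t z"
    unfolding F using arg_cong[OF E, of transpose] by (simp add: matrix_transpose_mul R_expl_sym[OF z])
  show "R_expl h t z ** Kh (VV h t) g m = Kh (VV h t) g m ** R_expl h t z" for m
    by (rule R_expl_K[OF z g2])
qed

section \<open>The eigenvalues of the explicit operator\<close>

text \<open>
  The coefficients of the spectral formula, freed of negative powers of \<open>q = h\<^sup>2\<close>.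
\<close>

definition eigenvalue :: "nat \<times> nat \<Rightarrow> complex \<Rightarrow> complex" where
  "eigenvalue l z =
    (if l = twice_om1 then 1
     else if l = om2 then - ((1 - h ^ 4 * z) / (h ^ 4 - z))
     else if l = om1 then - ((1 - h ^ 16 * z) / (h ^ 16 - z))
     else (1 - h ^ 4 * z) * (1 - h ^ 24 * z) / ((h ^ 4 - z) * (h ^ 24 - z)))"

text \<open>
  By \<open>commutes_sing_vec\<close> the singular vectors are eigenvectors, so that the eigenvalue can be read
  off from the single coordinate \<open>(pivot l, 1)\<close>.
\<close>

definition pivot :: "nat \<times> nat \<Rightarrow> nat" where
  "pivot l = (if l = twice_om1 then 1 else if l = om2 then 2 else if l = om1 then 4 else 7)"

lemma R_num_pivot:
  assumes "l \<in> weights" "z \<notin> poles"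
  shows "(\<Sum>j\<in>ix. \<Sum>m\<in>ix. R_num h (h * t) z (pivot l) 1 j m * sing_coord l j m) =
    R_den h z * (eigenvalue l z * sing_coord l (pivot l) 1)"
proof -
  define r where "r = h * t"
  have r: "r * r = h ^ 4 + 1" unfolding r_def by (rule r_sq)
  have nz: "h ^ 4 - z \<noteq> 0" "h ^ 16 - z \<noteq> 0" "h ^ 24 - z \<noteq> 0" using assms(2) by (auto simp: poles_def)
  note defs = pivot_def sing_coord_simps weights_distinct weights_distinct[symmetric]
    R_num_def sl7_num_def S_num_def Q_num_def block_def mu_num_def p_num_def r_def[symmetric]
  from assms(1) consider "l = twice_om1" | "l = om2" | "l = om1" | "l = om0" unfolding weights_def by blast
  then show ?thesis
  proof cases
    case 1
    have "(\<Sum>j\<in>ix. \<Sum>m\<in>ix. R_num h (h * t) z (pivot twice_om1) 1 j m * sing_coord twice_om1 j m) = R_den h z"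
      unfolding ix_def by (simp add: defs R_den_def)
    then show ?thesis by (simp add: 1 eigenvalue_def pivot_def sing_coord_simps)
  next
    case 2
    have "(\<Sum>j\<in>ix. \<Sum>m\<in>ix. R_num h (h * t) z (pivot om2) 1 j m * sing_coord om2 j m) =
        h ^ 24 * (h ^ 16 - z) * (h ^ 24 - z) * (1 - h ^ 4 * z)"
      unfolding ix_def by (simp add: defs del: mult_cancel_left mult_cancel_right mult_eq_0_iff) algebra
    then show ?thesis using nz weights_distinct by (simp add: 2 eigenvalue_def pivot_def sing_coord_simps R_den_def)
  next
    case 3
    have "(\<Sum>j\<in>ix. \<Sum>m\<in>ix. R_num h (h * t) z (pivot om1) 1 j m * sing_coord om1 j m) =
        h ^ 24 * (h ^ 4 - z) * (h ^ 24 - z) * (1 - h ^ 16 * z)"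
      unfolding ix_def
      by (simp add: defs del: mult_cancel_left mult_cancel_right mult_eq_0_iff) (insert r, algebra)
    then show ?thesis using nz weights_distinct
      by (simp add: 3 eigenvalue_def pivot_def sing_coord_simps R_den_def block_def mu_num_def)
  next
    case 4
    have "(\<Sum>j\<in>ix. \<Sum>m\<in>ix. R_num h (h * t) z (pivot om0) 1 j m * sing_coord om0 j m) =
        h ^ 24 * (h ^ 16 - z) * ((1 - h ^ 4 * z) * (1 - h ^ 24 * z))"
      unfolding ix_def
      by (simp add: defs del: mult_cancel_left mult_cancel_right mult_eq_0_iff) algebra
    then show ?thesis using nz weights_distinct
      by (simp add: 4 eigenvalue_def pivot_def sing_coord_simps R_den_def p_num_def)
  qed
qed

lemma R_expl_sing_vec:
  assumes l: "l \<in> weights" and z: "z \<notin> poles"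
  shows "R_expl h t z *v sing_vec l = eigenvalue l z *s sing_vec l"
proof -
  obtain d where d: "R_expl h t z *v sing_vec l = d *s sing_vec l"
    using commutes_sing_vec[OF R_expl_commutes[OF z] l] by blast
  have p: "pivot l \<in> ix" "1 \<in> ix" by (simp_all add: pivot_def ix_def)
  have nz: "sing_coord l (pivot l) 1 \<noteq> 0"
    using l weights_distinct unfolding weights_def
    by (auto simp: pivot_def sing_coord_simps block_def mu_num_def p_num_def)
  have "d * sing_coord l (pivot l) 1 * R_den h z = coord (R_expl h t z *v sing_vec l) (pivot l) 1 * R_den h z"
    unfolding d by (simp add: coord_simps coord_sing_vec p)
  also have "\<dots> = (\<Sum>j\<in>ix. \<Sum>m\<in>ix. R_num h (h * t) z (pivot l) 1 j m * sing_coord l j m)"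
    unfolding coord_mult sum_distrib_right
    using R_den_nz[OF z] by (intro sum.cong refl) (simp add: entry_R_expl z p coord_sing_vec)
  also have "\<dots> = eigenvalue l z * sing_coord l (pivot l) 1 * R_den h z"
    unfolding R_num_pivot[OF l z] by (simp only: mult_ac)
  finally have "d = eigenvalue l z" using nz R_den_nz[OF z] by simp
  with d show ?thesis by simp
qed

section \<open>The decomposition\<close>

lemma zero_not_pole: "0 \<notin> poles"
  using h_nz by (simp add: poles_def)

text \<open>
  At \<open>z = 0\<close> the eigenvalues are \<open>1\<close>, \<open>-q\<^sup>-\<^sup>2\<close>, \<open>-q\<^sup>-\<^sup>8\<close>, \<open>q\<^sup>-\<^sup>1\<^sup>4\<close>; an equality between two of them
  would make \<open>q\<close> a root of unity.
\<close>

lemma eigenvalue_inj: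
  assumes "l \<in> weights" "m \<in> weights" "eigenvalue l 0 = eigenvalue m 0"
  shows "l = m"
proof -
  have ev: "eigenvalue twice_om1 0 = 1" "eigenvalue om2 0 = - (1 / h ^ 4)" "eigenvalue om1 0 = - (1 / h ^ 16)"
    "eigenvalue om0 0 = 1 / h ^ 28"
    using weights_distinct h_nz by (simp_all add: eigenvalue_def flip: power_add)
  have d: "1 \<noteq> - (1 / h ^ 4)" "1 \<noteq> - (1 / h ^ 16)" "1 \<noteq> 1 / h ^ 28" "- (1 / h ^ 4) \<noteq> - (1 / h ^ 16)"
    "- (1 / h ^ 4) \<noteq> 1 / h ^ 28" "- (1 / h ^ 16) \<noteq> 1 / h ^ 28"
  proof -
    have q: "h ^ (a + n) = c * h ^ a \<longleftrightarrow> h ^ n = c" for a n c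
      using h_nz by (simp add: power_add)
    note s = q[of 4 12 1] q[of 4 24 "-1"] q[of 16 12 "-1"]
      h_power_ne_1[of 12] h_power_ne_1[of 28] h_power_ne_minus_1[of 4] h_power_ne_minus_1[of 12]
      h_power_ne_minus_1[of 16] h_power_ne_minus_1[of 24]
    have e: "1 = - (1 / x) \<longleftrightarrow> x + 1 = 0" "1 = 1 / x \<longleftrightarrow> x = 1" "- (1 / x) = - (1 / y) \<longleftrightarrow> y = x"
      "- (1 / x) = 1 / y \<longleftrightarrow> y = - x" if "x \<noteq> 0" "y \<noteq> 0" for x y :: complex
    proof -
      show "1 = - (1 / x) \<longleftrightarrow> x + 1 = 0"
        using that(1) by (metis add_eq_0_iff2 divide_minus1 divide_divide_eq_right minus_divide_left mult_1 nonzero_divide_eq_eq)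
      show "1 = 1 / x \<longleftrightarrow> x = 1" "- (1 / x) = - (1 / y) \<longleftrightarrow> y = x"
        using that by (auto simp: field_simps)
      show "- (1 / x) = 1 / y \<longleftrightarrow> y = - x"
        using that by (metis divide_minus_right minus_divide_left nonzero_divide_eq_eq divide_divide_eq_right minus_minus div_by_1 mult_1)
    qed
    have nz: "h ^ n \<noteq> 0" for n using h_nz by simp
    show "1 \<noteq> - (1 / h ^ 4)" "1 \<noteq> - (1 / h ^ 16)" "1 \<noteq> 1 / h ^ 28" "- (1 / h ^ 4) \<noteq> - (1 / h ^ 16)"
      "- (1 / h ^ 4) \<noteq> 1 / h ^ 28" "- (1 / h ^ 16) \<noteq> 1 / h ^ 28"
      using s unfolding e[OF nz nz] by (auto simp: eq_neg_iff_add_eq_0)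
  qed
  show ?thesis
    using assms d d[symmetric] unfolding weights_def by (elim insertE emptyE) (simp_all add: ev)
qed

text \<open>
  Lagrange interpolation: the operator \<open>R\<close> at \<open>z = 0\<close>, with eigenvalues \<open>e\<^sub>m\<close>, is inserted into the
  polynomial \<open>\<Prod>\<^sub>m (X - e\<^sub>m) / (e\<^sub>l - e\<^sub>m)\<close>, which is \<open>1\<close> at \<open>e\<^sub>l\<close> and \<open>0\<close> at \<open>e\<^sub>m\<close>.
\<close>

definition interpolate :: "nat \<times> nat \<Rightarrow> (nat \<times> nat) list \<Rightarrow> (7 \<times> 7) cmat" where
  "interpolate l ms = foldr (\<lambda>m A. inverse (eigenvalue l 0 - eigenvalue m 0) *\<^sub>c
     ((R_expl h t 0 - eigenvalue m 0 *\<^sub>c mat 1) ** A)) ms (mat 1)"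

definition proj :: "nat \<times> nat \<Rightarrow> (7 \<times> 7) cmat" where
  "proj l = interpolate l (filter (\<lambda>m. m \<noteq> l) [twice_om1, om2, om1, om0])"

lemma interpolate_commutes: "commutes (interpolate l ms)"
  by (induct ms) (simp_all add: interpolate_def commutes_one commutes_smult commutes_mult commutes_diff
      R_expl_commutes zero_not_pole)

lemma interpolate_sing_vec:
  assumes "k \<in> weights"
  shows "interpolate l ms *v sing_vec k =
    (\<Prod>m\<leftarrow>ms. (eigenvalue k 0 - eigenvalue m 0) / (eigenvalue l 0 - eigenvalue m 0)) *s sing_vec k"
proof (induct ms)
  case Nil
  then show ?case by (simp add: interpolate_def)
next
  case (Cons m ms)
  let ?T = "R_expl h t 0 - eigenvalue m 0 *\<^sub>c mat 1"
  have T: "?T *v sing_vec k = (eigenvalue k 0 - eigenvalue m 0) *s sing_vec k"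
    by (simp add: matrix_vector_mult_diff_rdistrib smult_mat_vec R_expl_sing_vec[OF assms zero_not_pole]
      vec.scale_left_diff_distrib)
  have "interpolate l (m # ms) *v sing_vec k =
      inverse (eigenvalue l 0 - eigenvalue m 0) *s (?T *v (interpolate l ms *v sing_vec k))"
    by (simp add: interpolate_def smult_mat_vec matrix_vector_mul_assoc)
  then show ?case
    unfolding Cons vector_scalar_commute T vec.scale_scale
    by (simp only: list.map prod_list.Cons divide_inverse mult_ac)
qed

lemma proj_commutes: "commutes (proj l)"
  unfolding proj_def by (rule interpolate_commutes)

lemma proj_sing_vec:
  assumes k: "k \<in> weights" and l: "l \<in> weights"
  shows "proj l *v sing_vec k = (if k = l then sing_vec k else 0)"
proof -
  define ms where "ms = filter (\<lambda>m. m \<noteq> l) [twice_om1, om2, om1, om0]"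
  define c where "c m = (eigenvalue k 0 - eigenvalue m 0) / (eigenvalue l 0 - eigenvalue m 0)" for m
  have ms: "set ms = weights - {l}" by (auto simp: ms_def weights_def)
  have one: "prod_list (map c xs) = 1" if "\<forall>m\<in>set xs. c m = 1" for xs
    using that by (induct xs) simp_all
  have zero: "prod_list (map c xs) = 0" if "\<exists>m\<in>set xs. c m = 0" for xs
    using that by (induct xs) auto
  have "prod_list (map c ms) = (if k = l then 1 else 0)"
  proof (cases "k = l")
    case True
    have "c m = 1" if "m \<in> set ms" for m
      using eigenvalue_inj[OF l, of m] that ms unfolding c_def True by auto
    then show ?thesis using one True by simp
  next
    case False
    then have "k \<in> set ms" using k ms by blast
    moreover have "c k = 0" by (simp add: c_def)
    ultimately show ?thesis using zero False by auto
  qed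
  then show ?thesis
    unfolding proj_def ms_def[symmetric] interpolate_sing_vec[OF k] c_def by simp
qed

lemma finite_weights: "finite weights"
  by (simp add: weights_def)

text \<open>
  Identities between operators of the commutant only have to be checked on singular vectors.
\<close>

lemma proj_mult:
  assumes "l \<in> weights" "m \<in> weights"
  shows "proj l ** proj m = (if l = m then proj l else 0)"
  by (rule commutes_eqI)
    (auto simp: commutes_mult proj_commutes commutes_def[of 0] mat_mult_zero matrix_vector_mul_assoc[symmetric]
      proj_sing_vec assms)

lemma sum_mat_vec: "sum f S *v x = (\<Sum>l\<in>S. f l *v x)"
  by (induct S rule: infinite_finite_induct) (simp_all add: matrix_vector_mult_add_rdistrib)

lemma mat_vec_sum: "A *v sum f S = (\<Sum>l\<in>S. A *v f l)"
  by (induct S rule: infinite_finite_induct) (simp_all add: matrix_vector_right_distrib)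

lemma sum_proj: "(\<Sum>l\<in>weights. proj l) = mat 1"
proof (rule commutes_eqI)
  fix k assume k: "k \<in> weights"
  have "(\<Sum>l\<in>weights. proj l) *v sing_vec k = (\<Sum>l\<in>weights. if k = l then sing_vec k else 0)"
    unfolding sum_mat_vec by (rule sum.cong) (simp_all add: proj_sing_vec k)
  then show "(\<Sum>l\<in>weights. proj l) *v sing_vec k = mat 1 *v sing_vec k"
    using k finite_weights by simp
qed (simp_all add: commutes_sum proj_commutes commutes_one)

definition component :: "nat \<times> nat \<Rightarrow> (complex ^ (7 \<times> 7)) set" where
  "component l = {x. proj l *v x = x}"

lemma sing_vec_component: "l \<in> weights \<Longrightarrow> sing_vec l \<in> component l"
  by (simp add: component_def proj_sing_vec)

lemma proj_component:
  assumes "l \<in> weights" "m \<in> weights" "x \<in> component m"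
  shows "proj l *v x = (if m = l then x else 0)"
proof -
  have x: "proj m *v x = x" using assms(3) by (simp add: component_def)
  then have "proj l *v x = proj l *v (proj m *v x)" by (simp only:)
  also have "\<dots> = (if l = m then proj l else 0) *v x"
    unfolding matrix_vector_mul_assoc proj_mult[OF assms(1,2)] ..
  also have "\<dots> = (if m = l then x else 0)"
    using x by auto
  finally show ?thesis .
qed

lemma proj_in_component: "l \<in> weights \<Longrightarrow> proj l *v x \<in> component l"
  by (simp add: component_def matrix_vector_mul_assoc proj_mult)

lemma component_submodule:
  assumes "l \<in> weights"
  shows "G2_submodule (VV h t) (component l)"
proof -
  have "G2_submodule (VV h t) {0}"
    by (simp add: G2_submodule_def)
  from preimage_submodule[OF commutes_diff[OF proj_commutes commutes_one] this]
  show ?thesis by (simp add: component_def matrix_vector_mult_diff_rdistrib)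
qed

text \<open>
  A nonzero submodule \<open>U\<close> of the component contains a singular vector, which the projector fixes
  and which is therefore a multiple of \<open>x\<^sub>l\<close>. Then the preimage of \<open>U\<close> under the projector contains
  all singular vectors, and is the whole space.
\<close>

lemma component_irreducible:
  assumes l: "l \<in> weights"
  shows "G2_irreducible (VV h t) (component l)"
  unfolding G2_irreducible_def
proof (intro conjI allI impI)
  show "G2_submodule (VV h t) (component l)" by (rule component_submodule[OF l])
  show "component l \<noteq> {0}" using sing_vec_component[OF l] sing_vec_nz[OF l] by blast
  fix U assume U: "G2_submodule (VV h t) U \<and> U \<subseteq> component l"
  show "U = {0} \<or> U = component l"
  proof (rule disjCI)
    assume "U \<noteq> component l"
    show "U = {0}"
    proof (rule ccontr)
      assume "U \<noteq> {0}"
      moreover have sub: "vec.subspace U" using U by (simp add: G2_submodule_def)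
      then have "0 \<in> U" by (simp add: vec.subspace_def)
      ultimately obtain x where "x \<in> U" "x \<noteq> 0" by blast
      then obtain w where w: "w \<in> U" "w \<noteq> 0" "singular w"
        using singular_in_subspace[OF sub, of x] U unfolding G2_submodule_def by blast
      obtain a b c d where abcd: "w = sing_comb a b c d"
        using singular_expand[OF w(3)] by blast
      have mem: "twice_om1 \<in> weights" "om2 \<in> weights" "om1 \<in> weights" "om0 \<in> weights"
        by (simp_all add: weights_def)
      have "w = proj l *v w" using w(1) U by (auto simp: component_def)
      moreover define \<delta> where "\<delta> m = (if m = l then 1 else 0 :: complex)" for m
      moreover have "proj l *v sing_vec m = \<delta> m *s sing_vec l" if "m \<in> weights" for m
        using l that by (simp add: proj_sing_vec \<delta>_def)
      ultimately have "w = (a * \<delta> twice_om1 + b * \<delta> om2 + c * \<delta> om1 + d * \<delta> om0) *s sing_vec l"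
        using mem by (simp add: abcd sing_comb_def matrix_vector_right_distrib vector_scalar_commute
          vec.scale_scale vec.scale_left_distrib del: vector_smult_assoc)
      then obtain e where e: "w = e *s sing_vec l" by blast
      then have "e \<noteq> 0" using w(2) by auto
      then have "sing_vec l = inverse e *s w" by (simp add: e vec.scale_scale)
      then have sl: "sing_vec l \<in> U" using w(1) sub by (simp add: vec.subspace_def)
      have "{x. proj l *v x \<in> U} = UNIV"
        using U sl \<open>0 \<in> U\<close> by (intro submodule_UNIV preimage_submodule proj_commutes) (auto simp: proj_sing_vec l)
      then have "component l \<subseteq> U" unfolding component_def by (smt (verit) UNIV_I mem_Collect_eq subsetI)
      with U \<open>U \<noteq> component l\<close> show False by blast
    qed
  qed
qed

lemma K_weight_powi:
  assumes "g \<in> {1, 2}"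
  shows "(h\<^sup>2) powi K_weight l g = ((h\<^sup>2) ^ dsym g) ^ (if g = 1 then fst l else snd l)"
proof -
  have "(h\<^sup>2) powi (3 * int n) = ((h\<^sup>2) ^ 3) ^ n" for n
    by (metis of_nat_mult of_nat_numeral power_int_of_nat power_mult)
  then show ?thesis using assms by (auto simp: K_weight_def dsym_def)
qed

lemma sing_vec_highest_weight:
  assumes "l \<in> weights"
  shows "highest_weight_vector (h\<^sup>2) (VV h t) l (sing_vec l)"
  using sing_vec_nz[OF assms] sing_vec_singular[OF assms] sing_vec_K[OF assms, of 1] sing_vec_K[OF assms, of 2]
  by (simp add: highest_weight_vector_def singular_def K_weight_powi)

text \<open>
  Highest weight vectors are unique up to scalars, hence every summand \<open>L\<^sub>\<lambda>\<close> of every decomposition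
  contains \<open>x\<^sub>\<lambda>\<close>.
\<close>

lemma highest_weight_vector_sing_vec:
  assumes "l \<in> weights" "highest_weight_vector (h\<^sup>2) (VV h t) l x"
  shows "\<exists>c. c \<noteq> 0 \<and> sing_vec l = c *s x"
proof -
  have "\<exists>c. x = c *s sing_vec l"
  proof (rule singular_of_weight[OF _ assms(1)])
    show "singular x" using assms(2) by (simp add: highest_weight_vector_def singular_def)
    show "Kh (VV h t) g 2 *v x = (h\<^sup>2) powi K_weight l g *s x" if "g \<in> {1, 2}" for g
      unfolding K_weight_powi[OF that] using assms(2) that by (auto simp: highest_weight_vector_def)
  qed
  then obtain c where c: "x = c *s sing_vec l" by blast
  moreover from c assms(2) have "c \<noteq> 0" by (auto simp: highest_weight_vector_def)
  ultimately have "inverse c \<noteq> 0 \<and> sing_vec l = inverse c *s x" by (simp add: vec.scale_scale)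
  then show ?thesis by blast
qed

lemma component_decomposition: "G2_decomposition (h\<^sup>2) (VV h t) weights component"
  unfolding G2_decomposition_def
proof (intro conjI ballI allI)
  fix l assume l: "l \<in> weights"
  then show "is_L (h\<^sup>2) (VV h t) l (component l)"
    unfolding is_L_def using component_irreducible sing_vec_component sing_vec_highest_weight by blast
next
  fix x :: "complex ^ (7 \<times> 7)"
  show "\<exists>!f. f \<in> (\<Pi>\<^sub>E l\<in>weights. component l) \<and> x = (\<Sum>l\<in>weights. f l)"
  proof (rule ex1I)
    have "x = (\<Sum>l\<in>weights. proj l) *v x" by (simp add: sum_proj)
    then show "(\<lambda>l\<in>weights. proj l *v x) \<in> (\<Pi>\<^sub>E l\<in>weights. component l) \<and>
        x = (\<Sum>l\<in>weights. (\<lambda>l\<in>weights. proj l *v x) l)"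
      by (simp add: proj_in_component sum_mat_vec)
  next
    fix f assume f: "f \<in> (\<Pi>\<^sub>E l\<in>weights. component l) \<and> x = (\<Sum>l\<in>weights. f l)"
    have "f l = proj l *v x" if l: "l \<in> weights" for l
    proof -
      have "proj l *v x = (\<Sum>m\<in>weights. proj l *v f m)" using f by (simp add: mat_vec_sum)
      also have "\<dots> = (\<Sum>m\<in>weights. if m = l then f m else 0)"
        using f l by (intro sum.cong refl proj_component) auto
      finally show ?thesis using l finite_weights by simp
    qed
    with f show "f = (\<lambda>l\<in>weights. proj l *v x)"
      by (auto simp: PiE_iff extensional_def fun_eq_iff)
  qed
qed

lemma proj_is_projectors: "is_projectors weights component proj"
  unfolding is_projectors_def by (simp add: proj_component)

text \<open>
  The summands are submodules, so \<open>P l\<close> belongs to the commutant, and it agrees with the projector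
  constructed above on the singular vectors, each of which lies in its summand.
\<close>

lemma projectors_unique:
  assumes D: "G2_decomposition (h\<^sup>2) (VV h t) weights W" and P: "is_projectors weights W P" and l: "l \<in> weights"
  shows "P l = proj l"
proof (rule commutes_eqI)
  have L: "is_L (h\<^sup>2) (VV h t) m (W m)" if "m \<in> weights" for m
    using D that by (simp add: G2_decomposition_def)
  then have sub: "G2_submodule (VV h t) (W m)" if "m \<in> weights" for m
    using that by (simp add: is_L_def G2_irreducible_def)
  have Pm: "P l *v x = (if m = l then x else 0)" if "m \<in> weights" "x \<in> W m" for m x
    using P l that by (simp add: is_projectors_def)
  have comm: "P l ** X = X ** P l" if X: "\<And>m x. m \<in> weights \<Longrightarrow> x \<in> W m \<Longrightarrow> X *v x \<in> W m" for X
    unfolding matrix_eq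
  proof
    fix x :: "complex ^ (7 \<times> 7)"
    obtain f where f: "f \<in> (\<Pi>\<^sub>E l\<in>weights. W l)" "x = (\<Sum>l\<in>weights. f l)"
      using D unfolding G2_decomposition_def by blast
    then have fm: "f m \<in> W m" if "m \<in> weights" for m using that by auto
    have "(P l ** X) *v x = (\<Sum>m\<in>weights. P l *v (X *v f m))"
      by (simp add: f(2) mat_vec_sum matrix_vector_mul_assoc[symmetric])
    also have "\<dots> = (\<Sum>m\<in>weights. X *v (P l *v f m))"
      by (intro sum.cong refl) (simp add: Pm[OF _ X] Pm fm)
    also have "\<dots> = (X ** P l) *v x"
      by (simp add: f(2) mat_vec_sum matrix_vector_mul_assoc[symmetric])
    finally show "(P l ** X) *v x = (X ** P l) *v x" .
  qed
  show "commutes (P l)"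
    unfolding commutes_def using sub unfolding G2_submodule_def by (auto intro!: comm)
  show "commutes (proj l)" by (rule proj_commutes)
  fix m assume m: "m \<in> weights"
  obtain x where x: "x \<in> W m" "highest_weight_vector (h\<^sup>2) (VV h t) m x"
    using L[OF m] unfolding is_L_def by blast
  from highest_weight_vector_sing_vec[OF m x(2)] obtain c where "sing_vec m = c *s x" by blast
  then have "sing_vec m \<in> W m"
    using x(1) sub[OF m] by (simp add: G2_submodule_def vec.subspace_def)
  then show "P l *v sing_vec m = proj l *v sing_vec m"
    using Pm[OF m] by (simp add: proj_sing_vec m l)
qed

lemma R_expl_projectors:
  assumes z: "z \<notin> poles"
  shows "R_expl h t z = (\<Sum>l\<in>weights. eigenvalue l z *\<^sub>c proj l)"
proof (rule commutes_eqI)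
  show "commutes (R_expl h t z)" by (rule R_expl_commutes[OF z])
  show "commutes (\<Sum>l\<in>weights. eigenvalue l z *\<^sub>c proj l)"
    by (intro commutes_sum commutes_smult proj_commutes)
  fix k assume k: "k \<in> weights"
  have "(\<Sum>l\<in>weights. eigenvalue l z *\<^sub>c proj l) *v sing_vec k =
      (\<Sum>l\<in>weights. if k = l then eigenvalue l z *s sing_vec k else 0)"
    unfolding sum_mat_vec by (intro sum.cong refl) (simp add: smult_mat_vec proj_sing_vec k)
  then show "R_expl h t z *v sing_vec k = (\<Sum>l\<in>weights. eigenvalue l z *\<^sub>c proj l) *v sing_vec k"
    using k finite_weights by (simp add: R_expl_sing_vec[OF k z])
qed

section \<open>Uniqueness of the intertwiner\<close>

lemma bas2_sing_vec: "bas2 1 1 = sing_vec twice_om1"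
proof (rule coord_eqI)
  fix i k assume ix: "i \<in> ix" "k \<in> ix"
  have "1 \<in> ix" by (simp add: ix_def)
  note inj = of_nat_ix_inj[OF ix(1) this] of_nat_ix_inj[OF ix(2) this]
  show "coord (bas2 1 1) i k = coord (sing_vec twice_om1) i k"
    unfolding coord_sing_vec[OF ix] sing_coord_simps
    unfolding coord_def bas2_def axis_def
    by (simp add: inj del: of_nat_1)
qed

abbreviation E0_source :: "complex \<Rightarrow> (7 \<times> 7) cmat" where
  "E0_source z \<equiv> Eop (tensor_rep (V_rep h t z) (V_rep h t 1)) 0"

lemma coord_E0:
  assumes "i \<in> ix" "k \<in> ix"
  shows "coord (E0_source z *v x) i k =
    z * row_coeff 1 t 0 i * h powi kexp 0 k * coord x (row_source 0 i) k +
    row_coeff 1 t 0 k * h powi (- kexp 0 i) * coord x i (row_source 0 k)"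
  using coord_tensor_E[of 0 i k h t z 1 x] assms by (simp add: param_def)

text \<open>
  Products of singular vectors with vectors obtained by raising operators of \<open>V(z) \<otimes> V(1)\<close>, from
  \<open>v\<^sub>1 \<otimes> v\<^sub>1\<close> in the first two cases and from \<open>x\<^sub>\<lambda>\<close>, \<open>\<lambda> = \<omega>\<^sub>2\<close>, in the third. The path goes from \<open>2\<omega>\<^sub>1\<close>
  through \<open>\<omega>\<^sub>1\<close> to \<open>\<omega>\<^sub>2\<close> and from there to \<open>\<omega>\<^sub>0\<close>; \<open>E\<^sub>0\<close> is needed at its first and at its last step.
\<close>

lemma bilinear_raise_om1:
  "bilinear (sing_vec om1) (Eop (VV h t) 1 *v (Eop (VV h t) 2 *v (E0_source z *v sing_vec twice_om1))) =
    t * (h ^ 16 - z) / h\<^sup>2"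
  unfolding bilinear_coord ix_def
  by (simp add: coord_sing_vec sing_coord_simps block_def mu_num_def coord_E coord_E0 ix_def row_coeff_def
      row_source_def kexp_def power_int_minus h_nz field_simps flip: power_add)
    algebra

lemma bilinear_raise_om2:
  "bilinear (sing_vec om2) (Eop (VV h t) 2 *v (Eop (VV h t) 1 *v (Eop (VV h t) 1 *v (Eop (VV h t) 2 *v
     (E0_source z *v sing_vec twice_om1))))) = t\<^sup>2 * (h ^ 4 - z) / h"
  unfolding bilinear_coord ix_def
  by (simp add: coord_sing_vec sing_coord_simps coord_E coord_E0 ix_def row_coeff_def
      row_source_def kexp_def power_int_minus h_nz field_simps power2_eq_square)
    algebra

lemma bilinear_raise_om0:
  "bilinear (sing_vec om0) (E0_source z *v sing_vec om2) = (h ^ 4 + 1) * (h ^ 24 - z) / h ^ 3"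
  unfolding bilinear_coord ix_def
  by (simp add: coord_sing_vec sing_coord_simps p_num_def coord_E0 ix_def row_coeff_def
      row_source_def kexp_def power_int_minus h_nz field_simps flip: power_add)

text \<open>
  Let \<open>D\<close> be the difference of the two operators. Its transpose commutes with \<open>U\<^sub>q(G\<^sub>2)\<close> as well, so
  \<open>D\<^sup>T x\<^sub>l = d x\<^sub>l\<close>. If \<open>D y = 0\<close> then \<open>d (x\<^sub>l \<cdot> y) = x\<^sub>l \<cdot> D y = 0\<close>, which gives \<open>d = 0\<close> as soon as
  \<open>x\<^sub>l \<cdot> y \<noteq> 0\<close>. The intertwining property shows \<open>D y = 0\<close> for every \<open>y\<close> that is obtained by
  raising operators from a vector killed by \<open>D\<close>.
\<close>

lemma intertwiner_unique:
  assumes z: "z \<notin> poles" "z \<noteq> 0"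
    and A: "intertwines (tensor_rep (V_rep h t z) (V_rep h t 1)) (tensor_rep (V_rep h t 1) (V_rep h t z)) A"
    and A1: "A *v bas2 1 1 = bas2 1 1"
  shows "A = R_expl h t z"
proof -
  let ?s = "tensor_rep (V_rep h t z) (V_rep h t 1)" and ?t = "tensor_rep (V_rep h t 1) (V_rep h t z)"
  define D where "D = A - R_expl h t z"
  have mem: "twice_om1 \<in> weights" "om2 \<in> weights" "om1 \<in> weights" "om0 \<in> weights"
    by (simp_all add: weights_def)
  have "commutes A"
    unfolding commutes_def
  proof (intro ballI conjI)
    fix g :: nat assume g: "g \<in> {1, 2}"
    then have g2: "g \<le> 2" by auto
    show "A ** Eop (VV h t) g = Eop (VV h t) g ** A" "A ** Fop (VV h t) g = Fop (VV h t) g ** A"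
      using A g2 unfolding intertwines_def by (auto simp: tensor_E_indep[OF g] tensor_F_indep[OF g])
    show "A ** Kh (VV h t) g m = Kh (VV h t) g m ** A" if "m \<in> {2, -2}" for m
      using A g2 that unfolding intertwines_def tensor_K_indep by auto
  qed
  then have D: "commutes D"
    unfolding D_def by (intro commutes_diff R_expl_commutes z)
  have E0: "D *v (E0_source z *v x) = Eop ?t 0 *v (D *v x)" for x
  proof -
    have "D ** E0_source z = Eop ?t 0 ** D"
      using A R_expl_intertwines_E[of 0 z] z(1) unfolding intertwines_def D_def by (simp add: mat_mult_diff)
    then show ?thesis by (simp add: matrix_vector_mul_assoc)
  qed
  have E: "D *v (Eop (VV h t) g *v x) = Eop (VV h t) g *v (D *v x)" if "g \<in> {1, 2}" for g x
  proof -
    have "D ** Eop (VV h t) g = Eop (VV h t) g ** D"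
      using D that unfolding commutes_def by blast
    then show ?thesis by (simp add: matrix_vector_mul_assoc)
  qed
  have kill: "D *v sing_vec l = 0 \<and> transpose D *v sing_vec l = 0"
    if l: "l \<in> weights" and y: "D *v y = 0" "bilinear (sing_vec l) y \<noteq> 0" for l y
  proof -
    obtain d where d: "transpose D *v sing_vec l = d *s sing_vec l"
      using commutes_sing_vec[OF commutes_transpose[OF D] l] by blast
    obtain e where e: "D *v sing_vec l = e *s sing_vec l"
      using commutes_sing_vec[OF D l] by blast
    have "d * bilinear (sing_vec l) x = bilinear (sing_vec l) (D *v x)" for x
      unfolding bilinear_transpose d bilinear_linear ..
    from this[of y] this[of "sing_vec l"] have "d = 0" "e = 0"
      using y bilinear_sing_vec_nz[OF l] by (simp_all add: e bilinear_linear)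
    with d e show ?thesis by simp
  qed
  have v: "D *v sing_vec twice_om1 = 0"
    using A1 R_expl_sing_vec[OF mem(1) z(1)] unfolding bas2_sing_vec D_def
    by (simp add: matrix_vector_mult_diff_rdistrib eigenvalue_def)
  have nz: "h ^ 4 - z \<noteq> 0" "h ^ 16 - z \<noteq> 0" "h ^ 24 - z \<noteq> 0"
    using z(1) by (auto simp: poles_def)
  have 1: "transpose D *v sing_vec twice_om1 = 0"
    using kill[OF mem(1) v] bilinear_sing_vec_nz[OF mem(1)] by blast
  have 2: "transpose D *v sing_vec om1 = 0"
    using kill[OF mem(3), of "Eop (VV h t) 1 *v (Eop (VV h t) 2 *v (E0_source z *v sing_vec twice_om1))"]
    unfolding bilinear_raise_om1 using nz h_nz t_nz by (simp add: E E0 v)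
  have 3: "D *v sing_vec om2 = 0 \<and> transpose D *v sing_vec om2 = 0"
    using kill[OF mem(2), of "Eop (VV h t) 2 *v (Eop (VV h t) 1 *v (Eop (VV h t) 1 *v (Eop (VV h t) 2 *v
      (E0_source z *v sing_vec twice_om1))))"]
    unfolding bilinear_raise_om2 using nz h_nz t_nz by (simp add: E E0 v)
  have 4: "transpose D *v sing_vec om0 = 0"
    using kill[OF mem(4), of "E0_source z *v sing_vec om2"]
    unfolding bilinear_raise_om0 using nz h_nz h_power_ne_minus_1[of 4] 3 by (simp add: E0)
  have "transpose D = 0"
    using commutes_zero[OF commutes_transpose[OF D]] 1 2 3 4 unfolding weights_def by blast
  then have "D = 0" using arg_cong[of _ _ transpose] by (simp add: transpose_def vec_eq_iff)
  then show ?thesis by (simp add: D_def)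
qed


section \<open>Existence of the intertwiner\<close>

lemma R_den_polynomial: "\<exists>D. D \<noteq> 0 \<and> (\<forall>z. R_den h z = poly D z)"
proof -
  have "polynomial_fun (R_den h)"
    unfolding R_den_def by (intro polynomial_fun_intros)
  then obtain D where D: "\<And>z. R_den h z = poly D z" unfolding polynomial_fun_def by blast
  then have "D \<noteq> 0" using R_den_nz[OF zero_not_pole] by auto
  with D show ?thesis by blast
qed

lemma R_num_polynomial: "polynomial_fun (\<lambda>z. R_num h r z i k j l)"
  unfolding R_num_def sl7_num_def S_num_def Q_num_def by (intro polynomial_fun_intros)

lemma R_expl_entry:
  "\<exists>n. \<forall>z. z \<notin> poles \<longrightarrow> R_expl h t z $ x $ y * R_den h z = poly n z"
proof -
  obtain i k where ik: "i \<in> ix" "k \<in> ix" "x = (of_nat i, of_nat k)"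
    using of_nat_ix_surj[of "fst x"] of_nat_ix_surj[of "snd x"] by (metis prod.collapse)
  obtain j l where jl: "j \<in> ix" "l \<in> ix" "y = (of_nat j, of_nat l)"
    using of_nat_ix_surj[of "fst y"] of_nat_ix_surj[of "snd y"] by (metis prod.collapse)
  obtain n where n: "\<And>z. R_num h (h * t) z i k j l = poly n z"
    using R_num_polynomial unfolding polynomial_fun_def by blast
  have "R_expl h t z $ x $ y * R_den h z = poly n z" if "z \<notin> poles" for z
    using entry_R_expl[OF ik(1,2) jl(1,2) that] R_den_nz[OF that]
    unfolding n entry_def ik(3) jl(3) by simp
  then show ?thesis by blast
qed

lemma almost_all_regular: "\<forall>\<^sub>\<infinity>z. z \<notin> poles \<and> z \<noteq> 0"
proof -
  have "{z. \<not> (z \<notin> poles \<and> z \<noteq> 0)} = insert 0 poles" by auto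
  then show ?thesis by (simp add: MOST_iff_cofinite poles_def)
qed

lemma normalized_intertwiner_eq:
  assumes R: "normalized_intertwiner h t R" and z: "z \<notin> poles"
  shows "R z = R_expl h t z"
proof -
  obtain D where D: "\<And>z. R_den h z = poly D z" using R_den_polynomial by blast
  have ae: "\<forall>\<^sub>\<infinity>z. z \<notin> poles \<and> R z = R_expl h t z"
    using almost_all_regular conjunct2[OF R[unfolded normalized_intertwiner_def]]
    by eventually_elim (blast intro: intertwiner_unique)
  have "R z $ x $ y = R_expl h t z $ x $ y" for x y
  proof -
    obtain n where n: "\<And>z. z \<notin> poles \<Longrightarrow> R_expl h t z $ x $ y * R_den h z = poly n z"
      using R_expl_entry by blast
    have "rational_fun (\<lambda>z. R z $ x $ y)"
      using R unfolding normalized_intertwiner_def by blast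
    moreover have "\<forall>\<^sub>\<infinity>z. R z $ x $ y * poly D z = poly n z"
      using ae by eventually_elim (simp add: n flip: D)
    moreover have "poly D z \<noteq> 0" using R_den_nz[OF z] by (simp add: D)
    ultimately have "R z $ x $ y = poly n z / poly D z"
      by (rule rational_fun_eqI)
    then show ?thesis
      unfolding n[OF z, symmetric] using R_den_nz[OF z] by (simp flip: D)
  qed
  then show ?thesis by (simp add: vec_eq_iff)
qed

text \<open>
  The entries of the explicit matrix are reduced to lowest terms, which keeps their values outside
  the three possible poles.
\<close>

lemma normalized_intertwiner_exists: "\<exists>R. normalized_intertwiner h t R"
proof -
  obtain D where D: "D \<noteq> 0" "\<And>z. R_den h z = poly D z" using R_den_polynomial by blast
  have "\<exists>f. rational_fun f \<and> (\<forall>z. z \<notin> poles \<longrightarrow> f z = R_expl h t z $ x $ y)" for x y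
  proof -
    obtain n where n: "\<And>z. z \<notin> poles \<Longrightarrow> R_expl h t z $ x $ y * R_den h z = poly n z"
      using R_expl_entry by blast
    obtain f where f: "rational_fun f" "\<And>z. poly D z \<noteq> 0 \<Longrightarrow> f z = poly n z / poly D z"
      using rational_fun_exists[OF D(1)] by blast
    have "f z = R_expl h t z $ x $ y" if "z \<notin> poles" for z
      using f(2)[of z] n[OF that] R_den_nz[OF that] by (simp add: D(2) nonzero_divide_eq_eq)
    with f(1) show ?thesis by blast
  qed
  then obtain f where f: "\<And>x y. rational_fun (f x y)"
    "\<And>x y z. z \<notin> poles \<Longrightarrow> f x y z = R_expl h t z $ x $ y" by metis
  define R where "R z = (\<chi> x y. f x y z)" for z
  have R: "R z = R_expl h t z" if "z \<notin> poles" for z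
    using f(2)[OF that] by (simp add: R_def vec_eq_iff)
  have "\<forall>\<^sub>\<infinity>z. intertwines (tensor_rep (V_rep h t z) (V_rep h t 1)) (tensor_rep (V_rep h t 1) (V_rep h t z)) (R z) \<and>
      R z *v bas2 1 1 = bas2 1 1"
    using almost_all_regular
  proof eventually_elim
    case (elim z)
    have "R_expl h t z *v sing_vec twice_om1 = sing_vec twice_om1"
      using R_expl_sing_vec[of twice_om1 z] elim by (simp add: weights_def eigenvalue_def)
    with elim show ?case
      by (simp add: R R_expl_intertwines bas2_sing_vec)
  qed
  moreover have "rational_fun (\<lambda>z. R z $ x $ y)" for x y
    by (simp add: R_def f(1))
  ultimately show ?thesis unfolding normalized_intertwiner_def by blast
qed

lemma normalized_intertwiner_unique:
  assumes R: "normalized_intertwiner h t R" and R': "normalized_intertwiner h t R'"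
  shows "R = R'"
proof -
  have "(\<lambda>z. R z $ x $ y) = (\<lambda>z. R' z $ x $ y)" for x y
  proof (rule rational_fun_unique)
    show "rational_fun (\<lambda>z. R z $ x $ y)" "rational_fun (\<lambda>z. R' z $ x $ y)"
      using R R' unfolding normalized_intertwiner_def by blast+
    show "\<forall>\<^sub>\<infinity>z. R z $ x $ y = R' z $ x $ y"
      using almost_all_regular
      by eventually_elim (simp add: normalized_intertwiner_eq[OF R] normalized_intertwiner_eq[OF R'])
  qed
  then show ?thesis by (simp add: fun_eq_iff vec_eq_iff)
qed

lemma eigenvalue_q:
  "eigenvalue twice_om1 z = 1"
  "eigenvalue om2 z = - ((h\<^sup>2) powi (-2) * ((1 - (h\<^sup>2) ^ 2 * z) / (1 - (h\<^sup>2) powi (-2) * z)))"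
  "eigenvalue om1 z = - ((h\<^sup>2) powi (-8) * ((1 - (h\<^sup>2) ^ 8 * z) / (1 - (h\<^sup>2) powi (-8) * z)))"
  "eigenvalue om0 z = (h\<^sup>2) powi (-14) * (((1 - (h\<^sup>2) ^ 2 * z) * (1 - (h\<^sup>2) ^ 12 * z)) /
     ((1 - (h\<^sup>2) powi (-2) * z) * (1 - (h\<^sup>2) powi (-12) * z)))"
proof -
  have i: "inverse x * (y / (1 - inverse x * z)) = y / (x - z)" if "x \<noteq> 0" for x y :: complex
  proof -
    have "x - z = x * (1 - inverse x * z)" using that by (simp add: algebra_simps)
    then show ?thesis by (simp add: divide_inverse mult_ac)
  qed
  have hp: "(h\<^sup>2) powi (-2) = inverse (h ^ 4)" "(h\<^sup>2) powi (-8) = inverse (h ^ 16)"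
    "(h\<^sup>2) powi (-12) = inverse (h ^ 24)" "(h\<^sup>2) powi (-14) = inverse (h ^ 4) * inverse (h ^ 24)"
    "(h\<^sup>2)\<^sup>2 = h ^ 4" "(h\<^sup>2) ^ 8 = h ^ 16" "(h\<^sup>2) ^ 12 = h ^ 24"
    by (simp_all add: powi_neg flip: power_mult power_add inverse_mult_distrib)
  have nz: "h ^ 4 \<noteq> 0" "h ^ 16 \<noteq> 0" "h ^ 24 \<noteq> 0" using h_nz by simp_all
  show "eigenvalue twice_om1 z = 1" by (simp add: eigenvalue_def)
  show "eigenvalue om2 z = - ((h\<^sup>2) powi (-2) * ((1 - (h\<^sup>2) ^ 2 * z) / (1 - (h\<^sup>2) powi (-2) * z)))"
    unfolding hp i[OF nz(1)] using weights_distinct by (simp add: eigenvalue_def)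
  show "eigenvalue om1 z = - ((h\<^sup>2) powi (-8) * ((1 - (h\<^sup>2) ^ 8 * z) / (1 - (h\<^sup>2) powi (-8) * z)))"
    unfolding hp i[OF nz(2)] using weights_distinct by (simp add: eigenvalue_def)
  have "inverse (h ^ 4) * inverse (h ^ 24) * ((x * y) / ((1 - inverse (h ^ 4) * z) * (1 - inverse (h ^ 24) * z))) =
      (x / (h ^ 4 - z)) * (y / (h ^ 24 - z))" for x y
    unfolding i[OF nz(1), symmetric] i[OF nz(3), symmetric] by (simp add: divide_inverse mult_ac)
  then show "eigenvalue om0 z = (h\<^sup>2) powi (-14) * (((1 - (h\<^sup>2) ^ 2 * z) * (1 - (h\<^sup>2) ^ 12 * z)) /
     ((1 - (h\<^sup>2) powi (-2) * z) * (1 - (h\<^sup>2) powi (-12) * z)))"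
    unfolding hp using weights_distinct by (simp add: eigenvalue_def)
qed

lemma sum_weights: "(\<Sum>l\<in>weights. f l) = f twice_om1 + f om2 + f om1 + f om0"
  for f :: "nat \<times> nat \<Rightarrow> 'b :: comm_monoid_add"
  using weights_distinct by (simp add: weights_def add.assoc)

end

theorem theorem5p11:
  fixes q h t :: complex
  assumes "q \<noteq> 0" and "\<forall>n::nat. n > 0 \<longrightarrow> q ^ n \<noteq> 1"
    and "h\<^sup>2 = q" and "t\<^sup>2 = q + inverse q"
  defines "\<Lambda> \<equiv> {twice_om1, om2, om1, om0}"
  shows "(\<exists>!R. normalized_intertwiner h t R) \<and>
    (\<exists>W P. G2_decomposition q (VV h t) \<Lambda> W \<and> is_projectors \<Lambda> W P) \<and>
    (\<forall>R. normalized_intertwiner h t R \<longrightarrow>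
      (\<forall>z. z \<notin> {q ^ 2, q ^ 8, q ^ 12} \<longrightarrow>
        (\<forall>W P. G2_decomposition q (VV h t) \<Lambda> W \<and> is_projectors \<Lambda> W P \<longrightarrow>
          R z = P twice_om1
            - (q powi (-2) * ((1 - q ^ 2 * z) / (1 - q powi (-2) * z))) *\<^sub>c P om2
            - (q powi (-8) * ((1 - q ^ 8 * z) / (1 - q powi (-8) * z))) *\<^sub>c P om1
            + (q powi (-14) * (((1 - q ^ 2 * z) * (1 - q ^ 12 * z)) /
                 ((1 - q powi (-2) * z) * (1 - q powi (-12) * z)))) *\<^sub>c P om0) \<and>
        R z = R_sl7 q z
          + ((q - q powi (-1)) * (1 - z) /
              ((q - q powi (-1) * z) * (q ^ 4 - q powi (-4) * z))) *\<^sub>c S_op h t z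
          - ((q - q powi (-1)) * (q ^ 2 + q powi (-2)) * (1 - z) /
              ((q - q powi (-1) * z) * (q ^ 6 - q powi (-6) * z))) *\<^sub>c Q_op q z))"
proof -
  interpret G2_parameters h t
    using assms(1-4) by unfold_locales auto
  have q: "q = h\<^sup>2" by (rule assms(3)[symmetric])
  have \<Lambda>: "\<Lambda> = weights" by (simp add: \<Lambda>_def weights_def)
  have poles: "{(h\<^sup>2) ^ 2, (h\<^sup>2) ^ 8, (h\<^sup>2) ^ 12} = poles"
    by (simp add: poles_def flip: power_mult)
  show ?thesis
    unfolding q \<Lambda> poles
  proof (intro conjI allI impI)
    show "\<exists>!R. normalized_intertwiner h t R"
      using normalized_intertwiner_exists normalized_intertwiner_unique by blast
    show "\<exists>W P. G2_decomposition (h\<^sup>2) (VV h t) weights W \<and> is_projectors weights W P"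
      using component_decomposition proj_is_projectors by blast
  next
    fix R z W P
    assume R: "normalized_intertwiner h t R" and z: "z \<notin> poles"
      and WP: "G2_decomposition (h\<^sup>2) (VV h t) weights W \<and> is_projectors weights W P"
    have P: "P l = proj l" if "l \<in> weights" for l
      using projectors_unique that WP by blast
    have mem: "twice_om1 \<in> weights" "om2 \<in> weights" "om1 \<in> weights" "om0 \<in> weights"
      by (simp_all add: weights_def)
    have "R z = (\<Sum>l\<in>weights. eigenvalue l z *\<^sub>c proj l)"
      using normalized_intertwiner_eq[OF R z] R_expl_projectors[OF z] by simp
    then show "R z = P twice_om1
            - ((h\<^sup>2) powi (-2) * ((1 - (h\<^sup>2) ^ 2 * z) / (1 - (h\<^sup>2) powi (-2) * z))) *\<^sub>c P om2
            - ((h\<^sup>2) powi (-8) * ((1 - (h\<^sup>2) ^ 8 * z) / (1 - (h\<^sup>2) powi (-8) * z))) *\<^sub>c P om1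
            + ((h\<^sup>2) powi (-14) * (((1 - (h\<^sup>2) ^ 2 * z) * (1 - (h\<^sup>2) ^ 12 * z)) /
                 ((1 - (h\<^sup>2) powi (-2) * z) * (1 - (h\<^sup>2) powi (-12) * z)))) *\<^sub>c P om0"
      unfolding sum_weights eigenvalue_q smult_mat_scalar P[OF mem(1)] P[OF mem(2)] P[OF mem(3)] P[OF mem(4)]
      by (simp only: diff_conv_add_uminus)
  next
    fix R z
    assume R: "normalized_intertwiner h t R" and z: "z \<notin> poles"
    show "R z = R_sl7 (h\<^sup>2) z
          + ((h\<^sup>2 - (h\<^sup>2) powi (-1)) * (1 - z) /
              ((h\<^sup>2 - (h\<^sup>2) powi (-1) * z) * ((h\<^sup>2) ^ 4 - (h\<^sup>2) powi (-4) * z))) *\<^sub>c S_op h t z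
          - ((h\<^sup>2 - (h\<^sup>2) powi (-1)) * ((h\<^sup>2) ^ 2 + (h\<^sup>2) powi (-2)) * (1 - z) /
              ((h\<^sup>2 - (h\<^sup>2) powi (-1) * z) * ((h\<^sup>2) ^ 6 - (h\<^sup>2) powi (-6) * z))) *\<^sub>c Q_op (h\<^sup>2) z"
      using normalized_intertwiner_eq[OF R z] unfolding R_expl_def Let_def .
  qed
qed

end
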